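(* Let $\mathcal{H}$ be a Hilbert space of dimension at least two, let $R>0$, let $A\subset\mathcal{H}$ be an $R$-proximally smooth set, and let $a,b\in A$ be two distinct points with $|a-b|<2R$. Then a shortest curve in $A$ between $a$ and $b$ exists and is unique (up to reparametrization). Moreover, (the image of) the shortest curve is an $R$-proximally smooth set, and its length is at most the length of the shortest arc of a circle of radius $R$ passing through $a$ and $b$, i.e. at most $2R\arcsin\frac{|a-b|}{2R}$.
   Context: $|\cdot|$ is the norm of $\mathcal{H}$. For a set $A$, $\operatorname{dist}(x,A)=\inf_{y\in A}|x-y|$. A set $A$ is $R$-proximally smooth if it is closed and the function $x\mapsto \operatorname{dist}(x,A)$ is continuously differentiable on $\{x: 0<\operatorname{dist}(x,A)<R\}$. A curve is a continuous map from a non-degenerate segment of $\mathbb{R}$; its length is its total variation (supremum of lengths of inscribed polylines). A curve in $A$ between $a$ and $b$ is a curve with values in $A$ and endpoints $a$ and $b$; it is shortest if its length is finite and minimal among all such curves. *)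

theory Defs
  imports "HOL-Analysis.Analysis"
begin

(* Continuity of the derivative is with respect to the operator norm, as f' is blinfun-valued. *)
definition continuously_differentiable_on ::
    "('a::real_normed_vector \<Rightarrow> 'b::real_normed_vector) \<Rightarrow> 'a set \<Rightarrow> bool"
  where "continuously_differentiable_on f U \<longleftrightarrow>
    (\<exists>f' :: 'a \<Rightarrow> 'a \<Rightarrow>\<^sub>L 'b.
       (\<forall>x\<in>U. (f has_derivative blinfun_apply (f' x)) (at x)) \<and> continuous_on U f')"

definition proximally_smooth :: "real \<Rightarrow> 'a::real_normed_vector set \<Rightarrow> bool"
  where "proximally_smooth R A \<longleftrightarrow>
    closed A \<and>
    continuously_differentiable_on (\<lambda>x. infdist x A) {x. 0 < infdist x A \<and> infdist x A < R}"

(* A curve is represented by the endpoints s < t of its parameter segment and a function g,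
   of which only the restriction to {s..t} matters. *)
definition curve :: "real \<Rightarrow> real \<Rightarrow> (real \<Rightarrow> 'a::topological_space) \<Rightarrow> bool"
  where "curve s t g \<longleftrightarrow> s < t \<and> continuous_on {s..t} g"

definition curve_length :: "real \<Rightarrow> real \<Rightarrow> (real \<Rightarrow> 'a::metric_space) \<Rightarrow> ennreal"
  where "curve_length s t g =
    Sup {ennreal (\<Sum>i<n. dist (g (p i)) (g (p (Suc i)))) | (p :: nat \<Rightarrow> real) n.
           mono_on {..n} p \<and> p ` {..n} \<subseteq> {s..t}}"

definition curve_between ::
    "'a::topological_space set \<Rightarrow> 'a \<Rightarrow> 'a \<Rightarrow> real \<Rightarrow> real \<Rightarrow> (real \<Rightarrow> 'a) \<Rightarrow> bool"
  where "curve_between A a b s t g \<longleftrightarrow>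
    curve s t g \<and> g ` {s..t} \<subseteq> A \<and> g s = a \<and> g t = b"

definition shortest_curve ::
    "'a::metric_space set \<Rightarrow> 'a \<Rightarrow> 'a \<Rightarrow> real \<Rightarrow> real \<Rightarrow> (real \<Rightarrow> 'a) \<Rightarrow> bool"
  where "shortest_curve A a b s t g \<longleftrightarrow>
    curve_between A a b s t g \<and> curve_length s t g < \<infinity> \<and>
    (\<forall>s' t' g'. curve_between A a b s' t' g' \<longrightarrow> curve_length s t g \<le> curve_length s' t' g')"

definition reparametrization_of ::
    "real \<Rightarrow> real \<Rightarrow> (real \<Rightarrow> 'a) \<Rightarrow> real \<Rightarrow> real \<Rightarrow> (real \<Rightarrow> 'a) \<Rightarrow> bool"
  where "reparametrization_of s t g u v h \<longleftrightarrow>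
    (\<exists>\<phi>. continuous_on {s..t} \<phi> \<and> mono_on {s..t} \<phi> \<and> \<phi> ` {s..t} = {u..v} \<and>
         (\<forall>x\<in>{s..t}. g x = h (\<phi> x)))"

(* A change of parameter may be constant on subintervals, because a shortest curve may pause.
   The symmetric relation is obtained by passing through a common curve h. *)
definition same_up_to_reparametrization ::
    "real \<Rightarrow> real \<Rightarrow> (real \<Rightarrow> 'a::topological_space) \<Rightarrow>
     real \<Rightarrow> real \<Rightarrow> (real \<Rightarrow> 'a) \<Rightarrow> bool"
  where "same_up_to_reparametrization s1 t1 g1 s2 t2 g2 \<longleftrightarrow>
    (\<exists>u v h. curve u v h \<and>
       reparametrization_of s1 t1 g1 u v h \<and> reparametrization_of s2 t2 g2 u v h)"

(* The circle has centre c and lies in the plane c + span {e, f}, with e, f orthonormal;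
   the parameter is the angle. *)
definition circle_arc_between ::
    "real \<Rightarrow> 'a::real_inner \<Rightarrow> 'a \<Rightarrow> real \<Rightarrow> real \<Rightarrow> (real \<Rightarrow> 'a) \<Rightarrow> bool"
  where "circle_arc_between R a b s t g \<longleftrightarrow>
    s < t \<and> t - s \<le> 2 * pi \<and> g s = a \<and> g t = b \<and>
    (\<exists>c e f. norm e = 1 \<and> norm f = 1 \<and> e \<bullet> f = 0 \<and>
       (\<forall>x\<in>{s..t}. g x = c + (R * cos x) *\<^sub>R e + (R * sin x) *\<^sub>R f))"

definition shortest_circle_arc ::
    "real \<Rightarrow> 'a::real_inner \<Rightarrow> 'a \<Rightarrow> real \<Rightarrow> real \<Rightarrow> (real \<Rightarrow> 'a) \<Rightarrow> bool"
  where "shortest_circle_arc R a b s t g \<longleftrightarrow>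
    circle_arc_between R a b s t g \<and>
    (\<forall>s' t' g'. circle_arc_between R a b s' t' g' \<longrightarrow> curve_length s t g \<le> curve_length s' t' g')"

end

(*
  Let d be the distance to A. Where 0 < d < R it is differentiable with slope one, and by Ekeland's
  principle it grows at unit rate along the normal ray through x up to the value R. Hence x has a
  nearest point p in A and 2R <y - p, x - p> <= |x - p| |y - p|^2 for all y in A. Conversely a closed
  set with such nearest points is R-proximally smooth, since the projection is locally Lipschitz.

  Projecting a segment to A gives a path whose length exceeds that of the segment only to second
  order; bisecting repeatedly, with projected midpoints, gives the bound 2R arcsin(|a - b| / 2R) < pi R.

  Move a path x of length l towards another path y in A by eps eta (y - x) and project back. To first
  order in eps the energy of a shortest x cannot decrease:
    2 int <x', (eta (y - x))'> + (l/R)^2 int eta |y - x|^2 >= 0.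
  With eta = 1, added to the same inequality with x and y exchanged, this contradicts Wirtinger's
  inequality unless x = y, because l < pi R. The quantitative version for almost shortest paths makes
  minimizing sequences converge. With y constant it says that psi = R^2 - |y - x|^2 / 2 satisfies
  psi'' + (l/R)^2 psi <= 0 weakly, so psi lies above the sine with the same end values. For y = q, the
  end point of x, this bounds the angle between the chord and the tangent at the starting point p, and
  the inequality for nearest points follows for the image of x. As x need not be differentiable,
  derivatives are replaced by differences on fine grids.
*)
theory Submission
  imports Defs
begin

text \<open>Balls of a Hilbert space are not compact, so neither nearest points in A nor shortest
  curves can be had from convergent subsequences. Both are limits of Cauchy sequences: almost
  optimal directions by the parallelogram law, almost shortest paths by a quantitative first
  variation, which thus yields existence together with uniqueness. The nearest-point map has
  Lipschitz constant 1/(1 - (d(x) + d(y))/(2R)) between points x and y, where d is the distance to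
  A. A path is moved towards another path in A because the point at the fraction \<tau> of a segment
  with end points in A has distance at most \<tau>|y - x|^2/(2R) from A. Together these two facts
  bring the factor 1/R^2 into the variation. Energy replaces length because its variation is
  bilinear, so that the mixed terms of two variations can be added exactly. The threshold pi R is
  where the first Dirichlet eigenvalue (pi/l)^2 of an interval of length l meets 1/R^2. On grids
  with N steps the displacement \<epsilon> stays fixed while N grows; its quadratic error is dealt
  with separately, by choosing \<epsilon> small or by a second limit.\<close>

section \<open>Nearest points\<close>

text \<open>The last condition says that the open ball of radius $R$ which touches $A$ at $p$ from the side
  of $x$ does not meet $A$.\<close>

definition foot :: "real \<Rightarrow> 'a::real_inner set \<Rightarrow> 'a \<Rightarrow> 'a \<Rightarrow> bool"
  where "foot R A x p \<longleftrightarrow> p \<in> A \<and> norm (x - p) = infdist x A \<and>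
    (\<forall>y\<in>A. 2 * R * ((y - p) \<bullet> (x - p)) \<le> norm (x - p) * (norm (y - p))\<^sup>2)"

definition has_feet :: "real \<Rightarrow> 'a::real_inner set \<Rightarrow> bool"
  where "has_feet R A \<longleftrightarrow> (\<forall>x. infdist x A < R \<longrightarrow> (\<exists>p. foot R A x p))"

section \<open>Directions of steepest ascent of a differentiable 1-Lipschitz function\<close>

lemma norm_diff_le_functional:
  fixes D :: "'a::real_inner \<Rightarrow> real"
  assumes "linear D" "\<And>v. \<bar>D v\<bar> \<le> norm v" "norm u \<le> 1" "norm v \<le> 1"
  shows "(norm (u - v))\<^sup>2 \<le> 4 - (D u + D v)\<^sup>2"
proof -
  have "(norm (u - v))\<^sup>2 + (norm (u + v))\<^sup>2 = 2 * (norm u)\<^sup>2 + 2 * (norm v)\<^sup>2"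
    by (simp add: power2_norm_eq_inner inner_add inner_diff inner_commute)
  moreover have "(D u + D v)\<^sup>2 \<le> (norm (u + v))\<^sup>2"
    using assms(2)[of "u + v"] linear_add[OF assms(1), of u v]
    by (metis abs_norm_cancel abs_le_square_iff)
  moreover have "(norm u)\<^sup>2 \<le> 1" "(norm v)\<^sup>2 \<le> 1"
    using assms(3,4) by (simp_all add: power_le_one)
  ultimately show ?thesis by linarith
qed

text \<open>The unit ball is uniformly convex: two of its vectors on which a functional of norm at
  most one is almost one have a sum of length almost two, hence a small difference. This replaces
  compactness of the unit sphere.\<close>

lemma Cauchy_maximizing_directions:
  fixes D :: "'a::real_inner \<Rightarrow> real"
  assumes "linear D" "\<And>v. \<bar>D v\<bar> \<le> norm v" "\<And>n. norm (u n) \<le> 1"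
    "(\<lambda>n. D (u n)) \<longlonglongrightarrow> 1"
  shows "Cauchy u"
proof (rule metric_CauchyI)
  fix e :: real assume "e > 0"
  \<comment> \<open>The value is read off from 4 - (2 - 2r)^2 <= 8r; the bound \<open>r\<close> <= 1
    keeps 2 - 2r nonnegative for squaring.\<close>
  define r where "r = min 1 (e\<^sup>2 / 8)"
  have r: "0 < r" "r \<le> 1" "r \<le> e\<^sup>2 / 8" using \<open>e > 0\<close> by (auto simp: r_def)
  obtain M where M: "\<And>n. n \<ge> M \<Longrightarrow> \<bar>D (u n) - 1\<bar> < r"
    using LIMSEQ_D[OF assms(4) r(1)] by auto
  have "dist (u m) (u n) < e" if "m \<ge> M" "n \<ge> M" for m n
  proof -
    have "D (u m) + D (u n) > 2 - 2 * r" using M[OF that(1)] M[OF that(2)] by linarith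
    then have "(2 - 2 * r)\<^sup>2 < (D (u m) + D (u n))\<^sup>2"
      using r by (intro power_strict_mono) auto
    then have "(norm (u m - u n))\<^sup>2 < 4 - (2 - 2 * r)\<^sup>2"
      using norm_diff_le_functional[OF assms(1,2) assms(3)[of m] assms(3)[of n]] by linarith
    also have "\<dots> \<le> 8 * r" by (simp add: power2_eq_square algebra_simps)
    also have "\<dots> \<le> e\<^sup>2" using r by simp
    finally show ?thesis using \<open>e > 0\<close> by (simp add: dist_norm power_less_imp_less_base)
  qed
  then show "\<exists>M. \<forall>m\<ge>M. \<forall>n\<ge>M. dist (u m) (u n) < e" by blast
qed

lemma has_derivative_real_bound:
  fixes f :: "'a::real_normed_vector \<Rightarrow> real"
  assumes "(f has_derivative D) (at x)" "e > 0"
  obtains d where "d > 0" "\<And>y. norm (y - x) < d \<Longrightarrow> \<bar>f y - f x - D (y - x)\<bar> \<le> e * norm (y - x)"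
proof -
  have "\<exists>d>0. \<forall>y. norm (y - x) < d \<longrightarrow> \<bar>f y - f x - D (y - x)\<bar> \<le> e * norm (y - x)"
    using assms by (simp add: has_derivative_at_alt)
  then show thesis using that by blast
qed

lemma derivative_one_lipschitz:
  fixes f :: "'a::real_normed_vector \<Rightarrow> real"
  assumes der: "(f has_derivative D) (at x)" and lip: "\<And>u v. \<bar>f u - f v\<bar> \<le> norm (u - v)"
  shows "\<bar>D v\<bar> \<le> norm v"
proof (cases "v = 0")
  case True
  then show ?thesis using der has_derivative_linear linear_0 by fastforce
next
  case False
  have lin: "linear D" using der has_derivative_linear by blast
  show ?thesis
  proof (rule field_le_epsilon)
    fix e :: real assume "e > 0"
    define e' where "e' = e / norm v"
    have e': "e' > 0" using \<open>e > 0\<close> False by (simp add: e'_def)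
    obtain d where d: "d > 0" "\<And>y. norm (y - x) < d \<Longrightarrow>
        \<bar>f y - f x - D (y - x)\<bar> \<le> e' * norm (y - x)"
      using has_derivative_real_bound[OF der e'] by metis
    define t where "t = d / (2 * norm v)"
    have t: "t > 0" "t * norm v < d" using d(1) False by (auto simp: t_def)
    have "\<bar>f (x + t *\<^sub>R v) - f x - t * D v\<bar> \<le> e' * (t * norm v)"
      using d(2)[of "x + t *\<^sub>R v"] t by (simp add: linear_scale[OF lin])
    moreover have "\<bar>f (x + t *\<^sub>R v) - f x\<bar> \<le> t * norm v"
      using lip[of "x + t *\<^sub>R v" x] t by simp
    ultimately have "\<bar>t * D v\<bar> \<le> t * norm v + e' * (t * norm v)" by linarith
    then have "t * \<bar>D v\<bar> \<le> t * (norm v + e' * norm v)"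
      using t by (simp add: abs_mult algebra_simps)
    then have "\<bar>D v\<bar> \<le> norm v + e' * norm v" using t by simp
    then show "\<bar>D v\<bar> \<le> norm v + e" using False by (simp add: e'_def)
  qed
qed

text \<open>The gain misses the step length \<open>\<tau> n\<close> by
  \<open>(\<tau> n)\<^sup>2\<close> only. After division by \<open>\<tau> n\<close> this loss and
  the error of differentiability both become small, although the direction varies with n; the upper
  bound is the Lipschitz condition.\<close>

lemma steep_directions_maximize:
  fixes f :: "'a::real_normed_vector \<Rightarrow> real"
  assumes der: "(f has_derivative D) (at x)" and lip: "\<And>u v. \<bar>f u - f v\<bar> \<le> norm (u - v)"
    and u: "\<And>n. norm (u n) \<le> 1" and \<tau>: "\<And>n. \<tau> n > 0" "\<tau> \<longlonglongrightarrow> 0"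
    and steep: "\<And>n. f (x + \<tau> n *\<^sub>R u n) \<ge> f x + \<tau> n - (\<tau> n)\<^sup>2"
  shows "(\<lambda>n. D (u n)) \<longlonglongrightarrow> 1"
proof (rule LIMSEQ_I)
  fix e :: real assume "e > 0"
  have lin: "linear D" using der has_derivative_linear by blast
  obtain d where d: "d > 0" "\<And>y. norm (y - x) < d \<Longrightarrow>
      \<bar>f y - f x - D (y - x)\<bar> \<le> e / 2 * norm (y - x)"
    using has_derivative_real_bound[OF der half_gt_zero[OF \<open>e > 0\<close>]] by metis
  obtain M where M: "\<And>n. n \<ge> M \<Longrightarrow> \<tau> n < min d (e / 2)"
    using LIMSEQ_D[OF \<tau>(2), of "min d (e / 2)"] d(1) \<open>e > 0\<close> by fastforce
  have "norm (D (u n) - 1) < e" if "n \<ge> M" for n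
  proof -
    have "norm (\<tau> n *\<^sub>R u n) \<le> \<tau> n" using u[of n] \<tau>(1)[of n] by (simp add: mult_left_le)
    moreover have "\<tau> n < d" using M[OF that] by simp
    ultimately have "\<bar>f (x + \<tau> n *\<^sub>R u n) - f x - \<tau> n * D (u n)\<bar> \<le> e / 2 * \<tau> n"
      using d(2)[of "x + \<tau> n *\<^sub>R u n"] mult_left_mono[of "norm (\<tau> n *\<^sub>R u n)" "\<tau> n" "e / 2"] \<open>e > 0\<close>
      unfolding linear_scale[OF lin] add_diff_cancel_left' real_scaleR_def by linarith
    then have "\<tau> n * D (u n) \<ge> \<tau> n - (\<tau> n)\<^sup>2 - e / 2 * \<tau> n" using steep[of n] by linarith
    then have "\<tau> n * D (u n) \<ge> \<tau> n * (1 - \<tau> n - e / 2)"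
      by (simp add: power2_eq_square algebra_simps)
    then have "D (u n) \<ge> 1 - \<tau> n - e / 2" using \<tau>(1)[of n] by simp
    moreover have "D (u n) \<le> 1"
      using derivative_one_lipschitz[OF der lip, of "u n"] u[of n] by linarith
    ultimately show ?thesis using M[OF that] by simp
  qed
  then show "\<exists>no. \<forall>n\<ge>no. norm (D (u n) - 1) < e" by blast
qed

text \<open>Used twice: for minus the distance to A, where the limit points to the nearest point,
  and for the distance itself, where it is the outward normal.\<close>

lemma steep_directions_converge:
  fixes f :: "'a::{real_inner,banach} \<Rightarrow> real"
  assumes der: "(f has_derivative D) (at x)" and lip: "\<And>u v. \<bar>f u - f v\<bar> \<le> norm (u - v)"
    and u: "\<And>n. norm (u n) = 1" and \<tau>: "\<And>n. \<tau> n > 0" "\<tau> \<longlonglongrightarrow> 0"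
    and steep: "\<And>n. f (x + \<tau> n *\<^sub>R u n) \<ge> f x + \<tau> n - (\<tau> n)\<^sup>2"
  obtains e where "u \<longlonglongrightarrow> e" "norm e = 1" "D e = 1"
proof -
  have Du: "(\<lambda>n. D (u n)) \<longlonglongrightarrow> 1"
    by (rule steep_directions_maximize[OF der lip _ \<tau> steep]) (simp add: u)
  have "Cauchy u"
    by (rule Cauchy_maximizing_directions[OF has_derivative_linear[OF der] derivative_one_lipschitz[OF der lip] _ Du])
       (simp add: u)
  then obtain e where e: "u \<longlonglongrightarrow> e" using Cauchy_convergent convergent_def by blast
  have "norm e = 1" using tendsto_norm[OF e] u by (simp add: LIMSEQ_const_iff)
  moreover have "D e = 1"
    using bounded_linear.tendsto[OF has_derivative_bounded_linear[OF der] e] Du LIMSEQ_unique by blast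
  ultimately show thesis using that e by blast
qed

section \<open>From a smooth distance function to touching balls of radius R\<close>

lemma infdist_one_lipschitz: "\<bar>infdist u A - infdist v A\<bar> \<le> norm (u - v)"
  using infdist_triangle[of u A v] infdist_triangle[of v A u]
  by (simp add: dist_norm norm_minus_commute abs_le_iff)

text \<open>A bounded function need not attain its maximum here. Call z better than y if z lies in
  \<open>S y\<close>, that is, if f gains at least c times the distance. Almost maximal choices in
  successive sets \<open>S (v n)\<close> form a Cauchy sequence, since their distances are
  controlled by the increments of a bounded increasing sequence, and nothing is better than the
  limit.\<close>

lemma ekeland:
  fixes f :: "'a::complete_space \<Rightarrow> real"
  assumes cont: "continuous_on UNIV f" and bdd: "\<And>z. f z \<le> M" and c: "c > 0"
  shows "\<exists>v. f x + c * dist v x \<le> f v \<and> (\<forall>w. w \<noteq> v \<longrightarrow> f w < f v + c * dist w v)"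
proof -
  define S where "S y = {z. f y + c * dist z y \<le> f z}" for y
  have S_self: "y \<in> S y" for y by (simp add: S_def)
  have S_trans: "w \<in> S y" if "w \<in> S z" "z \<in> S y" for w z y
  proof -
    have "c * dist w y \<le> c * dist w z + c * dist z y"
      using mult_left_mono[OF dist_triangle[of w y z], of c] c by (simp add: algebra_simps)
    then show ?thesis using that by (auto simp: S_def)
  qed
  have step: "\<exists>z\<in>S y. \<forall>w\<in>S y. f w \<le> f z + 1 / 2 ^ n" for y and n :: nat
  proof -
    have bd: "bdd_above (f ` S y)" using bdd by (intro bdd_aboveI2[of _ _ M])
    have "Sup (f ` S y) - 1 / 2 ^ n < Sup (f ` S y)" by simp
    moreover have "S y \<noteq> {}" using S_self by blast
    ultimately obtain z where z: "z \<in> S y" "Sup (f ` S y) - 1 / 2 ^ n < f z"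
      using less_cSUP_iff[OF _ bd] by blast
    have "f w \<le> f z + 1 / 2 ^ n" if "w \<in> S y" for w
      using cSUP_upper[OF that bd] z(2) by linarith
    then show ?thesis using z(1) by blast
  qed
  define F where "F n y = (SOME z. z \<in> S y \<and> (\<forall>w\<in>S y. f w \<le> f z + 1 / 2 ^ n))" for n :: nat and y
  have "F n y \<in> S y \<and> (\<forall>w\<in>S y. f w \<le> f (F n y) + 1 / 2 ^ n)" for n y
    unfolding F_def by (rule someI_ex) (use step[of y n] in blast)
  then have F: "\<And>n y. F n y \<in> S y" "\<And>n y w. w \<in> S y \<Longrightarrow> f w \<le> f (F n y) + 1 / 2 ^ n"
    by blast+
  define v where "v = rec_nat x F"
  have v0: "v 0 = x" and v: "\<And>n. v (Suc n) \<in> S (v n)"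
      "\<And>n w. w \<in> S (v n) \<Longrightarrow> f w \<le> f (v (Suc n)) + 1 / 2 ^ n"
    using F by (simp_all add: v_def)
  have vS: "v m \<in> S (v n)" if "n \<le> m" for m n
    using that by (induction m rule: dec_induct) (auto intro: S_self S_trans v)
  have inc: "incseq (\<lambda>n. f (v n))"
  proof (rule incseq_SucI)
    fix n
    have "f (v n) + c * dist (v (Suc n)) (v n) \<le> f (v (Suc n))" using v(1)[of n] by (simp add: S_def)
    moreover have "0 \<le> c * dist (v (Suc n)) (v n)" using c by simp
    ultimately show "f (v n) \<le> f (v (Suc n))" by linarith
  qed
  obtain l where "(\<lambda>n. f (v n)) \<longlonglongrightarrow> l"
    using incseq_convergent[OF inc, of M] bdd by blast
  then have Cf: "Cauchy (\<lambda>n. f (v n))" by (rule LIMSEQ_imp_Cauchy)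
  have "Cauchy v"
  proof (rule metric_CauchyI)
    fix e :: real assume "e > 0"
    then have "c * e > 0" using c by simp
    from metric_CauchyD[OF Cf this] obtain K where
      K: "\<And>m n. m \<ge> K \<Longrightarrow> n \<ge> K \<Longrightarrow> \<bar>f (v m) - f (v n)\<bar> < c * e" by (auto simp: dist_real_def)
    have *: "dist (v m) (v n) < e" if "m \<ge> n" "n \<ge> K" for m n
    proof -
      have "c * dist (v m) (v n) \<le> f (v m) - f (v n)" using vS[OF that(1)] by (simp add: S_def)
      also have "\<dots> < c * e" using K[of m n] that by auto
      finally show ?thesis using c by simp
    qed
    then have "dist (v m) (v n) < e" if "m \<ge> K" "n \<ge> K" for m n
      using *[of m n] *[of n m] that by (metis dist_commute nat_le_linear)
    then show "\<exists>K. \<forall>m\<ge>K. \<forall>n\<ge>K. dist (v m) (v n) < e" by blast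
  qed
  then obtain z where z: "v \<longlonglongrightarrow> z" using Cauchy_convergent convergent_def by blast
  have "isCont f z" using cont by (simp add: continuous_on_eq_continuous_at)
  then have fz: "(\<lambda>n. f (v n)) \<longlonglongrightarrow> f z" using z by (rule isCont_tendsto_compose)
  have zS: "z \<in> S (v n)" for n
  proof -
    have "(\<lambda>m. f (v n) + c * dist (v m) (v n)) \<longlonglongrightarrow> f (v n) + c * dist z (v n)"
      by (intro tendsto_intros z)
    moreover have "\<forall>m\<ge>n. f (v n) + c * dist (v m) (v n) \<le> f (v m)" using vS by (auto simp: S_def)
    ultimately show ?thesis using LIMSEQ_le[OF _ fz] by (auto simp: S_def)
  qed
  \<comment> \<open>A better \<open>w\<close> would lie in every \<open>S (v n)\<close>, so
    \<open>f w\<close> exceeds \<open>f (v (Suc n))\<close> by at most 1/2^n and, in the limit, does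
    not exceed \<open>f z\<close>.\<close>
  have "f w < f z + c * dist w z" if "w \<noteq> z" for w
  proof (rule ccontr)
    assume "\<not> ?thesis"
    then have w: "w \<in> S z" by (simp add: S_def)
    have "(\<lambda>n. f (v (Suc n)) + 1 / 2 ^ n) \<longlonglongrightarrow> f z + 0"
    proof (intro tendsto_add)
      show "(\<lambda>n. f (v (Suc n))) \<longlonglongrightarrow> f z" using fz by (rule LIMSEQ_Suc)
      show "(\<lambda>n. 1 / 2 ^ n :: real) \<longlonglongrightarrow> 0"
        using LIMSEQ_inverse_realpow_zero[of 2] by (simp add: inverse_eq_divide)
    qed
    moreover have "f w \<le> f (v (Suc n)) + 1 / 2 ^ n" for n using v(2) S_trans[OF w zS] by blast
    ultimately have "f w \<le> f z + 0" by (intro LIMSEQ_le_const) auto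
    moreover have "c * dist w z > 0" using c that by simp
    ultimately show False using w by (simp add: S_def)
  qed
  then show ?thesis using zS[of 0] v0 by (auto simp: S_def)
qed

lemma proximally_smooth_derivative:
  assumes "proximally_smooth R A" "0 < infdist x A" "infdist x A < R"
  obtains D where "((\<lambda>y. infdist y A) has_derivative D) (at x)"
  using assms unfolding proximally_smooth_def continuously_differentiable_on_def by blast

text \<open>Points \<open>q k\<close> of A that are nearest up to an error of
  \<open>(\<tau> k)\<^sup>2\<close> give directions along which the distance falls at almost unit
  rate. These directions converge, and with them \<open>q k\<close>; closedness puts the limit in A.
  The normal \<open>n\<close> is opposite to the limit direction.\<close>

lemma differentiable_infdist_nearest_point:
  fixes A :: "'a::{real_inner,banach} set"
  assumes cl: "closed A" and pos: "0 < infdist x A"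
    and der: "((\<lambda>y. infdist y A) has_derivative D) (at x)"
  obtains n where "norm n = 1" "D n = 1" "x - infdist x A *\<^sub>R n \<in> A"
proof -
  define d where "d = infdist x A"
  have d: "d > 0" using pos by (simp add: d_def)
  have ne: "A \<noteq> {}" using pos by (auto simp: infdist_def)
  \<comment> \<open>The shift by 2 makes the step strictly shorter than \<open>d\<close>, so that it
    does not pass \<open>q k\<close>.\<close>
  define \<tau> where "\<tau> k = d / real (k + 2)" for k
  have \<tau>: "\<tau> k > 0" "\<tau> k < d" for k
    using d divide_strict_left_mono[of 1 "real (k + 2)" d] by (auto simp: \<tau>_def)
  have \<tau>0: "\<tau> \<longlonglongrightarrow> 0" unfolding \<tau>_def
    by (rule LIMSEQ_ignore_initial_segment[OF lim_const_over_n])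
  have "\<exists>q\<in>A. norm (x - q) < d + (\<tau> k)\<^sup>2" for k
  proof -
    have "infdist x A < d + (\<tau> k)\<^sup>2" using \<tau>(1)[of k] by (simp add: d_def)
    then show ?thesis using cINF_less_iff[OF ne bdd_below_image_dist[of x A]] ne
      by (auto simp: infdist_notempty dist_norm)
  qed
  then obtain q where q: "\<And>k. q k \<in> A" "\<And>k. norm (x - q k) < d + (\<tau> k)\<^sup>2" by metis
  have qd: "norm (x - q k) \<ge> d" for k
    using infdist_le[OF q(1), of x k] by (simp add: d_def dist_norm)
  define u where "u k = (1 / norm (x - q k)) *\<^sub>R (q k - x)" for k
  have nu: "norm (u k) = 1" for k
    using qd[of k] d by (auto simp: u_def norm_minus_commute)
  have qu: "q k = x + norm (x - q k) *\<^sub>R u k" for k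
    using qd[of k] d by (simp add: u_def)
  have der': "((\<lambda>y. - infdist y A) has_derivative (\<lambda>v. - D v)) (at x)"
    using der by (rule has_derivative_minus)
  have lip: "\<bar>- infdist u A - - infdist v A\<bar> \<le> norm (u - v)" for u v
    using infdist_one_lipschitz[of u A v] by simp
  have steep: "- infdist (x + \<tau> k *\<^sub>R u k) A \<ge> - infdist x A + \<tau> k - (\<tau> k)\<^sup>2" for k
  proof -
    have "infdist (x + \<tau> k *\<^sub>R u k) A \<le> norm (x + \<tau> k *\<^sub>R u k - q k)"
      using infdist_le[OF q(1)] by (simp add: dist_norm)
    also have "x + \<tau> k *\<^sub>R u k - q k = (\<tau> k - norm (x - q k)) *\<^sub>R u k"
      using qu[of k] by (metis add_diff_cancel_left scaleR_left_diff_distrib)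
    also have "norm \<dots> = norm (x - q k) - \<tau> k"
      using \<tau>(2)[of k] qd[of k] nu[of k] by simp
    finally show ?thesis using q(2)[of k] by (simp add: d_def)
  qed
  obtain e where e: "u \<longlonglongrightarrow> e" and ne: "norm e = 1" and "- D e = 1"
    by (rule steep_directions_converge[OF der' lip nu \<tau>(1) \<tau>0 steep])
  moreover have "norm (- e) = 1" using ne by simp
  moreover have "D (- e) = 1"
    using linear_neg[OF has_derivative_linear[OF der], of e] calculation(3) by simp
  moreover have "(\<lambda>k. norm (x - q k)) \<longlonglongrightarrow> d"
  proof (rule real_tendsto_sandwich[where f="\<lambda>_. d" and h="\<lambda>k. d + (\<tau> k)\<^sup>2"])
    show "(\<lambda>k. d + (\<tau> k)\<^sup>2) \<longlonglongrightarrow> d" using tendsto_add[OF tendsto_const tendsto_power[OF \<tau>0, of 2]] by simp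
  qed (use q(2) qd in \<open>auto intro!: always_eventually less_imp_le\<close>)
  then have "(\<lambda>k. x + norm (x - q k) *\<^sub>R u k) \<longlonglongrightarrow> x + d *\<^sub>R e"
    by (intro tendsto_intros e)
  then have "q \<longlonglongrightarrow> x + d *\<^sub>R e" using qu by simp
  then have "x + d *\<^sub>R e \<in> A" using cl q(1) closed_sequentially by metis
  ultimately show thesis using that[of "- e"] by (simp add: d_def)
qed

text \<open>Where $0 < d < R$ the distance $d$ has slope one, so a point from which
  $\min(d, M)$ cannot increase at rate $c < 1$ already lies at distance at least $M$.\<close>

lemma proximally_smooth_nearby_farther:
  fixes A :: "'a::{real_inner,banach} set"
  assumes ps: "proximally_smooth R A" and x: "0 < infdist x A" and s: "s \<ge> 0" "infdist x A + s < R"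
    and c: "0 < c" "c < 1"
  shows "\<exists>y. infdist y A \<ge> infdist x A + s \<and> c * norm (y - x) \<le> s"
proof -
  define M where "M = infdist x A + s"
  \<comment> \<open>The truncation at \<open>M\<close> supplies the upper bound that
    \<open>ekeland\<close> asks for.\<close>
  have "continuous_on UNIV (\<lambda>z. min (infdist z A) M)" by (intro continuous_intros)
  then obtain v where v: "min (infdist x A) M + c * dist v x \<le> min (infdist v A) M"
    "\<And>w. w \<noteq> v \<Longrightarrow> min (infdist w A) M < min (infdist v A) M + c * dist w v"
    using ekeland[of "\<lambda>z. min (infdist z A) M" M c x] c(1) by auto
  have "0 \<le> c * dist v x" using c by simp
  then have vx: "infdist v A \<ge> infdist x A" using v(1) s(1) by (auto simp: M_def)
  have "infdist v A \<ge> M"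
  proof (rule ccontr)
    assume "\<not> ?thesis"
    then have lt: "infdist v A < M" by simp
    then have "infdist v A < R" using s by (simp add: M_def)
    moreover have v0: "0 < infdist v A" using x vx by simp
    ultimately obtain D where D: "((\<lambda>y. infdist y A) has_derivative D) (at v)"
      using proximally_smooth_derivative[OF ps] by blast
    obtain n where n: "norm n = 1" "D n = 1"
      using differentiable_infdist_nearest_point[OF _ v0 D] ps proximally_smooth_def by blast
    have "1 - c > 0" using c by simp
    then obtain d where d: "d > 0" "\<And>y. norm (y - v) < d \<Longrightarrow>
        \<bar>infdist y A - infdist v A - D (y - v)\<bar> \<le> (1 - c) * norm (y - v)"
      using has_derivative_real_bound[OF D] by metis
    \<comment> \<open>As \<open>t\<close> is at most the remaining height, the truncation does not
      cut off the gain \<open>c * t\<close>, which contradicts the choice of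
      \<open>v\<close>.\<close>
    define t where "t = min (d / 2) (M - infdist v A)"
    have t: "0 < t" "t < d" "t \<le> M - infdist v A" using d(1) lt by (auto simp: t_def)
    have "linear D" using D has_derivative_linear by blast
    then have "\<bar>infdist (v + t *\<^sub>R n) A - infdist v A - t\<bar> \<le> (1 - c) * t"
      using d(2)[of "v + t *\<^sub>R n"] t n by (simp add: linear_scale)
    then have "infdist (v + t *\<^sub>R n) A \<ge> infdist v A + c * t" by (simp add: algebra_simps abs_le_iff)
    moreover have "c * t \<le> t" using c t by (simp add: mult_left_le_one_le)
    moreover have "v + t *\<^sub>R n \<noteq> v" using t n by auto
    then have "min (infdist (v + t *\<^sub>R n) A) M < infdist v A + c * t"
      using v(2)[of "v + t *\<^sub>R n"] lt t n by (simp add: dist_norm)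
    ultimately show False using t by linarith
  qed
  moreover have "c * norm (v - x) \<le> s" using v(1) s(1) by (auto simp: M_def dist_norm)
  ultimately show ?thesis by (auto simp: M_def)
qed

text \<open>The points of the preceding lemma for $c \to 1$ lie in directions in which the derivative at $x$
  is almost one; such directions converge to $n$ by the parallelogram law.\<close>

lemma proximally_smooth_normal_ray:
  fixes A :: "'a::{real_inner,banach} set"
  assumes ps: "proximally_smooth R A" and x: "0 < infdist x A" and s: "s > 0" "infdist x A + s < R"
    and der: "((\<lambda>y. infdist y A) has_derivative D) (at x)" and n: "norm n = 1" "D n = 1"
  shows "infdist (x + s *\<^sub>R n) A \<ge> infdist x A + s"
proof -
  define \<tau> where "\<tau> k = s / real (k + 2)" for k
  have \<tau>: "\<tau> k > 0" "\<tau> k < s" for k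
    using s divide_strict_left_mono[of 1 "real (k + 2)" s] by (auto simp: \<tau>_def)
  have \<tau>0: "\<tau> \<longlonglongrightarrow> 0" unfolding \<tau>_def
    by (rule LIMSEQ_ignore_initial_segment[OF lim_const_over_n])
  have "\<exists>y. infdist y A \<ge> infdist x A + s \<and> norm (y - x) \<le> s + (\<tau> k)\<^sup>2" for k
  proof -
    \<comment> \<open>Chosen so that \<open>s / c\<close>, which bounds the distance of
      \<open>y\<close> from \<open>x\<close>, equals \<open>s + (\<tau> k)\<^sup>2\<close>.\<close>
    define c where "c = s / (s + (\<tau> k)\<^sup>2)"
    have p: "(\<tau> k)\<^sup>2 > 0" using \<tau>(1)[of k] by simp
    have sp: "s + (\<tau> k)\<^sup>2 > 0" using s p by linarith
    have c: "0 < c" "c < 1" using p s(1) sp by (auto simp: c_def)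
    obtain y where y: "infdist y A \<ge> infdist x A + s" "c * norm (y - x) \<le> s"
      using proximally_smooth_nearby_farther[OF ps x _ s(2) c] s(1) by auto
    have "norm (y - x) \<le> s + (\<tau> k)\<^sup>2"
      using y(2) s(1) sp
      by (simp add: c_def pos_divide_le_eq mult_le_cancel_left_pos)
    then show ?thesis using y(1) by blast
  qed
  then obtain y where y: "\<And>k. infdist (y k) A \<ge> infdist x A + s" "\<And>k. norm (y k - x) \<le> s + (\<tau> k)\<^sup>2"
    by metis
  have yx: "norm (y k - x) \<ge> s" for k
    using y(1)[of k] infdist_one_lipschitz[of "y k" A x] by linarith
  define u where "u k = (1 / norm (y k - x)) *\<^sub>R (y k - x)" for k
  have nu: "norm (u k) = 1" for k using yx[of k] s by (auto simp: u_def)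
  have yu: "y k = x + norm (y k - x) *\<^sub>R u k" for k using yx[of k] s by (simp add: u_def)
  have steep: "infdist (x + \<tau> k *\<^sub>R u k) A \<ge> infdist x A + \<tau> k - (\<tau> k)\<^sup>2" for k
  proof -
    have "x + \<tau> k *\<^sub>R u k - y k = (\<tau> k - norm (y k - x)) *\<^sub>R u k"
      using yu[of k] by (metis add_diff_cancel_left scaleR_left_diff_distrib)
    then have "norm (x + \<tau> k *\<^sub>R u k - y k) = norm (y k - x) - \<tau> k"
      using \<tau>(2)[of k] yx[of k] nu[of k] by simp
    then show ?thesis
      using infdist_one_lipschitz[of "x + \<tau> k *\<^sub>R u k" A "y k"] y(1)[of k] y(2)[of k] by linarith
  qed
  obtain e where e: "u \<longlonglongrightarrow> e" "norm e = 1" "D e = 1"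
    by (rule steep_directions_converge[OF der infdist_one_lipschitz nu \<tau>(1) \<tau>0 steep])
  \<comment> \<open>Equality case of the parallelogram estimate: unit vectors on which
    \<open>D\<close> takes the value one coincide.\<close>
  have "(norm (e - n))\<^sup>2 \<le> 0"
    using norm_diff_le_functional[OF has_derivative_linear[OF der]
        derivative_one_lipschitz[OF der infdist_one_lipschitz], of e n] e n by simp
  then have en: "e = n" by simp
  have "(\<lambda>k. norm (y k - x)) \<longlonglongrightarrow> s"
  proof (rule real_tendsto_sandwich[where f="\<lambda>_. s" and h="\<lambda>k. s + (\<tau> k)\<^sup>2"])
    show "(\<lambda>k. s + (\<tau> k)\<^sup>2) \<longlonglongrightarrow> s" using tendsto_add[OF tendsto_const tendsto_power[OF \<tau>0, of 2]] by simp
  qed (use y(2) yx in \<open>auto intro!: always_eventually\<close>)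
  then have "(\<lambda>k. x + norm (y k - x) *\<^sub>R u k) \<longlonglongrightarrow> x + s *\<^sub>R e"
    by (intro tendsto_intros e(1))
  then have "y \<longlonglongrightarrow> x + s *\<^sub>R n" using yu en by simp
  then have "(\<lambda>k. infdist (y k) A) \<longlonglongrightarrow> infdist (x + s *\<^sub>R n) A" by (rule tendsto_infdist)
  then show ?thesis by (rule LIMSEQ_le_const) (use y(1) in auto)
qed

text \<open>For d < r < R the point of the normal ray at distance r from p is at distance at least r
  from A. Expanding the square of |r n - (y - p)| >= r gives the inequality with r in place of R,
  and r tends to R. For empty A the convention that \<open>infdist\<close> is 0 would leave points
  without a foot.\<close>

lemma proximally_smooth_has_feet:
  fixes A :: "'a::{real_inner,banach} set"
  assumes ps: "proximally_smooth R A" and ne: "A \<noteq> {}"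
  shows "has_feet R A"
  unfolding has_feet_def
proof (intro allI impI)
  fix x assume xR: "infdist x A < R"
  have cl: "closed A" using ps by (simp add: proximally_smooth_def)
  show "\<exists>p. foot R A x p"
  proof (cases "infdist x A = 0")
    case True
    then have "x \<in> A" using cl ne by (simp add: in_closed_iff_infdist_zero)
    then have "foot R A x x" using True by (simp add: foot_def)
    then show ?thesis ..
  next
    case False
    define d where "d = infdist x A"
    have d: "0 < d" "d < R" using False xR infdist_nonneg[of x A] by (simp_all add: d_def)
    obtain D where D: "((\<lambda>y. infdist y A) has_derivative D) (at x)"
      using proximally_smooth_derivative[OF ps, of x] d by (auto simp: d_def)
    obtain n where n: "norm n = 1" "D n = 1" and nA: "x - d *\<^sub>R n \<in> A"
      using differentiable_infdist_nearest_point[OF cl _ D] d by (auto simp: d_def)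
    define p where "p = x - d *\<^sub>R n"
    have "2 * R * ((y - p) \<bullet> n) \<le> (norm (y - p))\<^sup>2" if "y \<in> A" for y
    proof -
      have ray: "2 * r * ((y - p) \<bullet> n) \<le> (norm (y - p))\<^sup>2" if r: "d < r" "r < R" for r
      proof -
        have "infdist (x + (r - d) *\<^sub>R n) A \<ge> r"
          using proximally_smooth_normal_ray[OF ps _ _ _ D n, of "r - d"] r d by (simp add: d_def)
        moreover have "x + (r - d) *\<^sub>R n = p + r *\<^sub>R n" by (simp add: p_def algebra_simps)
        ultimately have "r \<le> norm (r *\<^sub>R n - (y - p))"
          using infdist_le[OF \<open>y \<in> A\<close>, of "p + r *\<^sub>R n"] by (simp add: dist_norm algebra_simps)
        then have "r\<^sup>2 \<le> (norm (r *\<^sub>R n - (y - p)))\<^sup>2" using r d by (intro power_mono) auto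
        also have "\<dots> = r\<^sup>2 * (n \<bullet> n) - 2 * r * ((y - p) \<bullet> n) + (norm (y - p))\<^sup>2"
          unfolding power2_norm_eq_inner by (simp add: inner_diff inner_commute power2_eq_square algebra_simps)
        also have "n \<bullet> n = 1" using n by (simp add: norm_eq_1)
        finally show ?thesis by simp
      qed
      have "((\<lambda>r. 2 * r * ((y - p) \<bullet> n)) \<longlongrightarrow> 2 * R * ((y - p) \<bullet> n)) (at_left R)"
        by (intro tendsto_intros)
      moreover have "\<forall>\<^sub>F r in at_left R. 2 * r * ((y - p) \<bullet> n) \<le> (norm (y - p))\<^sup>2"
        using eventually_at_left_real[OF d(2)] by eventually_elim (use ray in auto)
      ultimately show ?thesis by (rule tendsto_upperbound) simp
    qed
    then have "d * (2 * R * ((y - p) \<bullet> n)) \<le> d * (norm (y - p))\<^sup>2" if "y \<in> A" for y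
      using that d by (intro mult_left_mono) auto
    moreover have "x - p = d *\<^sub>R n" by (simp add: p_def)
    ultimately have "foot R A x p" using nA d n
      unfolding foot_def by (auto simp: p_def[symmetric] d_def[symmetric] mult_ac)
    then show ?thesis ..
  qed
qed

section \<open>From touching balls back to a smooth distance function\<close>

lemma foot_lipschitz:
  fixes A :: "'a::real_inner set"
  assumes R: "R > 0" and p: "foot R A x p" and q: "foot R A y q"
  shows "norm (p - q) * (1 - (infdist x A + infdist y A) / (2 * R)) \<le> norm (x - y)"
proof (cases "p = q")
  case False
  then have pos: "norm (p - q) > 0" by simp
  \<comment> \<open>The inequality of the foot \<open>p\<close> is tested with \<open>q\<close> and
    that of \<open>q\<close> with \<open>p\<close>; the left-hand sides add up to 2R(|p - q|^2 - <p
    - q, x - y>).\<close>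
  have "2 * R * ((q - p) \<bullet> (x - p)) \<le> infdist x A * (norm (p - q))\<^sup>2"
    using p q unfolding foot_def by (metis norm_minus_commute)
  moreover have "2 * R * ((p - q) \<bullet> (y - q)) \<le> infdist y A * (norm (p - q))\<^sup>2"
    using p q unfolding foot_def by metis
  moreover have "(q - p) \<bullet> (x - p) + (p - q) \<bullet> (y - q) = (norm (p - q))\<^sup>2 - (p - q) \<bullet> (x - y)"
    unfolding power2_norm_eq_inner by (simp add: inner_diff inner_commute algebra_simps)
  then have "2 * R * ((q - p) \<bullet> (x - p)) + 2 * R * ((p - q) \<bullet> (y - q))
      = 2 * R * (norm (p - q))\<^sup>2 - 2 * R * ((p - q) \<bullet> (x - y))"
    by (metis distrib_left right_diff_distrib)
  moreover have "2 * R * ((p - q) \<bullet> (x - y)) \<le> 2 * R * (norm (p - q) * norm (x - y))"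
    using norm_cauchy_schwarz R by simp
  ultimately have "2 * R * (norm (p - q))\<^sup>2 - (infdist x A + infdist y A) * (norm (p - q))\<^sup>2
      \<le> 2 * R * (norm (p - q) * norm (x - y))" by (simp add: algebra_simps)
  then have "norm (p - q) * (2 * R * norm (p - q) - (infdist x A + infdist y A) * norm (p - q))
      \<le> norm (p - q) * (2 * R * norm (x - y))" by (simp add: power2_eq_square algebra_simps)
  then have "2 * R * norm (p - q) - (infdist x A + infdist y A) * norm (p - q) \<le> 2 * R * norm (x - y)"
    using pos by (simp only: mult_le_cancel_left_pos)
  moreover have "(norm (p - q) * (1 - (infdist x A + infdist y A) / (2 * R))) * (2 * R)
      = 2 * R * norm (p - q) - (infdist x A + infdist y A) * norm (p - q)"
    using R by (simp add: field_simps)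
  ultimately have "(norm (p - q) * (1 - (infdist x A + infdist y A) / (2 * R))) * (2 * R) \<le> norm (x - y) * (2 * R)"
    by (simp only: mult_ac)
  then show ?thesis using R by simp
qed simp

lemma foot_self:
  assumes "foot R A x p" "x \<in> A"
  shows "p = x"
  using assms by (auto simp: foot_def infdist_zero)

text \<open>The squared distance has the gradient 2(x - P x): its value at y is estimated with the
  competitor P x, its value at x with P y, and the two bounds differ by a quadratic term because P
  is Lipschitz near x. Away from A the square root is smooth, and continuity of P makes the
  derivative continuous.\<close>

lemma has_feet_proximally_smooth:
  fixes A :: "'a::real_inner set"
  assumes R: "R > 0" and cl: "closed A" and feet: "has_feet R A"
  shows "proximally_smooth R A"
proof -
  define d where "d x = infdist x A" for x
  define P where "P x = (SOME p. foot R A x p)" for x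
  have foot: "foot R A x (P x)" if "d x < R" for x
    unfolding P_def by (rule someI_ex) (use feet that in \<open>auto simp: has_feet_def d_def\<close>)
  have PA: "P x \<in> A" "norm (x - P x) = d x" if "d x < R" for x
    using foot[OF that] by (auto simp: foot_def d_def)
  \<comment> \<open>For |y - x| < R - d x the sum d y + d x is at most R + d x, and 1 - (R + d
    x)/(2R) is the reciprocal of \<open>K x\<close>.\<close>
  define K where "K x = 2 * R / (R - d x)" for x
  have PL: "d y < R \<and> norm (P y - P x) \<le> K x * norm (y - x)" if x: "d x < R" and y: "norm (y - x) < R - d x" for x y
  proof -
    have dy: "d y < R" "d y \<le> d x + (R - d x)" using infdist_one_lipschitz[of y A x] y by (auto simp: d_def)
    have "(R - d x) / (2 * R) \<le> 1 - (d y + d x) / (2 * R)"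
      using dy R by (simp add: field_simps)
    then have "norm (P y - P x) * ((R - d x) / (2 * R)) \<le> norm (P y - P x) * (1 - (d y + d x) / (2 * R))"
      by (intro mult_left_mono) auto
    also have "\<dots> \<le> norm (y - x)" using foot_lipschitz[OF R foot[OF dy(1)] foot[OF x]] by (simp add: d_def)
    finally have "norm (P y - P x) \<le> K x * norm (y - x)" using R x by (simp add: K_def field_simps)
    then show ?thesis using dy by simp
  qed
  have Kpos: "K x \<ge> 0" if "d x < R" for x using R that by (simp add: K_def)
  have quad: "\<bar>(d y)\<^sup>2 - (d x)\<^sup>2 - 2 * ((y - x) \<bullet> (x - P x))\<bar> \<le> (1 + 2 * K x) * (norm (y - x))\<^sup>2"
    if x: "d x < R" and y: "norm (y - x) < R - d x" for x y
  proof -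
    have dy: "d y < R" and L: "norm (P y - P x) \<le> K x * norm (y - x)" using PL[OF x y] by auto
    have "(d y)\<^sup>2 \<le> (norm (y - P x))\<^sup>2"
      using infdist_le[OF PA(1)[OF x], of y] by (intro power_mono) (auto simp: d_def dist_norm infdist_nonneg)
    also have "\<dots> = (norm (x - P x))\<^sup>2 + 2 * ((y - x) \<bullet> (x - P x)) + (norm (y - x))\<^sup>2"
      unfolding power2_norm_eq_inner by (simp add: inner_diff inner_commute)
    finally have up: "(d y)\<^sup>2 - (d x)\<^sup>2 - 2 * ((y - x) \<bullet> (x - P x)) \<le> (norm (y - x))\<^sup>2"
      using PA(2)[OF x] by simp
    have "(d x)\<^sup>2 \<le> (norm (x - P y))\<^sup>2"
      using infdist_le[OF PA(1)[OF dy], of x] by (intro power_mono) (auto simp: d_def dist_norm infdist_nonneg)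
    also have "\<dots> = (norm (y - P y))\<^sup>2 - 2 * ((y - x) \<bullet> (x - P x)) - (norm (y - x))\<^sup>2 + 2 * ((y - x) \<bullet> (P y - P x))"
      unfolding power2_norm_eq_inner by (simp add: inner_diff inner_commute)
    also have "(y - x) \<bullet> (P y - P x) \<le> norm (y - x) * norm (P y - P x)" by (rule norm_cauchy_schwarz)
    also have "\<dots> \<le> norm (y - x) * (K x * norm (y - x))" by (intro mult_left_mono L) auto
    finally have "(d y)\<^sup>2 - (d x)\<^sup>2 - 2 * ((y - x) \<bullet> (x - P x)) \<ge> (norm (y - x))\<^sup>2 - 2 * (K x * (norm (y - x))\<^sup>2)"
      using PA(2)[OF dy] by (simp add: power2_eq_square algebra_simps)
    moreover have "0 \<le> K x * (norm (y - x))\<^sup>2" using Kpos[OF x] by simp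
    moreover have "(1 + 2 * K x) * (norm (y - x))\<^sup>2 = (norm (y - x))\<^sup>2 + 2 * (K x * (norm (y - x))\<^sup>2)"
      by (simp add: algebra_simps)
    ultimately show ?thesis using up zero_le_power2[of "norm (y - x)"] unfolding abs_le_iff by linarith
  qed
  have der2: "((\<lambda>y. (d y)\<^sup>2) has_derivative (\<lambda>v. 2 * (v \<bullet> (x - P x)))) (at x)" if x: "d x < R" for x
    unfolding has_derivative_at_alt
  proof (intro conjI allI impI)
    show "bounded_linear (\<lambda>v. 2 * (v \<bullet> (x - P x)))"
      by (rule bounded_linear_const_mult[OF bounded_linear_inner_left])
    fix e :: real assume e: "e > 0"
    define C where "C = 1 + 2 * K x"
    have C: "C > 0" using Kpos[OF x] by (simp add: C_def)
    show "\<exists>\<delta>>0. \<forall>y. norm (y - x) < \<delta> \<longrightarrow>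
        norm ((d y)\<^sup>2 - (d x)\<^sup>2 - 2 * ((y - x) \<bullet> (x - P x))) \<le> e * norm (y - x)"
    proof (intro exI conjI allI impI)
      show "min (R - d x) (e / C) > 0" using x e C by simp
      fix y assume y: "norm (y - x) < min (R - d x) (e / C)"
      have "C * norm (y - x) \<le> e" using y C by (simp add: field_simps)
      then have "C * norm (y - x) * norm (y - x) \<le> e * norm (y - x)" by (rule mult_right_mono) simp
      then show "norm ((d y)\<^sup>2 - (d x)\<^sup>2 - 2 * ((y - x) \<bullet> (x - P x))) \<le> e * norm (y - x)"
        using quad[OF x, of y] y unfolding real_norm_def C_def power2_eq_square by (simp add: mult_ac)
    qed
  qed
  define U where "U = {x. 0 < d x \<and> d x < R}"
  define D where "D x = blinfun_inner_left ((1 / d x) *\<^sub>R (x - P x))" for x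
  have "(d has_derivative blinfun_apply (D x)) (at x)" if x: "x \<in> U" for x
  proof -
    have d: "0 < d x" "d x < R" using x by (auto simp: U_def)
    have "((\<lambda>y. sqrt ((d y)\<^sup>2)) has_derivative (\<lambda>v. (2 * (v \<bullet> (x - P x))) * (inverse (sqrt ((d x)\<^sup>2)) / 2))) (at x)"
      by (rule DERIV_real_sqrt[THEN DERIV_compose_FDERIV, OF _ der2]) (use d in auto)
    moreover have "sqrt ((d y)\<^sup>2) = d y" for y by (simp add: d_def infdist_nonneg)
    moreover have "(2 * (v \<bullet> (x - P x))) * (inverse (d x) / 2) = blinfun_apply (D x) v" for v
      by (simp add: D_def inverse_eq_divide)
    ultimately show ?thesis by (simp only:)
  qed
  moreover have "continuous_on U D"
  proof -
    have "continuous_on U P"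
      unfolding continuous_on_iff
    proof (intro ballI allI impI)
      fix x and e :: real assume x: "x \<in> U" and e: "e > 0"
      have dx: "d x < R" using x by (simp add: U_def)
      show "\<exists>\<delta>>0. \<forall>y\<in>U. dist y x < \<delta> \<longrightarrow> dist (P y) (P x) < e"
      proof (intro exI conjI ballI impI)
        show "min (R - d x) (e / (K x + 1)) > 0" using dx e Kpos[OF dx] by simp
        fix y assume y: "dist y x < min (R - d x) (e / (K x + 1))"
        have "dist (P y) (P x) \<le> K x * dist y x" using PL[OF dx, of y] y by (simp add: dist_norm)
        also have "\<dots> \<le> (K x + 1) * dist y x" by (simp add: algebra_simps)
        also have "\<dots> < e" using y Kpos[OF dx] by (simp add: field_simps)
        finally show "dist (P y) (P x) < e" .
      qed
    qed
    moreover have "continuous_on U d" unfolding d_def by (intro continuous_intros)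
    ultimately have "continuous_on U (\<lambda>x. (1 / d x) *\<^sub>R (x - P x))"
      by (intro continuous_intros) (auto simp: U_def)
    then show ?thesis unfolding D_def
      by (rule bounded_linear.continuous_on[OF bounded_linear_blinfun_inner_left])
  qed
  ultimately show ?thesis
    using cl unfolding proximally_smooth_def continuously_differentiable_on_def U_def d_def by blast
qed

section \<open>Lipschitz paths and their lengths\<close>

text \<open>The number \<open>L\<close> is only an upper bound for the length. Unlike
  parametrizations by arc length, 1-Lipschitz maps are closed under pointwise limits and may wait at
  an end point.\<close>

definition unit_path :: "'a::real_normed_vector set \<Rightarrow> 'a \<Rightarrow> 'a \<Rightarrow> real \<Rightarrow> (real \<Rightarrow> 'a) \<Rightarrow> bool"
  where "unit_path A a b L x \<longleftrightarrow> 0 \<le> L \<and> x 0 = a \<and> x L = b \<and> x ` {0..L} \<subseteq> A \<and>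
    (\<forall>s t. 0 \<le> s \<longrightarrow> s \<le> t \<longrightarrow> t \<le> L \<longrightarrow> norm (x t - x s) \<le> t - s)"

text \<open>The intrinsic distance of A. If no path joins the points, the infimum of the empty set
  carries no information; hence the path hypotheses of the estimates below.\<close>

definition path_dist :: "'a::real_normed_vector set \<Rightarrow> 'a \<Rightarrow> 'a \<Rightarrow> real"
  where "path_dist A a b = Inf {L. \<exists>x. unit_path A a b L x}"

lemma unit_path_norm_le:
  "unit_path A a b L x \<Longrightarrow> 0 \<le> s \<Longrightarrow> s \<le> t \<Longrightarrow> t \<le> L \<Longrightarrow> norm (x t - x s) \<le> t - s"
  by (simp add: unit_path_def)

lemma unit_path_continuous_on:
  assumes "unit_path A a b L x"
  shows "continuous_on {0..L} x"
  unfolding continuous_on_iff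
proof (intro ballI allI impI)
  fix s and e :: real assume s: "s \<in> {0..L}" and e: "e > 0"
  have "dist (x t) (x s) \<le> dist t s" if "t \<in> {0..L}" for t
    using unit_path_norm_le[OF assms, of s t] unit_path_norm_le[OF assms, of t s] s that
      norm_minus_commute[of "x s" "x t"]
    by (cases "s \<le> t") (auto simp: dist_norm)
  then show "\<exists>d>0. \<forall>t\<in>{0..L}. dist t s < d \<longrightarrow> dist (x t) (x s) < e"
    using e by (intro exI[of _ e]) fastforce
qed

lemma unit_path_join:
  assumes "unit_path A a c L x" "unit_path A c b M y"
  shows "unit_path A a b (L + M) (\<lambda>t. if t \<le> L then x t else y (t - L))" (is "unit_path _ _ _ _ ?z")
  unfolding unit_path_def
proof (intro conjI allI impI)
  have L: "0 \<le> L" "0 \<le> M" "x L = c" "y 0 = c" "y M = b" using assms by (auto simp: unit_path_def)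
  show "?z (L + M) = b" using L by auto
  show "?z ` {0..L + M} \<subseteq> A" using assms by (auto simp: unit_path_def image_subset_iff)
  fix s t assume st: "0 \<le> s" "s \<le> t" "t \<le> L + M"
  show "norm (?z t - ?z s) \<le> t - s"
  proof (cases "s \<le> L \<and> L < t")
    case True
    have "norm (?z t - ?z s) \<le> norm (y (t - L) - y 0) + norm (x L - x s)"
      using True L norm_triangle_ineq[of "y (t - L) - y 0" "x L - x s"] by simp
    also have "\<dots> \<le> (t - L - 0) + (L - s)"
      using True st L by (intro add_mono unit_path_norm_le[OF assms(1)] unit_path_norm_le[OF assms(2)]) auto
    finally show ?thesis by simp
  next
    case False
    moreover have "norm (y (t - L) - y (s - L)) \<le> (t - L) - (s - L)" if "L < s"
      using that st by (intro unit_path_norm_le[OF assms(2)]) auto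
    ultimately show ?thesis using assms st unfolding unit_path_def by auto
  qed
qed (use assms in \<open>auto simp: unit_path_def\<close>)

lemma unit_path_reverse:
  assumes "unit_path A a b L x"
  shows "unit_path A b a L (\<lambda>t. x (L - t))"
  unfolding unit_path_def
proof (intro conjI allI impI)
  fix s t assume st: "0 \<le> s" "s \<le> t" "t \<le> L"
  then have "norm (x (L - s) - x (L - t)) \<le> (L - s) - (L - t)"
    by (intro unit_path_norm_le[OF assms]) auto
  then show "norm (x (L - t) - x (L - s)) \<le> t - s" by (simp add: norm_minus_commute)
qed (use assms in \<open>auto simp: unit_path_def image_subset_iff\<close>)

lemma unit_path_subpath:
  assumes "unit_path A a b L x" "0 \<le> s" "s \<le> t" "t \<le> L"
  shows "unit_path A (x s) (x t) (t - s) (\<lambda>r. x (s + r))"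
  unfolding unit_path_def
proof (intro conjI allI impI)
  fix r r' assume "0 \<le> r" "r \<le> r'" "r' \<le> t - s"
  then have "norm (x (s + r') - x (s + r)) \<le> (s + r') - (s + r)"
    using assms(2-4) by (intro unit_path_norm_le[OF assms(1)]) auto
  then show "norm (x (s + r') - x (s + r)) \<le> r' - r" by simp
qed (use assms in \<open>auto simp: unit_path_def image_subset_iff\<close>)

text \<open>Waiting at the end point brings paths of different parameter lengths to a common
  interval, where they can be compared.\<close>

lemma unit_path_extend:
  assumes "unit_path A a b L x" "L \<le> M"
  shows "unit_path A a b M (\<lambda>t. x (min t L))"
  unfolding unit_path_def
proof (intro conjI allI impI)
  fix s t assume st: "0 \<le> s" "s \<le> t" "t \<le> M"
  have "norm (x (min t L) - x (min s L)) \<le> min t L - min s L"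
    using assms st unfolding unit_path_def by auto
  then show "norm (x (min t L) - x (min s L)) \<le> t - s" using st by linarith
qed (use assms in \<open>auto simp: unit_path_def image_subset_iff\<close>)

lemma unit_path_bdd_below: "bdd_below {L. \<exists>x. unit_path A a b L x}"
  by (rule bdd_belowI[of _ 0]) (auto simp: unit_path_def)

lemma path_dist_le: "unit_path A a b L x \<Longrightarrow> path_dist A a b \<le> L"
  unfolding path_dist_def by (intro cInf_lower unit_path_bdd_below) auto

lemma path_dist_near:
  assumes "unit_path A a b L x" "e > 0"
  obtains M y where "unit_path A a b M y" "M < path_dist A a b + e"
proof -
  have "Inf {L. \<exists>x. unit_path A a b L x} < path_dist A a b + e" using assms by (simp add: path_dist_def)
  then show thesis using cInf_less_iff[OF _ unit_path_bdd_below[of A a b]] assms(1) that by blast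
qed

lemma path_dist_ge_norm:
  assumes "unit_path A a b L x"
  shows "norm (a - b) \<le> path_dist A a b"
  unfolding path_dist_def
proof (rule cInf_greatest)
  fix M assume "M \<in> {L. \<exists>x. unit_path A a b L x}"
  then obtain y where y: "unit_path A a b M y" by auto
  then have "norm (y M - y 0) \<le> M - 0" unfolding unit_path_def by (metis order.refl)
  then show "norm (a - b) \<le> M" using y by (simp add: unit_path_def norm_minus_commute)
qed (use assms in auto)

lemma path_dist_triangle:
  assumes "unit_path A a c L x" "unit_path A c b M y"
  shows "path_dist A a b \<le> path_dist A a c + path_dist A c b"
proof (rule field_le_epsilon)
  fix e :: real assume "e > 0"
  then have e: "e / 2 > 0" by simp
  obtain L' x' where 1: "unit_path A a c L' x'" "L' < path_dist A a c + e / 2"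
    using path_dist_near[OF assms(1) e] .
  obtain M' y' where 2: "unit_path A c b M' y'" "M' < path_dist A c b + e / 2"
    using path_dist_near[OF assms(2) e] .
  have "path_dist A a b \<le> L' + M'" using path_dist_le[OF unit_path_join[OF 1(1) 2(1)]] .
  then show "path_dist A a b \<le> path_dist A a c + path_dist A c b + e" using 1 2 by linarith
qed

section \<open>Projected chords and the arcsine bound\<close>

lemma crude_path:
  fixes A :: "'a::real_inner set"
  assumes R: "R > 0" and feet: "has_feet R A" and ab: "a \<in> A" "b \<in> A" and lt: "norm (a - b) < 2 * R"
  shows "\<exists>x. unit_path A a b (norm (a - b) / (1 - norm (a - b) / (2 * R))) x"
proof (cases "a = b")
  case True
  then have "unit_path A a b 0 (\<lambda>_. a)" using ab by (auto simp: unit_path_def)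
  then show ?thesis using True by auto
next
  case False
  define e where "e = norm (a - b)"
  define \<kappa> where "\<kappa> = 1 - e / (2 * R)"
  have e: "e > 0" using False by (simp add: e_def)
  have \<kappa>: "\<kappa> > 0" using lt R by (simp add: \<kappa>_def e_def)
  define L where "L = e / \<kappa>"
  have L: "L > 0" using e \<kappa> by (simp add: L_def)
  define z where "z t = a + (t / L) *\<^sub>R (b - a)" for t
  \<comment> \<open>The nearer end point of the chord is at most \<open>e / 2\<close> away, so the
    projection stretches the chord at most by the factor 1/\<open>\<kappa>\<close>, which fixes the
    parameter length \<open>L\<close>.\<close>
  have dz: "infdist (z t) A \<le> e / 2" if "0 \<le> t" "t \<le> L" for t
  proof -
    have r: "0 \<le> t / L" "t / L \<le> 1" using that L by auto
    have "norm (z t - a) = (t / L) * e"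
      using abs_of_nonneg[OF r(1)] by (simp add: z_def e_def norm_minus_commute del: abs_divide)
    moreover have "z t - b = (1 - t / L) *\<^sub>R (a - b)" by (simp add: z_def algebra_simps)
    then have "norm (z t - b) = (1 - t / L) * e" using r by (simp add: e_def)
    moreover have "infdist (z t) A \<le> norm (z t - a)" "infdist (z t) A \<le> norm (z t - b)"
      using infdist_le[of _ A] ab by (auto simp: dist_norm)
    ultimately show ?thesis by (simp add: algebra_simps)
  qed
  define P where "P t = (SOME p. foot R A (z t) p)" for t
  have foot: "foot R A (z t) (P t)" if "0 \<le> t" "t \<le> L" for t
    unfolding P_def by (rule someI_ex) (use feet dz[OF that] lt in \<open>auto simp: has_feet_def e_def\<close>)
  have z0: "z 0 = a" "z L = b" using L by (simp_all add: z_def)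
  have "unit_path A a b L P"
    unfolding unit_path_def
  proof (intro conjI allI impI)
    show "P 0 = a" "P L = b" using foot_self[OF foot] z0 L ab by simp_all
    show "P ` {0..L} \<subseteq> A" using foot by (auto simp: foot_def)
    fix s t assume st: "0 \<le> s" "s \<le> t" "t \<le> L"
    have "z t - z s = ((t - s) / L) *\<^sub>R (b - a)" by (simp add: z_def algebra_simps diff_divide_distrib)
    then have zz: "norm (z t - z s) = (t - s) / L * e" using st L by (simp add: e_def norm_minus_commute)
    have "(infdist (z t) A + infdist (z s) A) / (2 * R) \<le> e / (2 * R)"
      using dz[of t] dz[of s] st R by (intro divide_right_mono) auto
    then have "norm (P t - P s) * \<kappa> \<le> norm (P t - P s) * (1 - (infdist (z t) A + infdist (z s) A) / (2 * R))"
      by (intro mult_left_mono) (auto simp: \<kappa>_def)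
    also have "\<dots> \<le> (t - s) / L * e" using foot_lipschitz[OF R foot foot, of t s] st unfolding zz by simp
    also have "\<dots> = (t - s) * \<kappa>" using e \<kappa> by (simp add: L_def)
    finally show "norm (P t - P s) \<le> t - s" using \<kappa> by simp
  qed (use L in auto)
  then show ?thesis by (auto simp: L_def \<kappa>_def e_def)
qed

lemma path_dist_le_chord:
  fixes A :: "'a::real_inner set"
  assumes "R > 0" "has_feet R A" "a \<in> A" "b \<in> A" "norm (a - b) < 2 * R"
  shows "path_dist A a b \<le> norm (a - b) / (1 - norm (a - b) / (2 * R))"
  using crude_path[OF assms] path_dist_le by blast

text \<open>Every edge is replaced by its projection to A. Shorter edges have better factors and are
  relaxed by \<open>unit_path_extend\<close> to the common factor 1/(1 - \<delta>/(2R)), which tends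
  to 1 for fine chains.\<close>

lemma chain_path:
  fixes A :: "'a::real_inner set" and p :: "nat \<Rightarrow> 'a"
  assumes R: "R > 0" and feet: "has_feet R A" and \<delta>: "0 \<le> \<delta>" "\<delta> < 2 * R"
    and p: "\<And>i. i \<le> N \<Longrightarrow> p i \<in> A" "\<And>i. i < N \<Longrightarrow> norm (p (Suc i) - p i) \<le> \<delta>"
  shows "\<exists>x. unit_path A (p 0) (p N) ((\<Sum>i<N. norm (p (Suc i) - p i)) / (1 - \<delta> / (2 * R))) x"
  using p
proof (induction N)
  case 0
  then show ?case by (intro exI[of _ "\<lambda>_. p 0"]) (auto simp: unit_path_def)
next
  case (Suc N)
  obtain x where x: "unit_path A (p 0) (p N) ((\<Sum>i<N. norm (p (Suc i) - p i)) / (1 - \<delta> / (2 * R))) x"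
    using Suc by force
  define e where "e = norm (p N - p (Suc N))"
  have e: "0 \<le> e" "e \<le> \<delta>" "e < 2 * R" using Suc.prems(2)[of N] \<delta> by (auto simp: e_def norm_minus_commute)
  obtain y where y: "unit_path A (p N) (p (Suc N)) (e / (1 - e / (2 * R))) y"
    using crude_path[OF R feet, of "p N" "p (Suc N)"] Suc.prems(1) e by (auto simp: e_def)
  have "e / (1 - e / (2 * R)) \<le> e / (1 - \<delta> / (2 * R))"
    using e \<delta> R by (intro divide_left_mono diff_left_mono divide_right_mono mult_pos_pos) auto
  from unit_path_join[OF x unit_path_extend[OF y this]]
  show ?case by (auto simp: e_def norm_minus_commute add_divide_distrib)
qed

text \<open>The inequality of the foot, tested with a and with b and added, bounds the height h, in
  quadratic form, by the sagitta R - sqrt(R^2 - |a - b|^2/4) of the chord in a circle of radius R.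
  The last claim uses the test with a alone: it limits the asymmetry of the two halves, so that
  bisection shrinks chords by the factor sqrt 2.\<close>

lemma foot_midpoint:
  fixes a b c :: "'a::real_inner"
  assumes R: "R > 0" and ab: "a \<in> A" "b \<in> A" and lt: "norm (a - b) < 2 * R"
    and c: "foot R A ((1/2) *\<^sub>R (a + b)) c"
  defines "h \<equiv> infdist ((1/2) *\<^sub>R (a + b)) A"
  shows "(norm (a - c))\<^sup>2 + (norm (b - c))\<^sup>2 = 2 * h\<^sup>2 + (norm (a - b))\<^sup>2 / 2"
    and "h \<le> norm (a - b) / 2"
    and "4 * R * h \<le> 2 * h\<^sup>2 + (norm (a - b))\<^sup>2 / 2"
    and "(norm (a - c))\<^sup>2 \<le> (norm (a - b))\<^sup>2 / 2"
proof -
  define m where "m = (1/2) *\<^sub>R (a + b)"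
  define u where "u = (1/2) *\<^sub>R (a - b)"
  define k where "k = m - c"
  define q where "q = u \<bullet> k"
  define s where "s = norm (a - b) / 2"
  have a: "a - c = u + k" and b: "b - c = k - u"
    by (simp_all add: u_def k_def m_def algebra_simps flip: scaleR_add_left)
  have nk: "norm k = h" using c by (simp add: k_def m_def h_def foot_def)
  have nu: "norm u = s" by (simp add: u_def s_def)
  have sq: "h\<^sup>2 = k \<bullet> k" "s\<^sup>2 = u \<bullet> u" using nk nu by (simp_all add: power2_norm_eq_inner[symmetric])
  have na: "(norm (a - c))\<^sup>2 = h\<^sup>2 + s\<^sup>2 + 2 * q" and nb: "(norm (b - c))\<^sup>2 = h\<^sup>2 + s\<^sup>2 - 2 * q"
    unfolding a b power2_norm_eq_inner sq by (simp_all add: q_def inner_add inner_diff inner_commute)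
  show sum: "(norm (a - c))\<^sup>2 + (norm (b - c))\<^sup>2 = 2 * h\<^sup>2 + (norm (a - b))\<^sup>2 / 2"
    unfolding na nb by (simp add: s_def power2_eq_square)
  have h0: "h \<ge> 0" by (simp add: h_def infdist_nonneg)
  have hs: "h \<le> s"
  proof -
    have "h \<le> dist m a" unfolding h_def m_def[symmetric] by (rule infdist_le[OF ab(1)])
    also have "a = u + m" using a by (simp add: k_def)
    then have "dist m a = s" using nu by (simp add: dist_norm)
    finally show ?thesis .
  qed
  then show "h \<le> norm (a - b) / 2" by (simp add: s_def)
  have sR: "s < R" and s0: "s \<ge> 0" using lt by (simp_all add: s_def)
  have "2 * R * ((a - c) \<bullet> k) \<le> h * (norm (a - c))\<^sup>2" "2 * R * ((b - c) \<bullet> k) \<le> h * (norm (b - c))\<^sup>2"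
    using c ab unfolding foot_def h_def[symmetric] m_def[symmetric] k_def[symmetric] nk by auto
  then have Fa: "2 * R * (h\<^sup>2 + q) \<le> h * (h\<^sup>2 + s\<^sup>2 + 2 * q)" and Fb: "2 * R * (h\<^sup>2 - q) \<le> h * (h\<^sup>2 + s\<^sup>2 - 2 * q)"
    unfolding na nb unfolding a b sq by (simp_all add: q_def inner_add inner_diff inner_commute add.commute)
  have "h * (4 * R * h) \<le> h * (2 * h\<^sup>2 + 2 * s\<^sup>2)" using Fa Fb by (simp add: algebra_simps power2_eq_square)
  then have "4 * R * h \<le> 2 * h\<^sup>2 + 2 * s\<^sup>2" using h0 by (cases "h = 0") auto
  then show "4 * R * h \<le> 2 * h\<^sup>2 + (norm (a - b))\<^sup>2 / 2" by (simp add: s_def power2_eq_square)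
  have "(R - h) * (h\<^sup>2 + 2 * q) \<le> h * (s\<^sup>2 - R * h)"
    using Fa by (simp add: algebra_simps power2_eq_square)
  also have "\<dots> \<le> (R - h) * s\<^sup>2"
  proof -
    have "2 * (s * h) * s \<le> 2 * (s * h) * R" using s0 h0 sR by (intro mult_left_mono) auto
    also have "2 * (s * h) * R \<le> (s\<^sup>2 + h\<^sup>2) * R"
      using R sum_squares_bound[of s h] by (intro mult_right_mono) auto
    finally show ?thesis by (simp add: algebra_simps power2_eq_square)
  qed
  finally have "h\<^sup>2 + 2 * q \<le> s\<^sup>2" using hs sR by (simp add: mult_le_cancel_left_pos)
  then show "(norm (a - c))\<^sup>2 \<le> (norm (a - b))\<^sup>2 / 2" unfolding na by (simp add: s_def power2_eq_square)
qed

text \<open>With $\alpha = 2R\sin x$ and $\beta = 2R\sin y$ the claim follows from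
  $\sin^2 x + \sin^2 y = 1 - \cos(x+y)\cos(x-y)$ and $x, y \le \pi/4$.\<close>

lemma arcsin_halves_le:
  fixes R :: real
  assumes R: "R > 0" and e: "0 \<le> e" "e < 2 * R" and h: "0 \<le> h" "h \<le> e / 2" "4 * R * h \<le> 2 * h\<^sup>2 + e\<^sup>2 / 2"
    and \<alpha>: "0 \<le> \<alpha>" "\<alpha>\<^sup>2 \<le> e\<^sup>2 / 2" and \<beta>: "0 \<le> \<beta>" "\<beta>\<^sup>2 \<le> e\<^sup>2 / 2" and sum: "\<alpha>\<^sup>2 + \<beta>\<^sup>2 = 2 * h\<^sup>2 + e\<^sup>2 / 2"
  shows "arcsin (\<alpha> / (2 * R)) + arcsin (\<beta> / (2 * R)) \<le> arcsin (e / (2 * R))"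
proof -
  define \<theta> where "\<theta> = arcsin (e / (2 * R))"
  have bnd: "0 \<le> e / (2 * R)" "e / (2 * R) < 1" using R e by auto
  have \<theta>: "0 \<le> \<theta>" "\<theta> \<le> pi / 2" "sin \<theta> = e / (2 * R)"
    using bnd arcsin_bounded[of "e / (2 * R)"] arcsin_le_arcsin[of 0 "e / (2 * R)"] by (auto simp: \<theta>_def)
  have cos: "0 \<le> cos \<theta>" using \<theta> by (intro cos_ge_zero) auto
  have es: "e = 2 * R * sin \<theta>" using \<theta>(3) R by simp
  \<comment> \<open>The height \<open>h\<close> is at most the sagitta
    \<open>R - R * cos \<theta>\<close>, the smaller root of the quadratic inequality.\<close>
  have hR: "R * cos \<theta> \<le> R - h"
  proof (rule power2_le_imp_le)
    have "(R * cos \<theta>)\<^sup>2 = R\<^sup>2 - e\<^sup>2 / 4"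
      unfolding es power_mult_distrib cos_squared_eq by (simp add: algebra_simps)
    also have "\<dots> \<le> (R - h)\<^sup>2" using h(3) by (simp add: power2_eq_square algebra_simps)
    finally show "(R * cos \<theta>)\<^sup>2 \<le> (R - h)\<^sup>2" .
    show "0 \<le> R - h" using h e by simp
  qed
  have quarter: "0 \<le> arcsin (\<gamma> / (2 * R)) \<and> arcsin (\<gamma> / (2 * R)) \<le> pi / 4 \<and> sin (arcsin (\<gamma> / (2 * R))) = \<gamma> / (2 * R)"
    if "0 \<le> \<gamma>" "\<gamma>\<^sup>2 \<le> e\<^sup>2 / 2" for \<gamma>
  proof -
    have "e\<^sup>2 \<le> (2 * R)\<^sup>2" using e by (intro power_mono) auto
    then have "(\<gamma> / (2 * R))\<^sup>2 \<le> 1 / 2" using that(2) R by (simp add: power_divide pos_divide_le_eq)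
    also have "(1 / 2 :: real) = (sqrt 2 / 2)\<^sup>2" by (simp add: power_divide)
    finally have "\<gamma> / (2 * R) \<le> sin (pi / 4)" unfolding sin_45 by (rule power2_le_imp_le) simp
    moreover have "0 \<le> \<gamma> / (2 * R)" using that R by simp
    moreover have "\<gamma> / (2 * R) \<le> 1" using calculation(1) sin_le_one[of "pi / 4"] by linarith
    moreover have "arcsin (sin (pi / 4)) = pi / 4" by (rule arcsin_sin) auto
    ultimately show ?thesis
      using arcsin_le_arcsin[of "\<gamma> / (2 * R)" "sin (pi / 4)"] arcsin_le_arcsin[of 0 "\<gamma> / (2 * R)"] by auto
  qed
  define x where "x = arcsin (\<alpha> / (2 * R))"
  define y where "y = arcsin (\<beta> / (2 * R))"
  have x: "0 \<le> x" "x \<le> pi / 4" "sin x = \<alpha> / (2 * R)" using quarter[OF \<alpha>] by (auto simp: x_def)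
  have y: "0 \<le> y" "y \<le> pi / 4" "sin y = \<beta> / (2 * R)" using quarter[OF \<beta>] by (auto simp: y_def)
  have c0: "0 \<le> cos (x + y)" using x y by (intro cos_ge_zero) auto
  have "1 - cos (x + y) \<le> 1 - cos (x + y) * cos (x - y)"
    using mult_left_mono[OF cos_le_one[of "x - y"] c0] by simp
  also have "\<dots> = (sin x)\<^sup>2 + (sin y)\<^sup>2"
  proof -
    have "cos (x + y) * cos (x - y) = (cos x)\<^sup>2 * (cos y)\<^sup>2 - (sin x)\<^sup>2 * (sin y)\<^sup>2"
      by (simp add: cos_add cos_diff algebra_simps power2_eq_square)
    also have "\<dots> = 1 - (sin x)\<^sup>2 - (sin y)\<^sup>2" unfolding cos_squared_eq by (simp add: algebra_simps)
    finally show ?thesis by simp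
  qed
  also have "\<dots> = (2 * h\<^sup>2 + e\<^sup>2 / 2) / (2 * R)\<^sup>2" unfolding x y power_divide using sum by (simp flip: add_divide_distrib)
  also have "\<dots> \<le> (2 * (R - R * cos \<theta>)\<^sup>2 + e\<^sup>2 / 2) / (2 * R)\<^sup>2"
    using hR h(1) e(1) by (intro divide_right_mono add_mono mult_left_mono power_mono) auto
  also have "\<dots> = 1 - cos \<theta>"
  proof -
    have "2 * (R - R * cos \<theta>)\<^sup>2 + e\<^sup>2 / 2 = (1 - cos \<theta>) * (2 * R)\<^sup>2"
      unfolding es power_mult_distrib sin_squared_eq by (simp add: field_simps power2_eq_square)
    then show ?thesis using R by simp
  qed
  finally have "cos \<theta> \<le> cos (x + y)" by simp
  then have "x + y \<le> \<theta>" using cos_monotone_0_pi[of \<theta> "x + y"] \<theta> x y by force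
  then show ?thesis by (simp add: x_def y_def \<theta>_def)
qed

lemma le_arcsin: "0 \<le> y \<Longrightarrow> y \<le> 1 \<Longrightarrow> y \<le> arcsin y"
  using sin_x_le_x[of "arcsin y"] arcsin_le_arcsin[of 0 y] by simp

text \<open>By \<open>arcsin_halves_le\<close> the bounds for the two halves add up to at most the
  bound for the whole, so bisection accumulates no loss. The only error is the projection factor of
  the last chords, which tends to 1 with the depth.\<close>

lemma path_dist_le_arcsin:
  fixes A :: "'a::real_inner set"
  assumes R: "R > 0" and feet: "has_feet R A" and ab: "a \<in> A" "b \<in> A" and lt: "norm (a - b) < 2 * R"
  shows "path_dist A a b \<le> 2 * R * arcsin (norm (a - b) / (2 * R))"
proof -
  \<comment> \<open>bisect $k$ times, then project the chords, which are shorter by the factor $\sqrt 2^k$\<close>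
  have approx: "path_dist A a b \<le> 2 * R * arcsin (norm (a - b) / (2 * R)) / (1 - norm (a - b) / (2 * R * sqrt 2 ^ k))"
    if "a \<in> A" "b \<in> A" "norm (a - b) < 2 * R" for k and a b :: 'a
    using that
  proof (induction k arbitrary: a b)
    case 0
    have "norm (a - b) \<le> 2 * R * arcsin (norm (a - b) / (2 * R))"
      using le_arcsin[of "norm (a - b) / (2 * R)"] 0 R by (simp add: pos_divide_le_eq mult.commute)
    then have "norm (a - b) / (1 - norm (a - b) / (2 * R)) \<le> 2 * R * arcsin (norm (a - b) / (2 * R)) / (1 - norm (a - b) / (2 * R))"
      using 0 R by (intro divide_right_mono) auto
    then show ?case using path_dist_le_chord[OF R feet 0] by simp
  next
    case (Suc k)
    define e where "e = norm (a - b)"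
    define m where "m = (1/2) *\<^sub>R (a + b)"
    define h where "h = infdist m A"
    have "h \<le> dist m a" unfolding h_def by (rule infdist_le[OF Suc.prems(1)])
    also have "m - a = (1/2) *\<^sub>R (b - a)" by (simp add: m_def algebra_simps flip: scaleR_add_left)
    then have "dist m a = e / 2" by (simp add: dist_norm e_def norm_minus_commute)
    finally have "infdist m A < R" using Suc.prems(3) by (simp add: h_def e_def)
    then obtain c where c: "foot R A m c" using feet has_feet_def by blast
    then have cA: "c \<in> A" by (simp add: foot_def)
    have c': "foot R A ((1/2) *\<^sub>R (b + a)) c" using c by (simp add: m_def add.commute)
    note F = foot_midpoint[OF R Suc.prems c[unfolded m_def], folded m_def, folded h_def]
    have lt': "norm (b - a) < 2 * R" using Suc.prems(3) by (simp add: norm_minus_commute)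
    have F': "(norm (b - c))\<^sup>2 \<le> (norm (a - b))\<^sup>2 / 2"
      using foot_midpoint(4)[OF R Suc.prems(2,1) lt' c'] by (simp add: norm_minus_commute)
    have e0: "0 \<le> e" "e < 2 * R" using Suc.prems(3) by (auto simp: e_def)
    have half: "\<gamma> \<le> e / sqrt 2" if "\<gamma>\<^sup>2 \<le> e\<^sup>2 / 2" for \<gamma>
      by (rule power2_le_imp_le) (use that e0 in \<open>simp_all add: power_divide\<close>)
    have le: "norm (a - c) \<le> e / sqrt 2" "norm (b - c) \<le> e / sqrt 2"
      using half[of "norm (a - c)"] half[of "norm (b - c)"] F(4) F' by (simp_all add: e_def)
    have "e / sqrt 2 \<le> e / 1" using e0 by (intro divide_left_mono) auto
    then have lts: "norm (a - c) < 2 * R" "norm (c - b) < 2 * R" using le e0 by (simp_all add: norm_minus_commute)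
    define \<kappa> where "\<kappa> = 1 - e / (2 * R * sqrt 2 ^ Suc k)"
    have \<kappa>: "\<kappa> > 0"
    proof -
      have "e < 2 * R * 1" using e0 by simp
      also have "\<dots> \<le> 2 * R * sqrt 2 ^ Suc k" using R by (intro mult_left_mono one_le_power) auto
      finally show ?thesis using R by (simp add: \<kappa>_def)
    qed
    have part: "path_dist A u v \<le> 2 * R * arcsin (norm (u - v) / (2 * R)) / \<kappa>"
      if uv: "u \<in> A" "v \<in> A" "norm (u - v) < 2 * R" "norm (u - v) \<le> e / sqrt 2" for u v
    proof -
      have "norm (u - v) / (2 * R * sqrt 2 ^ k) \<le> (e / sqrt 2) / (2 * R * sqrt 2 ^ k)"
        using uv(4) R by (intro divide_right_mono) auto
      then have "\<kappa> \<le> 1 - norm (u - v) / (2 * R * sqrt 2 ^ k)" by (simp add: \<kappa>_def mult_ac)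
      moreover have "0 < 1 - norm (u - v) / (2 * R * sqrt 2 ^ k)" using calculation \<kappa> by linarith
      moreover have "0 \<le> arcsin (norm (u - v) / (2 * R))"
        using arcsin_le_arcsin[of 0 "norm (u - v) / (2 * R)"] uv(3) R by simp
      ultimately have "2 * R * arcsin (norm (u - v) / (2 * R)) / (1 - norm (u - v) / (2 * R * sqrt 2 ^ k))
          \<le> 2 * R * arcsin (norm (u - v) / (2 * R)) / \<kappa>"
        using R \<kappa> by (intro divide_left_mono mult_nonneg_nonneg mult_pos_pos[of "1 - norm (u - v) / (2 * R * sqrt 2 ^ k)"]) (assumption | simp)+
      then show ?thesis using Suc.IH[OF uv(1-3)] by linarith
    qed
    have "path_dist A a b \<le> path_dist A a c + path_dist A c b"
      using path_dist_triangle crude_path[OF R feet Suc.prems(1) cA lts(1)] crude_path[OF R feet cA Suc.prems(2) lts(2)] by blast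
    also have "\<dots> \<le> 2 * R * arcsin (norm (a - c) / (2 * R)) / \<kappa> + 2 * R * arcsin (norm (b - c) / (2 * R)) / \<kappa>"
      using part[of a c] part[of c b] Suc.prems cA lts le by (intro add_mono) (auto simp: norm_minus_commute)
    also have "\<dots> = 2 * R * (arcsin (norm (a - c) / (2 * R)) + arcsin (norm (b - c) / (2 * R))) / \<kappa>"
      by (simp add: add_divide_distrib distrib_left)
    also have "\<dots> \<le> 2 * R * arcsin (e / (2 * R)) / \<kappa>"
      using less_imp_le[OF \<kappa>] less_imp_le[OF R] arcsin_halves_le[OF R e0 _ F(2)[folded e_def] F(3)[folded e_def]
          norm_ge_zero F(4)[folded e_def] norm_ge_zero F'[folded e_def] F(1)[folded e_def]]
      by (intro divide_right_mono mult_left_mono) (simp_all add: h_def infdist_nonneg)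
    finally show ?case by (simp add: \<kappa>_def e_def)
  qed
  have "(\<lambda>k. (1 / sqrt 2) ^ k) \<longlonglongrightarrow> 0" by (rule LIMSEQ_realpow_zero) auto
  then have "(\<lambda>k. 2 * R * arcsin (norm (a - b) / (2 * R)) / (1 - norm (a - b) / (2 * R) * (1 / sqrt 2) ^ k))
     \<longlonglongrightarrow> 2 * R * arcsin (norm (a - b) / (2 * R)) / (1 - norm (a - b) / (2 * R) * 0)"
    by (intro tendsto_intros) auto
  then have "(\<lambda>k. 2 * R * arcsin (norm (a - b) / (2 * R)) / (1 - norm (a - b) / (2 * R * sqrt 2 ^ k)))
     \<longlonglongrightarrow> 2 * R * arcsin (norm (a - b) / (2 * R))"
    by (simp add: power_divide)
  then show ?thesis by (rule LIMSEQ_le_const) (use approx[OF ab lt] in auto)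
qed

section \<open>First variation and uniqueness\<close>

text \<open>The inequality of the foot c of z is tested with x and y and averaged with the weights 1
  - \<tau> and \<tau>, for which the average of x - c and y - c is z - c. The result is 2Rh <= h^2 +
  \<tau>(1 - \<tau>)|y - x|^2, and the trivial bound h <= \<tau>|y - x| completes the right-hand
  side to \<tau>|y - x|^2.\<close>

lemma infdist_segment_le:
  fixes A :: "'a::real_inner set"
  assumes R: "R > 0" and feet: "has_feet R A" and xy: "x \<in> A" "y \<in> A" and \<tau>: "0 \<le> \<tau>" "\<tau> \<le> 1"
    and near: "infdist (x + \<tau> *\<^sub>R (y - x)) A < R"
  shows "infdist (x + \<tau> *\<^sub>R (y - x)) A \<le> \<tau> * (norm (y - x))\<^sup>2 / (2 * R)"
proof -
  define w where "w = y - x"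
  define z where "z = x + \<tau> *\<^sub>R w"
  define h where "h = infdist z A"
  obtain c where c: "foot R A z c" using feet near unfolding has_feet_def z_def w_def by blast
  define k where "k = z - c"
  have nk: "norm k = h" using c by (simp add: foot_def k_def h_def)
  have kk: "k \<bullet> k = h\<^sup>2" using nk by (simp add: power2_norm_eq_inner[symmetric])
  have x: "x - c = k - \<tau> *\<^sub>R w" and y: "y - c = k + (1 - \<tau>) *\<^sub>R w"
    by (simp_all add: k_def z_def w_def algebra_simps)
  have "2 * R * ((x - c) \<bullet> k) \<le> h * (norm (x - c))\<^sup>2" and "2 * R * ((y - c) \<bullet> k) \<le> h * (norm (y - c))\<^sup>2"
    using c xy unfolding foot_def k_def[symmetric] nk by auto
  then have "(1 - \<tau>) * (2 * R * ((x - c) \<bullet> k)) + \<tau> * (2 * R * ((y - c) \<bullet> k))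
      \<le> (1 - \<tau>) * (h * (norm (x - c))\<^sup>2) + \<tau> * (h * (norm (y - c))\<^sup>2)"
    using \<tau> by (intro add_mono mult_left_mono) auto
  also have "(1 - \<tau>) * (2 * R * ((x - c) \<bullet> k)) + \<tau> * (2 * R * ((y - c) \<bullet> k)) = 2 * R * h\<^sup>2"
    unfolding x y by (simp add: inner_diff_left inner_add_left kk algebra_simps)
  also have "(1 - \<tau>) * (h * (norm (x - c))\<^sup>2) + \<tau> * (h * (norm (y - c))\<^sup>2) = h * (h\<^sup>2 + \<tau> * (1 - \<tau>) * (norm w)\<^sup>2)"
    unfolding x y power2_norm_eq_inner
    by (simp add: inner_diff inner_add kk inner_commute algebra_simps power2_eq_square)
  finally have main: "h * (2 * R * h) \<le> h * (h\<^sup>2 + \<tau> * (1 - \<tau>) * (norm w)\<^sup>2)" by (simp add: power2_eq_square mult_ac)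
  have h0: "0 \<le> h" by (simp add: h_def infdist_nonneg)
  have "h \<le> \<tau> * norm w" using infdist_le[OF xy(1), of z] \<tau> by (simp add: h_def z_def dist_norm)
  then have "h\<^sup>2 \<le> \<tau>\<^sup>2 * (norm w)\<^sup>2" using h0 by (metis power_mono power_mult_distrib)
  moreover have "2 * R * h \<le> h\<^sup>2 + \<tau> * (1 - \<tau>) * (norm w)\<^sup>2"
    using main h0 \<tau> R by (cases "h = 0") auto
  moreover have "\<tau>\<^sup>2 * (norm w)\<^sup>2 + \<tau> * (1 - \<tau>) * (norm w)\<^sup>2 = \<tau> * (norm w)\<^sup>2"
    by (simp add: algebra_simps power2_eq_square)
  ultimately have "2 * R * h \<le> \<tau> * (norm w)\<^sup>2" by linarith
  then show ?thesis using R by (simp add: h_def z_def w_def pos_le_divide_eq mult.commute)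
qed

text \<open>The points $x_i$ are moved to $z_i = x_i + \epsilon u_i$ and projected back to $A$; the projection
  stretches distances near $z_i$ by at most $1/(1 - d(z_i)/R)$, and
  $2 R\, d(z_i) \le \epsilon \eta_i |y_i - x_i|^2$. The right-hand side bounds the discrete energy
  of the projected chain up to second order in $\epsilon$.\<close>

lemma first_variation:
  fixes A :: "'a::real_inner set" and x y :: "nat \<Rightarrow> 'a" and \<eta> :: "nat \<Rightarrow> real"
  assumes R: "R > 0" and feet: "has_feet R A" and N: "N > 0"
    and xA: "\<And>i. i \<le> N \<Longrightarrow> x i \<in> A" and yA: "\<And>i. i \<le> N \<Longrightarrow> y i \<in> A"
    and \<eta>: "\<And>i. i \<le> N \<Longrightarrow> 0 \<le> \<eta> i" "\<And>i. i \<le> N \<Longrightarrow> \<eta> i \<le> 1"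
    and W: "\<And>i. i \<le> N \<Longrightarrow> norm (y i - x i) \<le> W"
    and u: "\<And>i. u i = \<eta> i *\<^sub>R (y i - x i)" and u0: "u 0 = 0" "u N = 0"
    and l: "\<And>i. i < N \<Longrightarrow> norm (x (Suc i) - x i) \<le> l / real N"
    and K: "\<And>i. i < N \<Longrightarrow> norm (u (Suc i) - u i) \<le> K / real N"
    and \<epsilon>: "0 \<le> \<epsilon>" "\<epsilon> \<le> 1" "\<epsilon> * W < R" "\<epsilon> * \<sigma> \<le> 1 / 2" and \<sigma>: "\<sigma> = W\<^sup>2 / (2 * R\<^sup>2)"
    and big: "(l + K) / real N < R"
  shows "(path_dist A (x 0) (x N))\<^sup>2 * (1 - 2 * (l + K) / (R * real N)) \<le>
    l\<^sup>2 + \<epsilon> * (2 * real N * (\<Sum>i<N. (x (Suc i) - x i) \<bullet> (u (Suc i) - u i))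
      + l\<^sup>2 / (2 * R\<^sup>2 * real N) * (\<Sum>i<N. \<eta> i * (norm (y i - x i))\<^sup>2 + \<eta> (Suc i) * (norm (y (Suc i) - x (Suc i)))\<^sup>2))
    + (8 * l\<^sup>2 * \<sigma>\<^sup>2 + 12 * l * K * \<sigma> + 4 * K\<^sup>2) * \<epsilon>\<^sup>2"
proof -
  define z where "z i = x i + \<epsilon> *\<^sub>R u i" for i
  define d where "d i = infdist (z i) A" for i
  define g where "g i = \<eta> i * (norm (y i - x i))\<^sup>2" for i
  define I where "I i = (x (Suc i) - x i) \<bullet> (u (Suc i) - u i)" for i
  define C where "C = 8 * l\<^sup>2 * \<sigma>\<^sup>2 + 12 * l * K * \<sigma> + 4 * K\<^sup>2"
  have l0: "l \<ge> 0" and K0: "K \<ge> 0"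
    using order_trans[OF norm_ge_zero l[OF N]] order_trans[OF norm_ge_zero K[OF N]] N
    by (auto simp: zero_le_divide_iff)
  have W0: "W \<ge> 0" using order_trans[OF norm_ge_zero W[of 0]] by simp
  have \<sigma>0: "\<sigma> \<ge> 0" by (simp add: \<sigma>)
  have g: "0 \<le> g i \<and> g i \<le> W\<^sup>2" if "i \<le> N" for i
  proof -
    have "\<eta> i * (norm (y i - x i))\<^sup>2 \<le> 1 * W\<^sup>2"
      using \<eta>[OF that] W[OF that] by (intro mult_mono power_mono) auto
    then show ?thesis using \<eta>[OF that] by (simp add: g_def)
  qed
  have zz: "z i = x i + (\<epsilon> * \<eta> i) *\<^sub>R (y i - x i)" for i by (simp add: z_def u)
  have dR: "d i < R \<and> 2 * R * d i \<le> \<epsilon> * g i" if i: "i \<le> N" for i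
  proof -
    have t: "0 \<le> \<epsilon> * \<eta> i" "\<epsilon> * \<eta> i \<le> \<epsilon>" "\<epsilon> * \<eta> i \<le> 1"
      using \<epsilon>(1,2) \<eta>[OF i] by (auto intro: mult_left_le mult_le_one)
    have "d i \<le> norm (z i - x i)" using infdist_le[OF xA[OF i]] by (simp add: d_def dist_norm)
    also have "\<dots> = (\<epsilon> * \<eta> i) * norm (y i - x i)" using t(1) by (simp add: zz del: abs_mult)
    also have "\<dots> \<le> \<epsilon> * W" using t W[OF i] \<epsilon> by (intro mult_mono) auto
    finally have "d i < R" using \<epsilon>(3) by linarith
    moreover from infdist_segment_le[OF R feet xA[OF i] yA[OF i] t(1,3)] this
    have "d i \<le> \<epsilon> * \<eta> i * (norm (y i - x i))\<^sup>2 / (2 * R)" by (simp add: d_def zz)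
    ultimately show ?thesis using R by (simp add: g_def pos_le_divide_eq mult_ac)
  qed
  define p where "p i = (SOME p. foot R A (z i) p)" for i
  have foot: "foot R A (z i) (p i)" if "i \<le> N" for i
    unfolding p_def by (rule someI_ex) (use feet dR[OF that] in \<open>auto simp: has_feet_def d_def\<close>)
  have p0: "p 0 = x 0" "p N = x N"
    using foot_self[OF foot[of 0]] foot_self[OF foot[of N]] xA u0 by (auto simp: z_def)
  have I: "\<bar>I i\<bar> \<le> l * K / N\<^sup>2" if "i < N" for i
  proof -
    have "\<bar>I i\<bar> \<le> norm (x (Suc i) - x i) * norm (u (Suc i) - u i)"
      unfolding I_def by (rule Cauchy_Schwarz_ineq2)
    also have "\<dots> \<le> (l / N) * (K / N)" using l[OF that] K[OF that] l0 by (intro mult_mono) auto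
    finally show ?thesis by (simp add: power2_eq_square)
  qed
  have step: "norm (p (Suc i) - p i) \<le> 2 * (l + K) / N \<and>
      (norm (p (Suc i) - p i))\<^sup>2 \<le> 2 * \<epsilon> * I i + \<epsilon> * (l\<^sup>2 / (2 * R\<^sup>2 * N\<^sup>2)) * (g i + g (Suc i)) + (l\<^sup>2 + C * \<epsilon>\<^sup>2) / N\<^sup>2"
    if i: "i < N" for i
  proof -
    have i': "i \<le> N" "Suc i \<le> N" using i by auto
    define s where "s = (d (Suc i) + d i) / (2 * R)"
    \<comment> \<open>On [0, 1/2] the polynomial 1 + \<open>T\<close> majorizes 1/(1 - s)^2 with the
      exact linear term; its quadratic term goes into the error of order
      \<open>\<epsilon>\<^sup>2\<close>.\<close>
    define T where "T = 2 * s + 8 * s\<^sup>2"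
    define X where "X = x (Suc i) - x i"
    define U where "U = u (Suc i) - u i"
    have dnn: "0 \<le> d i" for i by (simp add: d_def infdist_nonneg)
    have "d (Suc i) + d i \<le> \<epsilon> * (g i + g (Suc i)) / (2 * R)"
      using dR[OF i'(1)] dR[OF i'(2)] R by (simp add: pos_le_divide_eq algebra_simps)
    then have "s \<le> \<epsilon> * (g i + g (Suc i)) / (2 * R) / (2 * R)" unfolding s_def using R by (intro divide_right_mono) auto
    then have s1: "2 * s \<le> \<epsilon> * (g i + g (Suc i)) / (2 * R\<^sup>2)" by (simp add: power2_eq_square)
    also have "\<dots> \<le> \<epsilon> * (W\<^sup>2 + W\<^sup>2) / (2 * R\<^sup>2)"
      using g[OF i'(1)] g[OF i'(2)] \<epsilon> by (intro divide_right_mono mult_left_mono add_mono) auto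
    finally have s2: "s \<le> \<epsilon> * \<sigma>" by (simp add: \<sigma>)
    have s0: "0 \<le> s" using R dnn by (simp add: s_def)
    have sh: "s \<le> 1 / 2" using s2 \<epsilon> by linarith
    have lip: "norm (p (Suc i) - p i) * (1 - s) \<le> norm (z (Suc i) - z i)"
      using foot_lipschitz[OF R foot[OF i'(2)] foot[OF i'(1)]] by (simp add: s_def d_def)
    have zXU: "z (Suc i) - z i = X + \<epsilon> *\<^sub>R U" by (simp add: z_def X_def U_def algebra_simps)
    have X: "norm X \<le> l / N" and U: "norm U \<le> K / N" using l[OF i] K[OF i] by (auto simp: X_def U_def)
    have "norm (z (Suc i) - z i) \<le> norm X + \<epsilon> * norm U" unfolding zXU using norm_triangle_ineq[of X "\<epsilon> *\<^sub>R U"] \<epsilon> by simp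
    also have "\<dots> \<le> l / N + 1 * (K / N)" using X U \<epsilon> by (intro add_mono mult_mono) auto
    finally have z1: "norm (z (Suc i) - z i) \<le> (l + K) / N" by (simp add: add_divide_distrib)
    have "norm (p (Suc i) - p i) * (1 / 2) \<le> norm (p (Suc i) - p i) * (1 - s)"
      using sh by (intro mult_left_mono) auto
    then have c1: "norm (p (Suc i) - p i) \<le> 2 * (l + K) / N" using lip z1
      unfolding times_divide_eq_right[symmetric] by linarith
    have poly: "1 \<le> (1 - s)\<^sup>2 * (1 + T)"
    proof -
      have "(1 - s)\<^sup>2 * (1 + T) - 1 = s\<^sup>2 * ((1 - 2 * s) * (5 - 4 * s))"
        by (simp add: T_def power2_eq_square algebra_simps)
      also have "\<dots> \<ge> 0" using sh by (intro mult_nonneg_nonneg) auto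
      finally show ?thesis by simp
    qed
    have T0: "0 \<le> T" using s0 by (simp add: T_def)
    have "s * s \<le> s * (1 / 2)" using s0 sh by (intro mult_left_mono)
    then have T6: "T \<le> 6 * (\<epsilon> * \<sigma>)" using s2 by (simp add: T_def power2_eq_square)
    have T3: "T \<le> 3" using T6 \<epsilon>(4) by linarith
    have ss: "s\<^sup>2 \<le> (\<epsilon> * \<sigma>)\<^sup>2" using s0 s2 by (intro power_mono)
    have X2: "(norm X)\<^sup>2 \<le> l\<^sup>2 / N\<^sup>2" and U2: "(norm U)\<^sup>2 \<le> K\<^sup>2 / N\<^sup>2"
      using power_mono[OF X norm_ge_zero, of 2] power_mono[OF U norm_ge_zero, of 2] by (simp_all add: power_divide)
    have "(norm (p (Suc i) - p i))\<^sup>2 \<le> (norm (p (Suc i) - p i))\<^sup>2 * ((1 - s)\<^sup>2 * (1 + T))"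
      using mult_left_mono[OF poly, of "(norm (p (Suc i) - p i))\<^sup>2"] by simp
    also have "\<dots> = (norm (p (Suc i) - p i) * (1 - s))\<^sup>2 * (1 + T)" by (simp add: power_mult_distrib)
    also have "\<dots> \<le> (norm (z (Suc i) - z i))\<^sup>2 * (1 + T)"
      using lip T0 sh by (intro mult_right_mono power_mono) auto
    also have "(norm (z (Suc i) - z i))\<^sup>2 = (norm X)\<^sup>2 + 2 * \<epsilon> * I i + \<epsilon>\<^sup>2 * (norm U)\<^sup>2"
      unfolding zXU power2_norm_eq_inner I_def X_def[symmetric] U_def[symmetric]
      by (simp add: inner_add inner_commute algebra_simps power2_eq_square)
    also have "\<dots> * (1 + T) = (norm X)\<^sup>2 * (1 + T) + 2 * \<epsilon> * I i + 2 * \<epsilon> * (I i * T) + \<epsilon>\<^sup>2 * ((norm U)\<^sup>2 * (1 + T))"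
      by (simp add: algebra_simps)
    also have "\<dots> \<le> l\<^sup>2 / N\<^sup>2 * (1 + \<epsilon> * (g i + g (Suc i)) / (2 * R\<^sup>2) + 8 * (\<epsilon> * \<sigma>)\<^sup>2) + 2 * \<epsilon> * I i
        + 2 * \<epsilon> * (l * K / N\<^sup>2 * (6 * (\<epsilon> * \<sigma>))) + \<epsilon>\<^sup>2 * (K\<^sup>2 / N\<^sup>2 * 4)"
    proof (intro add_mono order_refl)
      show "(norm X)\<^sup>2 * (1 + T) \<le> l\<^sup>2 / N\<^sup>2 * (1 + \<epsilon> * (g i + g (Suc i)) / (2 * R\<^sup>2) + 8 * (\<epsilon> * \<sigma>)\<^sup>2)"
        using X2 T0 s1 ss unfolding T_def by (intro mult_mono) auto
      have "I i * T \<le> \<bar>I i\<bar> * T" using T0 by (intro mult_right_mono) auto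
      also have "\<dots> \<le> l * K / N\<^sup>2 * (6 * (\<epsilon> * \<sigma>))"
        using I[OF i] T0 T6 l0 K0 by (intro mult_mono) auto
      finally show "2 * \<epsilon> * (I i * T) \<le> 2 * \<epsilon> * (l * K / N\<^sup>2 * (6 * (\<epsilon> * \<sigma>)))"
        using \<epsilon> by (intro mult_left_mono) auto
      show "\<epsilon>\<^sup>2 * ((norm U)\<^sup>2 * (1 + T)) \<le> \<epsilon>\<^sup>2 * (K\<^sup>2 / N\<^sup>2 * 4)"
        using U2 T0 T3 by (intro mult_left_mono mult_mono) auto
    qed
    also have "\<dots> = 2 * \<epsilon> * I i + \<epsilon> * (l\<^sup>2 / (2 * R\<^sup>2 * N\<^sup>2)) * (g i + g (Suc i)) + (l\<^sup>2 + C * \<epsilon>\<^sup>2) / N\<^sup>2"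
    proof -
      define n where "n = 1 / real (N\<^sup>2)"
      define r where "r = 1 / (2 * R\<^sup>2)"
      have e: "a / real (N\<^sup>2) = a * n" "a / (2 * R\<^sup>2) = a * r" "a / (2 * R\<^sup>2 * real (N\<^sup>2)) = a * (r * n)" for a
        by (simp_all add: n_def r_def)
      show ?thesis unfolding e C_def by (simp add: algebra_simps power2_eq_square)
    qed
    finally show ?thesis using c1 by simp
  qed
  define S where "S = (\<Sum>i<N. norm (p (Suc i) - p i))"
  \<comment> \<open>A bound for the edges of the projected chain: turning it into a path in A costs
    a factor that tends to 1 as N grows.\<close>
  define \<delta> where "\<delta> = 2 * (l + K) / N"
  have "\<delta> = 2 * ((l + K) / N)" by (simp add: \<delta>_def)
  moreover have "0 \<le> (l + K) / N" using l0 K0 by simp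
  ultimately have \<delta>: "0 \<le> \<delta>" "\<delta> < 2 * R" using big by linarith+
  obtain c where c: "unit_path A (x 0) (x N) (S / (1 - \<delta> / (2 * R))) c"
    using chain_path[OF R feet \<delta>, of N p] foot step p0 unfolding S_def \<delta>_def by (auto simp: foot_def)
  have pos: "1 - \<delta> / (2 * R) > 0" using \<delta> R by simp
  define lam where "lam = path_dist A (x 0) (x N)"
  have lam0: "0 \<le> lam" using order_trans[OF norm_ge_zero path_dist_ge_norm[OF c]] by (simp add: lam_def)
  have "lam * (1 - \<delta> / (2 * R)) \<le> S" using path_dist_le[OF c] pos by (simp add: lam_def pos_le_divide_eq)
  then have "(lam * (1 - \<delta> / (2 * R)))\<^sup>2 \<le> S\<^sup>2" using lam0 pos by (intro power_mono) auto
  then have "lam\<^sup>2 * (1 - \<delta> / (2 * R))\<^sup>2 \<le> S\<^sup>2" by (simp add: power_mult_distrib)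
  moreover have "lam\<^sup>2 * (1 - \<delta> / R) \<le> lam\<^sup>2 * (1 - \<delta> / (2 * R))\<^sup>2"
    by (intro mult_left_mono) (auto simp: power2_eq_square algebra_simps)
  ultimately have "lam\<^sup>2 * (1 - \<delta> / R) \<le> S\<^sup>2" by linarith
  also have "S\<^sup>2 \<le> N * (\<Sum>i<N. (norm (p (Suc i) - p i))\<^sup>2)" unfolding S_def
    using sum_squared_le_sum_of_squares[of _ "{..<N}"] by (simp add: mult.commute)
  also have "\<dots> \<le> N * (\<Sum>i<N. 2 * \<epsilon> * I i + \<epsilon> * (l\<^sup>2 / (2 * R\<^sup>2 * N\<^sup>2)) * (g i + g (Suc i)) + (l\<^sup>2 + C * \<epsilon>\<^sup>2) / N\<^sup>2)"
    using step by (intro mult_left_mono sum_mono) auto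
  also have "\<dots> = N * (2 * \<epsilon> * (\<Sum>i<N. I i) + \<epsilon> * (l\<^sup>2 / (2 * R\<^sup>2 * N\<^sup>2)) * (\<Sum>i<N. g i + g (Suc i)) + N * ((l\<^sup>2 + C * \<epsilon>\<^sup>2) / N\<^sup>2))"
    unfolding sum.distrib sum_distrib_left[symmetric] by simp
  also have "\<dots> = l\<^sup>2 + \<epsilon> * (2 * N * (\<Sum>i<N. I i) + l\<^sup>2 / (2 * R\<^sup>2 * N) * (\<Sum>i<N. g i + g (Suc i))) + C * \<epsilon>\<^sup>2"
  proof -
    define G where "G = (\<Sum>i<N. g i + g (Suc i))"
    define J where "J = (\<Sum>i<N. I i)"
    have e: "real N * (2 * \<epsilon> * J + \<epsilon> * v * G + N * v') = (N * (N * v')) + \<epsilon> * (2 * N * J + (N * v) * G)" for v v' :: real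
      by (simp add: algebra_simps)
    have "N * (l\<^sup>2 / (2 * R\<^sup>2 * N\<^sup>2)) = l\<^sup>2 / (2 * R\<^sup>2 * N)" "N * (N * ((l\<^sup>2 + C * \<epsilon>\<^sup>2) / N\<^sup>2)) = l\<^sup>2 + C * \<epsilon>\<^sup>2"
      using N by (simp_all add: power2_eq_square)
    then show ?thesis unfolding G_def[symmetric] J_def[symmetric] e by simp
  qed
  finally show ?thesis unfolding lam_def \<delta>_def C_def I_def g_def by (simp add: mult_ac)
qed

section \<open>Wirtinger's inequality on a grid\<close>

text \<open>Picone's argument with the positive solution $\sigma_i = \sin(\pi i/N)$. At the two end points
  the quotients below are $x/0 = 0$, multiplied by a vanishing norm.\<close>

lemma discrete_wirtinger:
  fixes w :: "nat \<Rightarrow> 'a::real_inner"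
  assumes N: "N > 0" and w: "w 0 = 0" "w N = 0"
  shows "4 * (sin (pi / (2 * real N)))\<^sup>2 * (\<Sum>i<N. (norm (w i))\<^sup>2) \<le> (\<Sum>i<N. (norm (w (Suc i) - w i))\<^sup>2)"
proof -
  define \<sigma> where "\<sigma> r = sin (pi * r / N)" for r :: real
  have pos: "\<sigma> (real i) > 0" if "0 < i" "i < N" for i
    unfolding \<sigma>_def using that by (intro sin_gt_zero) (auto simp: field_simps)
  \<comment> \<open>Each edge is shared between its end points: \<open>G\<close> is the part of the
    left one, \<open>F\<close> that of the right one. Regrouped by vertices, the weights add up to
    the first eigenvalue of the discrete Laplacian.\<close>
  define F where "F i = (norm (w i))\<^sup>2 * (1 - \<sigma> (real i - 1) / \<sigma> (real i))" for i
  define G where "G i = (norm (w i))\<^sup>2 * (1 - \<sigma> (real i + 1) / \<sigma> (real i))" for i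
  have edge: "F (Suc i) + G i \<le> (norm (w (Suc i) - w i))\<^sup>2" if i: "i < N" for i
  proof -
    have s0: "\<sigma> 0 = 0" "\<sigma> (real N) = 0" using N by (simp_all add: \<sigma>_def)
    consider "i = 0" | "Suc i = N" | "0 < i" "Suc i < N" using i by linarith
    then show ?thesis
    proof cases
      case 1
      then show ?thesis using w s0 by (simp add: F_def G_def)
    next
      case 2
      then have "real i + 1 = real N" by simp
      then have "\<sigma> (real i + 1) = 0" using s0 by simp
      then show ?thesis using w 2 by (simp add: F_def G_def)
    next
      case 3
      define a where "a = \<sigma> (real i)"
      define b where "b = \<sigma> (real (Suc i))"
      have ab: "a > 0" "b > 0" using pos[of i] pos[of "Suc i"] 3 by (auto simp: a_def b_def)
      \<comment> \<open>This square is the defect in Picone's identity; it vanishes if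
        \<open>w\<close> is a multiple of the sine.\<close>
      have "0 \<le> (norm (b *\<^sub>R w i - a *\<^sub>R w (Suc i)))\<^sup>2" by simp
      also have "\<dots> = b\<^sup>2 * (norm (w i))\<^sup>2 - 2 * (a * b) * (w i \<bullet> w (Suc i)) + a\<^sup>2 * (norm (w (Suc i)))\<^sup>2"
        unfolding power2_norm_eq_inner by (simp add: inner_diff inner_commute power2_eq_square algebra_simps)
      finally have "2 * (w i \<bullet> w (Suc i)) * (a * b) \<le> (b / a * (norm (w i))\<^sup>2 + a / b * (norm (w (Suc i)))\<^sup>2) * (a * b)"
        using ab by (simp add: power2_eq_square algebra_simps)
      then have "2 * (w i \<bullet> w (Suc i)) \<le> b / a * (norm (w i))\<^sup>2 + a / b * (norm (w (Suc i)))\<^sup>2"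
        using ab by (simp only: mult_le_cancel_right_pos mult_pos_pos)
      moreover have "(norm (w (Suc i) - w i))\<^sup>2 = (norm (w i))\<^sup>2 + (norm (w (Suc i)))\<^sup>2 - 2 * (w i \<bullet> w (Suc i))"
        unfolding power2_norm_eq_inner by (simp add: inner_diff inner_commute)
      moreover have "F (Suc i) = (norm (w (Suc i)))\<^sup>2 - a / b * (norm (w (Suc i)))\<^sup>2"
        by (simp add: F_def a_def b_def algebra_simps)
      moreover have "G i = (norm (w i))\<^sup>2 - b / a * (norm (w i))\<^sup>2"
        by (simp add: G_def a_def b_def algebra_simps)
      ultimately show ?thesis by linarith
    qed
  qed
  have FN: "F N = 0" "F 0 = 0" using w by (simp_all add: F_def)
  have "(\<Sum>i<N. F (Suc i)) = (\<Sum>i<N. F i)"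
    using sum.lessThan_Suc_shift[of F N] FN by simp
  then have "(\<Sum>i<N. F i + G i) = (\<Sum>i<N. F (Suc i) + G i)" by (simp add: sum.distrib)
  also have "\<dots> \<le> (\<Sum>i<N. (norm (w (Suc i) - w i))\<^sup>2)" using edge by (intro sum_mono) auto
  finally have 1: "(\<Sum>i<N. F i + G i) \<le> (\<Sum>i<N. (norm (w (Suc i) - w i))\<^sup>2)" .
  have "F i + G i = 4 * (sin (pi / (2 * real N)))\<^sup>2 * (norm (w i))\<^sup>2" if "i < N" for i
  proof (cases "i = 0")
    case True
    then show ?thesis using w by (simp add: F_def G_def)
  next
    case False
    have p: "\<sigma> (real i) > 0" using pos False that by simp
    have "\<sigma> (real i - 1) + \<sigma> (real i + 1) = 2 * cos (pi / N) * \<sigma> (real i)"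
      by (simp add: \<sigma>_def right_diff_distrib distrib_left diff_divide_distrib add_divide_distrib sin_add sin_diff)
    then have "\<sigma> (real i - 1) / \<sigma> (real i) + \<sigma> (real i + 1) / \<sigma> (real i) = 2 * cos (pi / N)"
      using p by (simp add: add_divide_distrib[symmetric])
    moreover have "cos (pi / N) = 1 - 2 * (sin (pi / (2 * real N)))\<^sup>2"
      using cos_double_sin[of "pi / (2 * real N)"] by simp
    moreover have "F i + G i = (norm (w i))\<^sup>2 * (2 - (\<sigma> (real i - 1) / \<sigma> (real i) + \<sigma> (real i + 1) / \<sigma> (real i)))"
      by (simp add: F_def G_def algebra_simps)
    ultimately show ?thesis by simp
  qed
  then have "(\<Sum>i<N. F i + G i) = (\<Sum>i<N. 4 * (sin (pi / (2 * real N)))\<^sup>2 * (norm (w i))\<^sup>2)" by (intro sum.cong) auto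
  then show ?thesis using 1 by (simp add: sum_distrib_left)
qed

lemma tendsto_mult_sin_divide: "(\<lambda>n. real n * sin (c / real n)) \<longlonglongrightarrow> c"
proof (cases "c = 0")
  case False
  have "\<forall>\<^sub>F n in sequentially. c / real n \<noteq> 0"
    using eventually_gt_at_top[of 0] by eventually_elim (use False in auto)
  then have "filterlim (\<lambda>n. c / real n) (at 0) sequentially"
    by (simp add: filterlim_at lim_const_over_n)
  moreover have "((\<lambda>x. sin x / x) \<longlongrightarrow> 1) (at (0::real))"
    using DERIV_sin[of "0::real"] by (simp add: DERIV_def)
  ultimately have "(\<lambda>n. sin (c / real n) / (c / real n)) \<longlonglongrightarrow> 1"
    by (rule filterlim_compose[rotated])
  then have "(\<lambda>n. c * (sin (c / real n) / (c / real n))) \<longlonglongrightarrow> c * 1"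
    by (intro tendsto_intros)
  moreover have "\<forall>\<^sub>F n in sequentially. c * (sin (c / real n) / (c / real n)) = real n * sin (c / real n)"
    using eventually_gt_at_top[of 0] by eventually_elim (use False in simp)
  ultimately show ?thesis by (simp add: tendsto_cong)
qed simp

text \<open>The rescaled discrete eigenvalue tends to the continuous one: for c = pi this is
  Wirtinger's constant, for c = l/R the coefficient in the equation of Green's function.\<close>

lemma tendsto_wirtinger_constant:
  "(\<lambda>N. 4 * (real N)\<^sup>2 * (sin (c / (2 * real N)))\<^sup>2) \<longlonglongrightarrow> c\<^sup>2"
proof -
  have "(\<lambda>N. 4 * (real N * sin (c / 2 / real N))\<^sup>2) \<longlonglongrightarrow> 4 * (c / 2)\<^sup>2"
    by (intro tendsto_intros tendsto_mult_sin_divide)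
  then show ?thesis by (simp add: power_mult_distrib power_divide mult.assoc)
qed

section \<open>Stability of almost shortest paths; uniqueness and existence\<close>

lemma norm_le_sum_increments:
  fixes w :: "nat \<Rightarrow> 'a::real_normed_vector"
  assumes "w 0 = 0"
  shows "norm (w k) \<le> (\<Sum>i<k. norm (w (Suc i) - w i))"
  using norm_sum[of "\<lambda>i. w (Suc i) - w i" "{..<k}"] assms by (simp add: sum_lessThan_telescope)

text \<open>The first variations of $x$ towards $y$ and of $y$ towards $x$ are added: the mixed terms combine
  to minus the energy of $y - x$, which dominates the remaining term by Wirtinger's inequality.\<close>

lemma near_shortest_increments:
  fixes A :: "'a::real_inner set" and x y :: "nat \<Rightarrow> 'a"
  assumes R: "R > 0" and feet: "has_feet R A" and N: "N > 0"
    and xA: "\<And>i. i \<le> N \<Longrightarrow> x i \<in> A" and yA: "\<And>i. i \<le> N \<Longrightarrow> y i \<in> A"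
    and ends: "x 0 = y 0" "x N = y N"
    and W: "\<And>i. i \<le> N \<Longrightarrow> norm (y i - x i) \<le> 2 * l0"
    and x: "\<And>i. i < N \<Longrightarrow> norm (x (Suc i) - x i) \<le> l / N"
    and y: "\<And>i. i < N \<Longrightarrow> norm (y (Suc i) - y i) \<le> l / N"
    and l: "l \<le> l0"
    and \<epsilon>: "0 < \<epsilon>" "\<epsilon> \<le> 1" "\<epsilon> * (2 * l0) < R" "\<epsilon> * \<sigma> \<le> 1 / 2" and \<sigma>: "\<sigma> = 2 * l0\<^sup>2 / R\<^sup>2"
    and big: "3 * l0 / N < R"
    and q: "q > 0" "q \<le> 4 * (real N)\<^sup>2 * (sin (pi / (2 * real N)))\<^sup>2"
  shows "\<epsilon> * ((1 - l0\<^sup>2 / R\<^sup>2 / q) * (N * (\<Sum>i<N. (norm ((y (Suc i) - x (Suc i)) - (y i - x i)))\<^sup>2)))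
    \<le> l\<^sup>2 - (path_dist A (x 0) (x N))\<^sup>2 * (1 - 6 * l0 / (R * N))
      + (8 * l0\<^sup>2 * \<sigma>\<^sup>2 + 24 * l0\<^sup>2 * \<sigma> + 16 * l0\<^sup>2) * \<epsilon>\<^sup>2"
proof -
  define w where "w i = y i - x i" for i
  define lam where "lam = path_dist A (x 0) (x N)"
  define S where "S = (\<Sum>i<N. (norm (w i))\<^sup>2)"
  define D where "D = N * (\<Sum>i<N. (norm (w (Suc i) - w i))\<^sup>2)"
  have l0': "0 \<le> l" using order_trans[OF norm_ge_zero x[OF N]] N by (auto simp: zero_le_divide_iff)
  have w0: "w 0 = 0" "w N = 0" using ends by (simp_all add: w_def)
  \<comment> \<open>The constant of \<open>first_variation\<close> for W = K = 2 \<open>l0\<close>,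
    with \<open>l\<close> enlarged to \<open>l0\<close>.\<close>
  define C where "C = 8 * l0\<^sup>2 * \<sigma>\<^sup>2 + 24 * l0\<^sup>2 * \<sigma> + 16 * l0\<^sup>2"
  have \<sigma>0: "\<sigma> \<ge> 0" by (simp add: \<sigma>)
  have shift: "(\<Sum>i<N. (norm (w (Suc i)))\<^sup>2) = S"
    using sum.lessThan_Suc_shift[of "\<lambda>i. (norm (w i))\<^sup>2" N] w0 by (simp add: S_def)
  have Cl: "8 * l\<^sup>2 * \<sigma>\<^sup>2 + 12 * l * (2 * l0) * \<sigma> + 4 * (2 * l0)\<^sup>2 \<le> C"
  proof -
    have "l\<^sup>2 \<le> l0\<^sup>2" using l l0' by (intro power_mono)
    then have "8 * l\<^sup>2 * \<sigma>\<^sup>2 \<le> 8 * l0\<^sup>2 * \<sigma>\<^sup>2" by (intro mult_right_mono mult_left_mono) auto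
    moreover have "12 * l * (2 * l0) * \<sigma> \<le> 12 * l0 * (2 * l0) * \<sigma>"
      using l l0' \<sigma>0 by (intro mult_right_mono mult_left_mono) auto
    ultimately show ?thesis by (simp add: C_def power2_eq_square)
  qed
  have dw: "norm (w (Suc i) - w i) \<le> 2 * l0 / N" if "i < N" for i
  proof -
    have "w (Suc i) - w i = (y (Suc i) - y i) - (x (Suc i) - x i)" by (simp add: w_def)
    then have "norm (w (Suc i) - w i) \<le> l / N + l / N"
      using norm_triangle_ineq4[of "y (Suc i) - y i" "x (Suc i) - x i"] x[OF that] y[OF that] by simp
    also have "\<dots> \<le> 2 * l0 / N" using l by (simp add: divide_right_mono flip: add_divide_distrib)
    finally show ?thesis .
  qed
  have big': "(l + 2 * l0) / N < R"
  proof -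
    have "(l + 2 * l0) / N \<le> 3 * l0 / N" using l by (intro divide_right_mono) auto
    then show ?thesis using big by simp
  qed
  have lam2: "lam\<^sup>2 * (1 - 6 * l0 / (R * N)) \<le> lam\<^sup>2 * (1 - 2 * (l + 2 * l0) / (R * N))"
    using l R by (intro mult_left_mono diff_left_mono divide_right_mono) auto
  \<comment> \<open>Stated for abstract paths, as it is applied to both orders of the pair;
    exchanging \<open>x\<close> and \<open>y\<close> changes the sign of \<open>w\<close>.\<close>
  have var: "lam\<^sup>2 * (1 - 6 * l0 / (R * N)) \<le> l\<^sup>2 + \<epsilon> * (2 * real N * (\<Sum>i<N. (x' (Suc i) - x' i) \<bullet> (w' (Suc i) - w' i)) + l\<^sup>2 / (R\<^sup>2 * N) * S) + C * \<epsilon>\<^sup>2"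
    if A': "\<And>i. i \<le> N \<Longrightarrow> x' i \<in> A" "\<And>i. i \<le> N \<Longrightarrow> y' i \<in> A" "x' 0 = x 0" "x' N = x N"
      and x': "\<And>i. i < N \<Longrightarrow> norm (x' (Suc i) - x' i) \<le> l / N"
      and w': "\<And>i. w' i = y' i - x' i" "\<And>i. norm (w' i) = norm (w i)" "\<And>i. norm (w' (Suc i) - w' i) = norm (w (Suc i) - w i)"
    for x' y' w' :: "nat \<Rightarrow> 'a"
  proof -
    have "norm (w' 0) = 0" "norm (w' N) = 0" unfolding w'(2) using w0 by auto
    then have w'0: "w' 0 = 0" "w' N = 0" by auto
    have "lam\<^sup>2 * (1 - 2 * (l + 2 * l0) / (R * N)) \<le>
      l\<^sup>2 + \<epsilon> * (2 * real N * (\<Sum>i<N. (x' (Suc i) - x' i) \<bullet> (w' (Suc i) - w' i))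
        + l\<^sup>2 / (2 * R\<^sup>2 * N) * (\<Sum>i<N. 1 * (norm (y' i - x' i))\<^sup>2 + 1 * (norm (y' (Suc i) - x' (Suc i)))\<^sup>2))
      + (8 * l\<^sup>2 * \<sigma>\<^sup>2 + 12 * l * (2 * l0) * \<sigma> + 4 * (2 * l0)\<^sup>2) * \<epsilon>\<^sup>2"
      unfolding lam_def A'(3,4)[symmetric]
    proof (rule first_variation[where x = x' and y = y' and u = w' and W = "2 * l0" and \<eta> = "\<lambda>_. 1"])
      show "norm (y' i - x' i) \<le> 2 * l0" if "i \<le> N" for i
        using W[OF that] w'(1,2) by (simp add: w_def)
      show "norm (w' (Suc i) - w' i) \<le> 2 * l0 / real N" if "i < N" for i
        using dw[OF that] w'(3) by simp
    qed (use R feet N A'(1,2) w'0 w'(1) x' \<epsilon> \<sigma> big' in \<open>auto simp: power_mult_distrib\<close>)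
    also have "(\<Sum>i<N. 1 * (norm (y' i - x' i))\<^sup>2 + 1 * (norm (y' (Suc i) - x' (Suc i)))\<^sup>2) = 2 * S"
      unfolding w'(1)[symmetric] w'(2) by (simp add: sum.distrib shift S_def)
    also have "l\<^sup>2 / (2 * R\<^sup>2 * N) * (2 * S) = l\<^sup>2 / (R\<^sup>2 * N) * S" by simp
    finally show ?thesis using lam2 mult_right_mono[OF Cl, of "\<epsilon>\<^sup>2"] by simp
  qed
  define P where "P = (\<Sum>i<N. (x (Suc i) - x i) \<bullet> (w (Suc i) - w i))"
  define Q where "Q = (\<Sum>i<N. (y (Suc i) - y i) \<bullet> (- w (Suc i) - - w i))"
  have PQ: "real N * (P + Q) = - D"
  proof -
    have "(x (Suc i) - x i) \<bullet> (w (Suc i) - w i) + (y (Suc i) - y i) \<bullet> (- w (Suc i) - - w i) = - (norm (w (Suc i) - w i))\<^sup>2" for i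
      unfolding power2_norm_eq_inner w_def by (simp add: inner_diff inner_commute algebra_simps)
    then have "P + Q = - (\<Sum>i<N. (norm (w (Suc i) - w i))\<^sup>2)"
      by (simp add: P_def Q_def sum.distrib[symmetric] sum_negf)
    then show ?thesis by (simp add: D_def)
  qed
  have V1: "lam\<^sup>2 * (1 - 6 * l0 / (R * N)) \<le> l\<^sup>2 + \<epsilon> * (2 * real N * P + l\<^sup>2 / (R\<^sup>2 * N) * S) + C * \<epsilon>\<^sup>2"
    unfolding P_def by (rule var[of x y]) (use xA yA x in \<open>auto simp: w_def\<close>)
  have V2: "lam\<^sup>2 * (1 - 6 * l0 / (R * N)) \<le> l\<^sup>2 + \<epsilon> * (2 * real N * Q + l\<^sup>2 / (R\<^sup>2 * N) * S) + C * \<epsilon>\<^sup>2"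
    unfolding Q_def
  proof (rule var[of y x])
    show "norm (- w (Suc i) - - w i) = norm (w (Suc i) - w i)" for i
      by (metis minus_diff_minus norm_minus_cancel)
  qed (use xA yA y ends in \<open>auto simp: w_def norm_minus_commute\<close>)
  have "\<epsilon> * (2 * real N * P + l\<^sup>2 / (R\<^sup>2 * N) * S) + \<epsilon> * (2 * real N * Q + l\<^sup>2 / (R\<^sup>2 * N) * S)
      = 2 * (\<epsilon> * (real N * (P + Q) + l\<^sup>2 / (R\<^sup>2 * N) * S))" by (simp add: algebra_simps)
  then have V: "lam\<^sup>2 * (1 - 6 * l0 / (R * N)) \<le> l\<^sup>2 + \<epsilon> * (- D + l\<^sup>2 / (R\<^sup>2 * N) * S) + C * \<epsilon>\<^sup>2"
    using V1 V2 unfolding PQ by linarith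
  have S0: "S \<ge> 0" by (simp add: S_def sum_nonneg)
  have qS: "q * (S / N) \<le> D"
  proof -
    have "q * (S / N) \<le> (4 * (real N)\<^sup>2 * (sin (pi / (2 * real N)))\<^sup>2) * (S / N)"
      using q S0 by (intro mult_right_mono) auto
    also have "\<dots> = N * (4 * (sin (pi / (2 * real N)))\<^sup>2 * S)" using N by (simp add: power2_eq_square)
    also have "\<dots> \<le> D" unfolding D_def S_def
      by (intro mult_left_mono discrete_wirtinger[OF N w0]) auto
    finally show ?thesis .
  qed
  have "l\<^sup>2 / (R\<^sup>2 * N) * S = l\<^sup>2 / R\<^sup>2 * (S / N)" by simp
  also have "\<dots> \<le> l0\<^sup>2 / R\<^sup>2 * (S / N)" using S0 l l0' by (intro mult_right_mono divide_right_mono power_mono) auto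
  also have "\<dots> \<le> l0\<^sup>2 / R\<^sup>2 * (D / q)" using qS q by (intro mult_left_mono) (auto simp: pos_le_divide_eq mult.commute)
  also have "\<dots> = l0\<^sup>2 / R\<^sup>2 / q * D" by simp
  finally have "- D + l\<^sup>2 / (R\<^sup>2 * N) * S \<le> - ((1 - l0\<^sup>2 / R\<^sup>2 / q) * D)" by (simp add: algebra_simps)
  then have "\<epsilon> * (- D + l\<^sup>2 / (R\<^sup>2 * N) * S) \<le> - (\<epsilon> * ((1 - l0\<^sup>2 / R\<^sup>2 / q) * D))"
    using mult_left_mono[of "- D + l\<^sup>2 / (R\<^sup>2 * N) * S" "- ((1 - l0\<^sup>2 / R\<^sup>2 / q) * D)" \<epsilon>] \<epsilon> by simp
  then have "\<epsilon> * ((1 - l0\<^sup>2 / R\<^sup>2 / q) * D) \<le> l\<^sup>2 - lam\<^sup>2 * (1 - 6 * l0 / (R * N)) + C * \<epsilon>\<^sup>2" using V by linarith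
  then show ?thesis by (simp add: D_def w_def lam_def C_def)
qed

text \<open>As l0 < pi R, the energy of y - x enters with a positive coefficient \<theta>; it is
  bounded by the excess \<delta>, a grid error and C \<epsilon>^2, and it controls the maximum norm.
  For exact minimizers this is uniqueness, for minimizing sequences it is the Cauchy
  property.\<close>

lemma near_shortest_close:
  fixes A :: "'a::real_inner set"
  assumes R: "R > 0" and feet: "has_feet R A" and l0: "0 \<le> l0" "l0 < pi * R" and \<kappa>: "\<kappa> > 0"
  obtains \<delta> where "\<delta> > 0"
    "\<And>l x y s. \<lbrakk>unit_path A a b l x; unit_path A a b l y; l \<le> l0; l\<^sup>2 \<le> (path_dist A a b)\<^sup>2 + \<delta>; 0 \<le> s; s \<le> l\<rbrakk>
      \<Longrightarrow> norm (x s - y s) \<le> \<kappa>"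
proof -
  define r where "r = l0\<^sup>2 / R\<^sup>2"
  have "l0\<^sup>2 < (pi * R)\<^sup>2" using l0 by (intro power_strict_mono) auto
  then have r: "0 \<le> r" "r < pi\<^sup>2" using R by (simp_all add: r_def pos_divide_less_eq power_mult_distrib)
  \<comment> \<open>Any value strictly between \<open>r\<close> and pi^2 serves: it leaves
    \<open>\<theta>\<close> positive and lies below the discrete eigenvalue on fine grids.\<close>
  define q where "q = (r + pi\<^sup>2) / 2"
  have q: "q > 0" "r < q" "q < pi\<^sup>2" using r pi_gt_zero by (auto simp: q_def)
  define \<theta> where "\<theta> = 1 - r / q"
  have \<theta>: "\<theta> > 0" using q by (simp add: \<theta>_def)
  define \<sigma> where "\<sigma> = 2 * l0\<^sup>2 / R\<^sup>2"
  define C where "C = 8 * l0\<^sup>2 * \<sigma>\<^sup>2 + 24 * l0\<^sup>2 * \<sigma> + 16 * l0\<^sup>2"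
  have \<sigma>0: "0 \<le> \<sigma>" by (simp add: \<sigma>_def)
  then have C0: "0 \<le> C" by (simp add: C_def)
  \<comment> \<open>The first three entries make \<open>\<epsilon>\<close> admissible for
    \<open>first_variation\<close>, the last one gives C \<epsilon>^2 <= \<delta>. The 12 is due to
    three errors of at most \<delta> each, with the sum \<epsilon> \<theta> (\<kappa>/2)^2; the
    other half of \<open>\<kappa>\<close> pays for the points between grid points.\<close>
  define \<epsilon> where "\<epsilon> = Min {1, R / (2 * l0 + 1) / 2, 1 / (2 * (\<sigma> + 1)), \<theta> * \<kappa>\<^sup>2 / (12 * (C + 1))}"
  have \<epsilon>le: "\<epsilon> \<le> 1" "\<epsilon> \<le> R / (2 * l0 + 1) / 2" "\<epsilon> \<le> 1 / (2 * (\<sigma> + 1))" "\<epsilon> \<le> \<theta> * \<kappa>\<^sup>2 / (12 * (C + 1))"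
    by (simp_all add: \<epsilon>_def)
  have \<epsilon>0: "\<epsilon> > 0" using R l0 \<sigma>0 \<theta> \<kappa> C0 by (simp add: \<epsilon>_def)
  have \<epsilon>1: "\<epsilon> * (2 * l0) < R"
  proof -
    have "\<epsilon> * (2 * l0) \<le> \<epsilon> * (2 * l0 + 1)" using \<epsilon>0 by (intro mult_left_mono) auto
    also have "\<dots> \<le> (R / 2 / (2 * l0 + 1)) * (2 * l0 + 1)" using \<epsilon>le(2) l0 by (intro mult_right_mono) auto
    also have "\<dots> = R / 2"
    proof -
      have "v / c * c = v" if "c \<noteq> 0" for v c :: real using that by simp
      moreover have "2 * l0 + 1 \<noteq> 0" using l0 by linarith
      ultimately show ?thesis by blast
    qed
    finally show ?thesis using R by simp
  qed
  have \<epsilon>2: "\<epsilon> * \<sigma> \<le> 1 / 2"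
  proof -
    have "\<epsilon> * \<sigma> \<le> \<epsilon> * (\<sigma> + 1)" using \<epsilon>0 by (intro mult_left_mono) auto
    also have "\<dots> \<le> 1 / 2" using \<epsilon>le(3) \<sigma>0 by (simp add: pos_le_divide_eq algebra_simps)
    finally show ?thesis .
  qed
  have \<epsilon>3: "C * \<epsilon>\<^sup>2 \<le> \<epsilon> * \<theta> * \<kappa>\<^sup>2 / 12"
  proof -
    have "C * \<epsilon> \<le> (C + 1) * \<epsilon>" using \<epsilon>0 by (intro mult_right_mono) auto
    also have "\<dots> \<le> \<theta> * \<kappa>\<^sup>2 / 12" using \<epsilon>le(4) C0 by (simp add: pos_le_divide_eq mult_ac)
    finally have "C * \<epsilon> * \<epsilon> \<le> \<theta> * \<kappa>\<^sup>2 / 12 * \<epsilon>" using \<epsilon>0 by (intro mult_right_mono) auto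
    then show ?thesis by (simp add: power2_eq_square mult_ac)
  qed
  define \<delta> where "\<delta> = \<epsilon> * \<theta> * \<kappa>\<^sup>2 / 12"
  have \<delta>: "\<delta> > 0" using \<epsilon>0 \<theta> \<kappa> by (simp add: \<delta>_def)
  have close: "norm (x s - y s) \<le> \<kappa>"
    if px: "unit_path A a b l x" and py: "unit_path A a b l y" and l: "l \<le> l0" "l\<^sup>2 \<le> (path_dist A a b)\<^sup>2 + \<delta>"
      and s: "0 \<le> s" "s \<le> l" for l x y s
  proof -
    define lam where "lam = path_dist A a b"
    have "l \<ge> 0" using px by (simp add: unit_path_def)
    have e1: "\<forall>\<^sub>F N in sequentially. q < 4 * (real N)\<^sup>2 * (sin (pi / (2 * real N)))\<^sup>2"
      by (rule order_tendstoD(1)[OF tendsto_wirtinger_constant[of pi] q(3)])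
    have e2: "\<forall>\<^sub>F N in sequentially. c / real N < d" if "d > 0" for c d
      by (rule order_tendstoD(2)[OF lim_const_over_n that])
    have "\<forall>\<^sub>F N in sequentially. N > 0 \<and> q < 4 * (real N)\<^sup>2 * (sin (pi / (2 * real N)))\<^sup>2 \<and> 3 * l0 / N < R
        \<and> lam\<^sup>2 * (6 * l0) / R / N < \<delta> \<and> 2 * l0 / N < \<kappa> / 2"
      by (intro eventually_conj eventually_gt_at_top e1 e2 R \<delta> half_gt_zero \<kappa>)
    then obtain N :: nat where N: "N > 0" "q < 4 * (real N)\<^sup>2 * (sin (pi / (2 * real N)))\<^sup>2" "3 * l0 / N < R"
        "lam\<^sup>2 * (6 * l0) / R / N < \<delta>" "2 * l0 / N < \<kappa> / 2"
      by (metis (mono_tags, lifting) eventually_sequentially order_refl)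
    define X where "X i = x (real i * (l / N))" for i :: nat
    define Y where "Y i = y (real i * (l / N))" for i :: nat
    have t: "0 \<le> real i * (l / N)" "real i * (l / N) \<le> l" if "i \<le> N" for i
      using that \<open>l \<ge> 0\<close> N(1) mult_right_mono[of "real i" "real N" "l / N"] by auto
    have ends: "X 0 = a" "Y 0 = a" "X N = b" "Y N = b"
      using px py N(1) by (auto simp: X_def Y_def unit_path_def)
    define w where "w i = Y i - X i" for i
    have inc: "norm (z (real (Suc i) * (l / N)) - z (real i * (l / N))) \<le> l / N"
      if "unit_path A a b l z" "i < N" for z i
    proof -
      have "norm (z (real (Suc i) * (l / N)) - z (real i * (l / N))) \<le> real (Suc i) * (l / N) - real i * (l / N)"
        using t[of i] t[of "Suc i"] that(2) \<open>l \<ge> 0\<close> by (intro unit_path_norm_le[OF that(1)] mult_right_mono) auto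
      also have "\<dots> = l / N" by (simp add: algebra_simps add_divide_distrib)
      finally show ?thesis .
    qed
    have W: "norm (Y i - X i) \<le> 2 * l0" if "i \<le> N" for i
    proof -
      have "norm (x (real i * (l / N)) - x 0) \<le> real i * (l / N) - 0"
        by (rule unit_path_norm_le[OF px]) (use t[OF that] in auto)
      moreover have "norm (y (real i * (l / N)) - y 0) \<le> real i * (l / N) - 0"
        by (rule unit_path_norm_le[OF py]) (use t[OF that] in auto)
      ultimately have "norm (X i - a) \<le> l" "norm (Y i - a) \<le> l"
        using t[OF that] px py by (auto simp: X_def Y_def unit_path_def)
      then show ?thesis using norm_triangle_ineq4[of "Y i - a" "X i - a"] l by simp
    qed
    have A': "X i \<in> A" "Y i \<in> A" if "i \<le> N" for i
      using px py t[OF that] by (auto simp: X_def Y_def unit_path_def image_subset_iff)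
    define D where "D = N * (\<Sum>i<N. (norm (w (Suc i) - w i))\<^sup>2)"
    have main: "\<epsilon> * (\<theta> * D) \<le> l\<^sup>2 - lam\<^sup>2 * (1 - 6 * l0 / (R * N)) + C * \<epsilon>\<^sup>2"
    proof -
      have "\<epsilon> * ((1 - l0\<^sup>2 / R\<^sup>2 / q) * (N * (\<Sum>i<N. (norm ((Y (Suc i) - X (Suc i)) - (Y i - X i)))\<^sup>2)))
        \<le> l\<^sup>2 - (path_dist A (X 0) (X N))\<^sup>2 * (1 - 6 * l0 / (R * N))
        + (8 * l0\<^sup>2 * \<sigma>\<^sup>2 + 24 * l0\<^sup>2 * \<sigma> + 16 * l0\<^sup>2) * \<epsilon>\<^sup>2"
      proof (rule near_shortest_increments[where x = X and y = Y, OF R feet N(1) _ _ _ _ _ _ _ l(1)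
            \<epsilon>0 \<epsilon>le(1) \<epsilon>1 \<epsilon>2 \<sigma>_def N(3) q(1) less_imp_le[OF N(2)]])
        show "norm (X (Suc i) - X i) \<le> l / N" "norm (Y (Suc i) - Y i) \<le> l / N" if "i < N" for i
          using inc[OF px that] inc[OF py that] by (simp_all only: X_def Y_def)
        show "X 0 = Y 0" "X N = Y N" by (simp_all only: ends)
      qed (fact A' W)+
      then show ?thesis unfolding ends D_def w_def lam_def C_def \<theta>_def r_def .
    qed
    also have "\<dots> = (l\<^sup>2 - lam\<^sup>2) + lam\<^sup>2 * (6 * l0) / R / N + C * \<epsilon>\<^sup>2"
      by (simp add: algebra_simps)
    also have "\<dots> \<le> \<delta> + \<delta> + \<delta>" using l(2) N(4) \<epsilon>3 by (simp add: lam_def \<delta>_def)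
    also have "\<dots> = \<epsilon> * (\<theta> * (\<kappa> / 2)\<^sup>2)" by (simp add: \<delta>_def power_divide)
    finally have D: "D \<le> (\<kappa> / 2)\<^sup>2" using \<epsilon>0 \<theta> by simp
    \<comment> \<open>The grid index to the left of \<open>s\<close>; for \<open>l\<close> = 0 the
      division by zero yields \<open>k\<close> = 0.\<close>
    define k where "k = nat \<lfloor>s / (l / N)\<rfloor>"
    have k: "k \<le> N \<and> real k * (l / N) \<le> s \<and> s - real k * (l / N) \<le> l / N"
    proof (cases "l = 0")
      case True
      then show ?thesis using s by (simp add: k_def)
    next
      case False
      then have h: "l / N > 0" using \<open>l \<ge> 0\<close> N(1) by simp
      have fl: "real k \<le> s / (l / N)" "s / (l / N) < real k + 1" using s h by (auto simp: k_def)
      then have 1: "real k * (l / N) \<le> s" "s < (real k + 1) * (l / N)" using h by (simp_all only: pos_le_divide_eq pos_divide_less_eq)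
      have "s / (l / N) \<le> l / (l / N)" using s h by (intro divide_right_mono) auto
      also have "\<dots> = N" using False by simp
      finally have "real k \<le> real N" using fl by linarith
      then show ?thesis using 1 by (simp add: algebra_simps add_divide_distrib)
    qed
    have "norm (w k) \<le> (\<Sum>i<k. norm (w (Suc i) - w i))"
      by (rule norm_le_sum_increments) (simp add: w_def ends)
    also have "\<dots> \<le> (\<Sum>i<N. norm (w (Suc i) - w i))" using k by (intro sum_mono2) auto
    finally have "(norm (w k))\<^sup>2 \<le> (\<Sum>i<N. norm (w (Suc i) - w i))\<^sup>2" by (intro power_mono) auto
    also have "\<dots> \<le> D" unfolding D_def
      using sum_squared_le_sum_of_squares[of _ "{..<N}"] by (simp add: mult.commute)
    finally have "(norm (w k))\<^sup>2 \<le> D" .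
    then have "norm (w k) \<le> \<kappa> / 2" using power2_le_imp_le[OF order_trans[OF _ D]] \<kappa> by simp
    moreover have "norm (x s - X k) \<le> l / N" "norm (y s - Y k) \<le> l / N"
      using unit_path_norm_le[OF px, of "real k * (l / N)" s] unit_path_norm_le[OF py, of "real k * (l / N)" s] k s t[of k]
      by (auto simp: X_def Y_def)
    moreover have "l / N \<le> l0 / N" using l by (intro divide_right_mono) auto
    moreover have "norm ((x s - X k) - (y s - Y k) - w k) \<le> norm (x s - X k) + norm (y s - Y k) + norm (w k)"
      using norm_triangle_ineq4[of "(x s - X k) - (y s - Y k)" "w k"] norm_triangle_ineq4[of "x s - X k" "y s - Y k"]
      by linarith
    moreover have "(x s - X k) - (y s - Y k) - w k = x s - y s" by (simp add: w_def)
    ultimately show ?thesis using N(5) by simp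
  qed
  show thesis using that[OF \<delta>] close by blast
qed

lemma shortest_unit_path_unique:
  fixes A :: "'a::real_inner set"
  assumes R: "R > 0" and feet: "has_feet R A" and lam: "path_dist A a b < pi * R"
    and xy: "unit_path A a b (path_dist A a b) x" "unit_path A a b (path_dist A a b) y"
    and s: "0 \<le> s" "s \<le> path_dist A a b"
  shows "x s = y s"
proof -
  have l0: "0 \<le> path_dist A a b" using xy by (simp add: unit_path_def)
  have "norm (x s - y s) \<le> 0 + e" if "e > 0" for e
    proof -
    from near_shortest_close[OF R feet l0 lam that, of a b] obtain \<delta> where "\<delta> > 0"
      "\<And>l x y s. \<lbrakk>unit_path A a b l x; unit_path A a b l y; l \<le> path_dist A a b;
        l\<^sup>2 \<le> (path_dist A a b)\<^sup>2 + \<delta>; 0 \<le> s; s \<le> l\<rbrakk> \<Longrightarrow> norm (x s - y s) \<le> e" by blast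
    then show ?thesis using xy s by fastforce
  qed
  then have "norm (x s - y s) \<le> 0" by (rule field_le_epsilon)
  then show ?thesis by simp
qed

text \<open>Completeness takes the place of compactness: once the paths of a minimizing sequence
  wait at b, \<open>near_shortest_close\<close> makes them Cauchy at every parameter, and closedness
  of A keeps the limit in A.\<close>

lemma shortest_unit_path_exists:
  fixes A :: "'a::{real_inner,banach} set"
  assumes R: "R > 0" and feet: "has_feet R A" and cl: "closed A" and lam: "path_dist A a b < pi * R"
    and ex: "unit_path A a b L0 x0"
  shows "\<exists>x. unit_path A a b (path_dist A a b) x"
proof -
  define lam where "lam = path_dist A a b"
  have lam0: "0 \<le> lam" using order_trans[OF norm_ge_zero path_dist_ge_norm[OF ex]] by (simp add: lam_def)
  \<comment> \<open>A bound strictly below pi R for the whole minimizing sequence, so that one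
    \<delta> serves all its members.\<close>
  define l0 where "l0 = (lam + pi * R) / 2"
  have l0: "0 \<le> l0" "lam < l0" "l0 < pi * R" using lam lam0 R by (auto simp: l0_def lam_def mult.commute)
  have "\<exists>M y. unit_path A a b M y \<and> M < lam + (l0 - lam) / real (Suc n)" for n
    using path_dist_near[OF ex, of "(l0 - lam) / real (Suc n)"] l0 unfolding lam_def[symmetric]
    by (metis diff_gt_0_iff_gt divide_pos_pos of_nat_0_less_iff zero_less_Suc)
  then obtain M y where y: "\<And>n. unit_path A a b (M n) (y n)" and M: "\<And>n. M n < lam + (l0 - lam) / real (Suc n)"
    by metis
  have Mlam: "lam \<le> M n" for n using path_dist_le[OF y] by (simp add: lam_def)
  have Ml0: "M n \<le> l0" for n
  proof -
    have "(l0 - lam) / real (Suc n) \<le> (l0 - lam) / 1" using l0 by (intro divide_left_mono) auto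
    then show ?thesis using M[of n] by simp
  qed
  have Mlim: "M \<longlonglongrightarrow> lam"
  proof (rule real_tendsto_sandwich[where f = "\<lambda>_. lam" and h = "\<lambda>n. lam + (l0 - lam) / real (Suc n)"])
    show "(\<lambda>n. lam + (l0 - lam) / real (Suc n)) \<longlonglongrightarrow> lam"
      using tendsto_add[OF tendsto_const[of lam] LIMSEQ_Suc[OF lim_const_over_n[of "l0 - lam"]]] by simp
  qed (use M Mlam in \<open>auto intro!: always_eventually less_imp_le\<close>)
  define z where "z n s = y n (min s (M n))" for n s
  have z: "unit_path A a b l (z n)" if "M n \<le> l" for n l
    using unit_path_extend[OF y that] by (simp add: z_def[abs_def])
  have "Cauchy (\<lambda>n. z n s)" if s: "0 \<le> s" for s
  proof (rule metric_CauchyI)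
    fix e :: real assume "e > 0"
    then have "e / 2 > 0" by simp
    from near_shortest_close[OF R feet l0(1,3) this, of a b] obtain \<delta> where \<delta>: "\<delta> > 0"
      "\<And>l x y s. \<lbrakk>unit_path A a b l x; unit_path A a b l y; l \<le> l0; l\<^sup>2 \<le> lam\<^sup>2 + \<delta>; 0 \<le> s; s \<le> l\<rbrakk>
        \<Longrightarrow> norm (x s - y s) \<le> e / 2" unfolding lam_def by blast
    have "(\<lambda>n. (M n)\<^sup>2) \<longlonglongrightarrow> lam\<^sup>2" by (intro tendsto_intros Mlim)
    then have "\<forall>\<^sub>F n in sequentially. (M n)\<^sup>2 < lam\<^sup>2 + \<delta>" using \<delta>(1) by (intro order_tendstoD) auto
    then obtain K where K: "\<And>n. n \<ge> K \<Longrightarrow> (M n)\<^sup>2 < lam\<^sup>2 + \<delta>" unfolding eventually_sequentially by blast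
    have "dist (z m s) (z n s) < e" if mn: "m \<ge> K" "n \<ge> K" for m n
    proof -
      define l where "l = max (M m) (M n)"
      have l: "M m \<le> l" "M n \<le> l" "l \<le> l0" using Ml0 by (auto simp: l_def)
      have l2: "l\<^sup>2 \<le> lam\<^sup>2 + \<delta>" using K[OF mn(1)] K[OF mn(2)] by (auto simp: l_def max_def)
      have "norm (z m s - z n s) \<le> e / 2"
      proof (cases "s \<le> l")
        case True
        then show ?thesis using \<delta>(2)[OF z[OF l(1)] z[OF l(2)] l(3) l2 s] by blast
      next
        case False
        then have "z m s = b" "z n s = b" using l y by (auto simp: z_def unit_path_def min_def)
        then show ?thesis using \<open>e > 0\<close> by simp
      qed
      then show ?thesis using \<open>e > 0\<close> by (simp add: dist_norm)
    qed
    then show "\<exists>K. \<forall>m\<ge>K. \<forall>n\<ge>K. dist (z m s) (z n s) < e" by blast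
  qed
  then have conv: "convergent (\<lambda>n. z n s)" if "0 \<le> s" for s using that Cauchy_convergent by blast
  define x where "x s = lim (\<lambda>n. z n s)" for s
  have x: "(\<lambda>n. z n s) \<longlonglongrightarrow> x s" if "0 \<le> s" for s
    using conv[OF that] by (simp add: x_def convergent_LIMSEQ_iff)
  have lip: "norm (x t - x s) \<le> t - s" if st: "0 \<le> s" "s \<le> t" "t \<le> l0" for s t
  proof -
    have "(\<lambda>n. norm (z n t - z n s)) \<longlonglongrightarrow> norm (x t - x s)" using st by (intro tendsto_intros x) auto
    moreover have "norm (z n t - z n s) \<le> t - s" for n
      using unit_path_norm_le[OF z[OF Ml0]] st by blast
    ultimately show ?thesis by (intro LIMSEQ_le_const2) auto
  qed
  have "unit_path A a b lam x"
    unfolding unit_path_def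
  proof (intro conjI allI impI)
    have "z n 0 = a" for n using z[OF Ml0] by (auto simp: unit_path_def)
    then show "x 0 = a" using x[of 0] by (simp add: LIMSEQ_const_iff)
    have xb: "x s = b" if "lam < s" for s
    proof -
      have "\<forall>\<^sub>F n in sequentially. M n < s" using Mlim that by (rule order_tendstoD)
      then have "\<forall>\<^sub>F n in sequentially. z n s = b"
        by eventually_elim (use y in \<open>auto simp: z_def unit_path_def min_def\<close>)
      then have "(\<lambda>n. z n s) \<longlonglongrightarrow> b" by (rule tendsto_eventually)
      then show ?thesis using x[of s] that lam0 LIMSEQ_unique by fastforce
    qed
    \<comment> \<open>The approximating paths may reach \<open>b\<close> only after
      \<open>lam\<close>, so the value at \<open>lam\<close> is obtained from the right by the
      Lipschitz bound.\<close>
    have "norm (x lam - b) \<le> 0 + e" if "e > 0" for e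
    proof -
      define s where "s = min l0 (lam + e)"
      have "lam < s" "s \<le> l0" "s \<le> lam + e" using l0 that by (auto simp: s_def)
      then show ?thesis using lip[of lam s] xb[of s] lam0 by (simp add: norm_minus_commute)
    qed
    then have "norm (x lam - b) \<le> 0" by (rule field_le_epsilon)
    then show "x lam = b" by simp
    show "x ` {0..lam} \<subseteq> A"
    proof safe
      fix s assume s: "s \<in> {0..lam}"
      have "z n s \<in> A" for n using z[OF Ml0, of n] s l0 by (auto simp: unit_path_def image_subset_iff)
      then show "x s \<in> A" using closed_sequentially[OF cl _ x] s by auto
    qed
    show "norm (x t - x s) \<le> t - s" if "0 \<le> s" "s \<le> t" "t \<le> lam" for s t
      using lip that l0 by auto
  qed (rule lam0)
  then show ?thesis unfolding lam_def by blast
qed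

section \<open>The angle between chord and tangent\<close>

text \<open>The sequence $t$ is $s$ shifted by one index, so that $t_0$ stands for $s_{-1}$.\<close>

lemma sum_mult_differences:
  fixes s \<psi> :: "nat \<Rightarrow> real" and t :: "nat \<Rightarrow> real"
  assumes t: "\<And>i. t (Suc i) = s i" and rec: "\<And>i. i < m \<Longrightarrow> s (Suc i) + t i = (2 - \<kappa>) * s i"
  shows "(\<Sum>i<m. (s (Suc i) - s i) * (\<psi> (Suc i) - \<psi> i))
    = \<psi> m * (s m - t m) - \<psi> 0 * (s 0 - t 0) + \<kappa> * (\<Sum>i<m. s i * \<psi> i)"
  using rec
proof (induction m)
  case (Suc m)
  have r: "s (Suc m) + t m = (2 - \<kappa>) * s m" using Suc.prems by simp
  have "(s (Suc m) - s m) * (\<psi> (Suc m) - \<psi> m)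
      = \<psi> (Suc m) * (s (Suc m) - s m) - \<psi> m * (s m - t m) + (2 * s m - (s (Suc m) + t m)) * \<psi> m"
    by (simp add: algebra_simps)
  also have "(2 * s m - (s (Suc m) + t m)) * \<psi> m = \<kappa> * (s m * \<psi> m)"
    unfolding r by (simp add: algebra_simps)
  finally have e: "(s (Suc m) - s m) * (\<psi> (Suc m) - \<psi> m)
      = \<psi> (Suc m) * (s (Suc m) - s m) - \<psi> m * (s m - t m) + \<kappa> * (s m * \<psi> m)" .
  have IH: "(\<Sum>i<m. (s (Suc i) - s i) * (\<psi> (Suc i) - \<psi> i))
    = \<psi> m * (s m - t m) - \<psi> 0 * (s 0 - t 0) + \<kappa> * (\<Sum>i<m. s i * \<psi> i)"
    using Suc by simp
  show ?case unfolding sum.lessThan_Suc IH e t by (simp add: algebra_simps)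
qed simp

text \<open>An unnormalised Green's function of $u'' + \mu^2 u$ on $[0,1]$ with zero boundary values and
  pole at $j/n$, sampled at the points $i/n$.\<close>

definition green :: "real \<Rightarrow> nat \<Rightarrow> nat \<Rightarrow> nat \<Rightarrow> real"
  where "green \<mu> n j i = (if i \<le> j then sin (\<mu> - \<mu> * j / n) * sin (\<mu> * i / n)
    else sin (\<mu> * j / n) * sin (\<mu> - \<mu> * i / n))"

lemma sin_three_term:
  "sin (c + (1 + real i) * d) + sin (c + (real i - 1) * d) = (2 - 4 * (sin (d / 2))\<^sup>2) * sin (c + real i * d)"
proof -
  define x where "x = c + real i * d"
  have "c + (1 + real i) * d = x + d" "c + (real i - 1) * d = x - d"
    by (simp_all add: x_def algebra_simps)
  moreover have "sin (x + d) + sin (x - d) = 2 * cos d * sin x"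
    by (simp add: sin_add sin_diff)
  moreover have "cos d = 1 - 2 * (sin (d / 2))\<^sup>2" using cos_double_sin[of "d / 2"] by simp
  ultimately show ?thesis unfolding x_def[symmetric] by simp
qed

text \<open>Summation by parts on both sides of the pole. Each branch solves the three-term
  recurrence with the coefficient 4 sin^2(\<mu>/(2n)), so that besides the last sum only boundary
  terms remain; the jump of the slope at the pole produces the term with \<psi> j.\<close>

lemma green_sum:
  fixes \<psi> :: "nat \<Rightarrow> real" and \<mu> :: real
  assumes j: "0 < j" "j < n"
  defines "\<theta> \<equiv> \<mu> * j / n"
  shows "(\<Sum>i<n. (green \<mu> n j (Suc i) - green \<mu> n j i) * (\<psi> (Suc i) - \<psi> i))
    = sin (\<mu> / n) * (\<psi> j * sin \<mu> - \<psi> 0 * sin (\<mu> - \<theta>) - \<psi> n * sin \<theta>)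
      + 4 * (sin (\<mu> / n / 2))\<^sup>2 * (\<Sum>i<n. green \<mu> n j i * \<psi> i)"
proof -
  define d where "d = \<mu> / n"
  define \<kappa> where "\<kappa> = 4 * (sin (d / 2))\<^sup>2"
  define a where "a = sin (\<mu> - \<theta>)"
  define b where "b = sin \<theta>"
  define s where "s i = a * sin (0 + real i * d)" for i
  \<comment> \<open>The predecessor is defined through a real index, so that it makes sense at
    \<open>i\<close> = 0 too.\<close>
  define s' where "s' i = a * sin (0 + (real i - 1) * d)" for i
  define c where "c i = - b * sin ((\<theta> - \<mu>) + real i * d)" for i
  define c' where "c' i = - b * sin ((\<theta> - \<mu>) + (real i - 1) * d)" for i
  have \<theta>: "\<theta> = real j * d" by (simp add: \<theta>_def d_def)
  have \<mu>: "\<mu> = real n * d" using j by (simp add: d_def)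
  have g1: "green \<mu> n j i = s i" if "i \<le> j" for i
    using that by (simp add: green_def s_def a_def \<theta>_def d_def mult.commute)
  have g2: "green \<mu> n j (j + i) = c i" for i
  proof -
    have "\<mu> - \<mu> * real (j + i) / n = - ((\<theta> - \<mu>) + real i * d)"
      by (simp add: \<theta>_def d_def distrib_left add_divide_distrib)
    then have e: "sin (\<mu> - \<mu> * real (j + i) / n) = - sin ((\<theta> - \<mu>) + real i * d)" by (metis sin_minus)
    show ?thesis
    proof (cases "i = 0")
      case True
      have "sin (\<theta> - \<mu>) = - sin (\<mu> - \<theta>)" by (metis minus_diff_eq sin_minus)
      then show ?thesis using True by (simp add: green_def c_def b_def \<theta>_def)
    next
      case False
      then show ?thesis using e by (simp add: green_def c_def b_def \<theta>_def)
    qed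
  qed
  have r1: "(\<Sum>i<j. (s (Suc i) - s i) * (\<psi> (Suc i) - \<psi> i))
    = \<psi> j * (s j - s' j) - \<psi> 0 * (s 0 - s' 0) + \<kappa> * (\<Sum>i<j. s i * \<psi> i)"
  proof (rule sum_mult_differences)
    show "s (Suc i) + s' i = (2 - \<kappa>) * s i" for i
    proof -
      have "s (Suc i) + s' i = a * (sin (0 + (1 + real i) * d) + sin (0 + (real i - 1) * d))"
        unfolding s_def s'_def distrib_left by simp
      then show ?thesis unfolding sin_three_term by (simp add: s_def \<kappa>_def)
    qed
  qed (simp add: s_def s'_def)
  have r2: "(\<Sum>i<n - j. (c (Suc i) - c i) * (\<psi> (j + Suc i) - \<psi> (j + i)))
    = \<psi> (j + (n - j)) * (c (n - j) - c' (n - j)) - \<psi> (j + 0) * (c 0 - c' 0) + \<kappa> * (\<Sum>i<n - j. c i * \<psi> (j + i))"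
  proof (rule sum_mult_differences)
    show "c (Suc i) + c' i = (2 - \<kappa>) * c i" for i
    proof -
      have "c (Suc i) + c' i = - b * (sin ((\<theta> - \<mu>) + (1 + real i) * d) + sin ((\<theta> - \<mu>) + (real i - 1) * d))"
        unfolding c_def c'_def distrib_left by simp
      then show ?thesis unfolding sin_three_term by (simp add: c_def \<kappa>_def)
    qed
  qed (simp add: c_def c'_def)
  have split: "(\<Sum>i<n. f i) = (\<Sum>i<j. f i) + (\<Sum>i<n - j. f (j + i))" for f :: "nat \<Rightarrow> real"
    using sum.atLeastLessThan_concat[of 0 j n f] j sum.shift_bounds_nat_ivl[of f 0 j "n - j"]
    by (simp add: lessThan_atLeast0 add.commute)
  have L: "(\<Sum>i<n. (green \<mu> n j (Suc i) - green \<mu> n j i) * (\<psi> (Suc i) - \<psi> i))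
    = (\<Sum>i<j. (s (Suc i) - s i) * (\<psi> (Suc i) - \<psi> i)) + (\<Sum>i<n - j. (c (Suc i) - c i) * (\<psi> (j + Suc i) - \<psi> (j + i)))"
    unfolding split
  proof (intro arg_cong2[where f = "(+)"] sum.cong refl)
    show "(green \<mu> n j (Suc i) - green \<mu> n j i) * (\<psi> (Suc i) - \<psi> i) = (s (Suc i) - s i) * (\<psi> (Suc i) - \<psi> i)"
      if "i \<in> {..<j}" for i using that g1[of i] g1[of "Suc i"] by auto
    show "(green \<mu> n j (Suc (j + i)) - green \<mu> n j (j + i)) * (\<psi> (Suc (j + i)) - \<psi> (j + i))
      = (c (Suc i) - c i) * (\<psi> (j + Suc i) - \<psi> (j + i))" for i
      using g2[of i] g2[of "Suc i"] by simp
  qed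
  have S: "(\<Sum>i<n. green \<mu> n j i * \<psi> i) = (\<Sum>i<j. s i * \<psi> i) + (\<Sum>i<n - j. c i * \<psi> (j + i))"
    unfolding split by (intro arg_cong2[where f = "(+)"] sum.cong refl) (use g1 g2 in auto)
  have b0: "s 0 - s' 0 = a * sin d" by (simp add: s_def s'_def)
  have bn: "c (n - j) - c' (n - j) = - b * sin d"
  proof -
    have "(\<theta> - \<mu>) + real (n - j) * d = 0" "(\<theta> - \<mu>) + (real (n - j) - 1) * d = - d"
      using j by (simp_all add: \<theta> \<mu> of_nat_diff algebra_simps)
    then show ?thesis by (simp add: c_def c'_def)
  qed
  \<comment> \<open>The jump of the slope at the pole; by the addition theorem it does not depend on
    the position of the pole.\<close>
  have bj: "(s j - s' j) - (c 0 - c' 0) = sin d * sin \<mu>"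
  proof -
    have e1: "0 + (real j - 1) * d = \<theta> - d" "0 + real j * d = \<theta>" by (simp_all add: \<theta> algebra_simps)
    have e2: "(\<theta> - \<mu>) + (real 0 - 1) * d = - ((\<mu> - \<theta>) + d)" "(\<theta> - \<mu>) + real 0 * d = - (\<mu> - \<theta>)"
      by (simp_all add: algebra_simps)
    have "\<mu> = (\<mu> - \<theta>) + \<theta>" by simp
    then have "sin \<mu> = sin (\<mu> - \<theta>) * cos \<theta> + cos (\<mu> - \<theta>) * sin \<theta>" by (metis sin_add)
    then show ?thesis
      unfolding s_def s'_def c_def c'_def e1 e2 sin_minus a_def b_def sin_diff[of \<theta> d] sin_add[of "\<mu> - \<theta>" d]
      by (simp add: algebra_simps)
  qed
  have nj: "j + (n - j) = n" using j by simp
  have "\<psi> j * (s j - s' j) - \<psi> j * (c 0 - c' 0) = \<psi> j * (sin d * sin \<mu>)"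
    unfolding bj[symmetric] by (simp add: algebra_simps)
  then show ?thesis unfolding L r1 r2 S nj b0 bn by (simp add: \<kappa>_def a_def b_def d_def algebra_simps)
qed

lemma green_bounds:
  assumes \<mu>: "0 \<le> \<mu>" "\<mu> \<le> pi" and j: "j \<le> n" and n: "n > 0" and i: "i \<le> n"
  shows "0 \<le> green \<mu> n j i" "green \<mu> n j i \<le> 1"
proof -
  have *: "0 \<le> sin (\<mu> * real k / n)" "0 \<le> sin (\<mu> - \<mu> * real k / n)" if "k \<le> n" for k
  proof -
    have "\<mu> * real k / n \<le> \<mu> * real n / n" using that \<mu> by (intro divide_right_mono mult_left_mono) auto
    then have "\<mu> * real k / n \<le> \<mu>" using n by simp
    moreover have "0 \<le> \<mu> * real k / n" using \<mu> by simp
    ultimately show "0 \<le> sin (\<mu> * real k / n)" "0 \<le> sin (\<mu> - \<mu> * real k / n)"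
      using \<mu> by (intro sin_ge_zero; linarith)+
  qed
  show "0 \<le> green \<mu> n j i" using *[OF i] *[OF j] by (auto simp: green_def)
  show "green \<mu> n j i \<le> 1" using *[OF i] *[OF j] by (auto simp: green_def intro!: mult_le_one)
qed

lemma abs_sin_diff_le: "\<bar>sin u - sin v\<bar> \<le> \<bar>u - v\<bar>" for u v :: real
proof -
  have "sin u - sin v = 2 * sin ((u - v) / 2) * cos ((u + v) / 2)" by (rule sin_diff_sin)
  then have "\<bar>sin u - sin v\<bar> = 2 * \<bar>sin ((u - v) / 2)\<bar> * \<bar>cos ((u + v) / 2)\<bar>" by (simp add: abs_mult)
  also have "\<dots> \<le> 2 * \<bar>(u - v) / 2\<bar> * 1"
    by (intro mult_mono abs_sin_x_le_abs_x) auto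
  finally show ?thesis by simp
qed

lemma green_step:
  assumes \<mu>: "0 \<le> \<mu>" and n: "n > 0"
  shows "\<bar>green \<mu> n j (Suc i) - green \<mu> n j i\<bar> \<le> \<mu> / n"
proof -
  have *: "\<bar>c * sin u - c * sin v\<bar> \<le> \<mu> / n" if "\<bar>c\<bar> \<le> 1" "\<bar>u - v\<bar> \<le> \<mu> / n" for c u v
  proof -
    have "\<bar>c * sin u - c * sin v\<bar> = \<bar>c\<bar> * \<bar>sin u - sin v\<bar>" by (simp add: abs_mult flip: right_diff_distrib)
    also have "\<dots> \<le> 1 * (\<mu> / n)" using that abs_sin_diff_le[of u v] by (intro mult_mono) auto
    finally show ?thesis by simp
  qed
  have d: "\<bar>\<mu> * real (Suc i) / n - \<mu> * real i / n\<bar> \<le> \<mu> / n"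
    using \<mu> by (simp add: algebra_simps add_divide_distrib)
  consider "Suc i \<le> j" | "i = j" | "j < i" by linarith
  then show ?thesis
  proof cases
    case 1
    then show ?thesis using *[OF _ d, of "sin (\<mu> - \<mu> * j / n)"] by (simp add: green_def)
  next
    case 2
    then show ?thesis using *[of "sin (\<mu> * j / n)" "\<mu> - \<mu> * real (Suc i) / n" "\<mu> - \<mu> * real i / n"] d
      by (simp add: green_def mult.commute abs_minus_commute)
  next
    case 3
    then show ?thesis using *[of "sin (\<mu> * j / n)" "\<mu> - \<mu> * real (Suc i) / n" "\<mu> - \<mu> * real i / n"] d
      by (simp add: green_def abs_minus_commute)
  qed
qed

section \<open>Sine concavity along a shortest path\<close>

lemma path_dist_subpath:
  assumes x: "unit_path A a b (path_dist A a b) x" and st: "0 \<le> s" "s \<le> t" "t \<le> path_dist A a b"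
  shows "path_dist A (x s) (x t) = t - s"
proof (rule antisym)
  note p = unit_path_subpath[OF x]
  have s1: "unit_path A (x 0) (x s) (s - 0) (\<lambda>r. x (0 + r))" by (rule p) (use st in auto)
  have s2: "unit_path A (x s) (x t) (t - s) (\<lambda>r. x (s + r))" by (rule p) (use st in auto)
  have s3: "unit_path A (x t) (x (path_dist A a b)) (path_dist A a b - t) (\<lambda>r. x (t + r))" by (rule p) (use st in auto)
  show "path_dist A (x s) (x t) \<le> t - s" using path_dist_le[OF s2] .
  have ends: "x 0 = a" "x (path_dist A a b) = b" using x by (simp_all add: unit_path_def)
  have "path_dist A a b \<le> path_dist A (x 0) (x s) + path_dist A (x s) b"
    using path_dist_triangle[OF s1 unit_path_join[OF s2 s3]] ends by simp
  also have "path_dist A (x s) b \<le> path_dist A (x s) (x t) + path_dist A (x t) b"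
    using path_dist_triangle[OF s2 s3] ends by simp
  finally show "t - s \<le> path_dist A (x s) (x t)"
    using path_dist_le[OF s1] path_dist_le[OF s3] ends by simp
qed

text \<open>The projected chord is a competitor for the piece between s and t, so its length is at
  least t - s, and this bounds the chord from below. The estimate stands in for unit speed, of which
  \<open>unit_path\<close> contains only the upper half.\<close>

lemma shortest_path_chord_ge:
  fixes A :: "'a::real_inner set"
  assumes R: "R > 0" and feet: "has_feet R A"
    and x: "unit_path A a b (path_dist A a b) x" and st: "0 \<le> s" "s \<le> t" "t \<le> path_dist A a b" "t - s < 2 * R"
  shows "(t - s)\<^sup>2 * (1 - (t - s) / R) \<le> (norm (x t - x s))\<^sup>2"
proof -
  define h where "h = t - s"
  define e where "e = norm (x s - x t)"
  have eh: "e \<le> h" using unit_path_norm_le[OF x st(1-3)] by (simp add: e_def h_def norm_minus_commute)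
  have h: "0 \<le> h" "h < 2 * R" using st by (simp_all add: h_def)
  have e0: "0 \<le> e" by (simp add: e_def)
  have xA: "x s \<in> A" "x t \<in> A" using x st by (auto simp: unit_path_def image_subset_iff)
  have e2: "e < 2 * R" using eh h by simp
  have "h \<le> e / (1 - e / (2 * R))"
    using path_dist_le_chord[OF R feet xA] e2 path_dist_subpath[OF x st(1-3)] by (simp add: h_def e_def)
  then have "h * (1 - e / (2 * R)) \<le> e" using R e2 by (simp add: pos_le_divide_eq)
  moreover have "h * (1 - h / (2 * R)) \<le> h * (1 - e / (2 * R))"
    using h eh R by (intro mult_left_mono diff_left_mono divide_right_mono) auto
  ultimately have "h * (1 - h / (2 * R)) \<le> e" by linarith
  then have "(h * (1 - h / (2 * R)))\<^sup>2 \<le> e\<^sup>2" using h R by (intro power_mono) auto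
  moreover have "h\<^sup>2 * (1 - h / R) \<le> h\<^sup>2 * (1 - h / (2 * R))\<^sup>2"
    by (intro mult_left_mono) (auto simp: power2_eq_square algebra_simps)
  ultimately have "h\<^sup>2 * (1 - h / R) \<le> e\<^sup>2" by (simp only: power_mult_distrib)
  then show ?thesis by (simp add: h_def e_def norm_minus_commute)
qed

text \<open>\<open>first_variation\<close> towards the constant path y, weighted with Green's
  function. Up to errors that vanish on fine grids or are quadratic in \<epsilon>, what remains is
  Z, the defect in the comparison of \<psi> with the sine. W bounds |y - x|, and K bounds the
  displacement by the product rule: slope \<mu> of the weight times W, plus slope l of the
  path.\<close>

lemma green_variation:
  fixes A :: "'a::real_inner set"
  assumes R: "R > 0" and feet: "has_feet R A"
    and x: "unit_path A p q l x" and l: "l = path_dist A p q" "0 < l" "l < pi * R" and yA: "y \<in> A"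
    and j: "0 < j" "j < n"
    and W: "W = norm (y - p) + l" and K: "K = l + l / R * W" and \<sigma>: "\<sigma> = W\<^sup>2 / (2 * R\<^sup>2)"
    and \<epsilon>: "0 \<le> \<epsilon>" "\<epsilon> \<le> 1" "\<epsilon> * W < R" "\<epsilon> * \<sigma> \<le> 1 / 2" and big: "(l + K) / real n < R"
    and \<mu>: "\<mu> = l / R" and \<psi>: "\<And>t. \<psi> t = R\<^sup>2 - (norm (y - x t))\<^sup>2 / 2"
    and Z: "Z = \<psi> (l * real j / real n) * sin \<mu> - \<psi> 0 * sin (\<mu> - \<mu> * real j / real n) - \<psi> l * sin (\<mu> * real j / real n)"
  shows "0 \<le> 2 * l\<^sup>2 * (l + K) / R / real n + (8 * l\<^sup>2 * \<sigma>\<^sup>2 + 12 * l * K * \<sigma> + 4 * K\<^sup>2) * \<epsilon>\<^sup>2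
    + 2 * \<epsilon> * (real n * sin (\<mu> / real n) * Z
        + \<bar>4 * (real n)\<^sup>2 * (sin (\<mu> / (2 * real n)))\<^sup>2 - \<mu>\<^sup>2\<bar> * (R\<^sup>2 + W\<^sup>2 / 2) + l ^ 3 / R / real n)"
proof -
  have n: "n > 0" using j by simp
  define h where "h = l / real n"
  have h: "h > 0" using l n by (simp add: h_def)
  define X where "X i = x (real i * h)" for i :: nat
  define \<eta> where "\<eta> = green \<mu> n j"
  define u where "u i = \<eta> i *\<^sub>R (y - X i)" for i
  define \<Psi> where "\<Psi> i = \<psi> (real i * h)" for i :: nat
  define G where "G = (\<Sum>i<n. \<eta> i * \<Psi> i)"
  define H where "H = (\<Sum>i<n. \<eta> i)"
  have \<Psi>: "\<Psi> i = R\<^sup>2 - (norm (y - X i))\<^sup>2 / 2" for i by (simp add: \<Psi>_def \<psi> X_def)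
  have \<mu>b: "0 \<le> \<mu>" "\<mu> \<le> pi" using l R by (auto simp: \<mu> pos_divide_le_eq)
  have ih: "0 \<le> real i * h" "real i * h \<le> l" if "i \<le> n" for i
  proof -
    have "real i * h \<le> real n * h" using that h by (intro mult_right_mono) auto
    then show "real i * h \<le> l" using n by (simp add: h_def)
  qed (use h in auto)
  have \<eta>01: "0 \<le> \<eta> i" "\<eta> i \<le> 1" if "i \<le> n" for i
    unfolding \<eta>_def using green_bounds[OF \<mu>b _ n that, of j] j by auto
  have \<eta>0: "\<eta> 0 = 0" "\<eta> n = 0" using j by (auto simp: \<eta>_def green_def)
  have XA: "X i \<in> A" if "i \<le> n" for i using x ih[OF that] by (auto simp: X_def unit_path_def image_subset_iff)
  have Xe: "X 0 = p" "X n = q" using x n by (auto simp: X_def h_def unit_path_def)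
  have yX: "norm (y - X i) \<le> W" if "i \<le> n" for i
  proof -
    have "norm (x (real i * h) - x 0) \<le> real i * h - 0"
      by (rule unit_path_norm_le[OF x]) (use ih[OF that] in auto)
    then have "norm (X i - p) \<le> l" using ih[OF that] Xe by (auto simp: X_def)
    then show ?thesis using norm_triangle_ineq4[of "y - p" "X i - p"] by (simp add: W)
  qed
  have hh: "real (Suc i) * h - real i * h = h" for i by (simp add: algebra_simps)
  have dX: "norm (X (Suc i) - X i) \<le> l / real n" if "i < n" for i
    unfolding X_def h_def[symmetric]
    using unit_path_norm_le[OF x, of "real i * h" "real (Suc i) * h"] ih[of i] ih[of "Suc i"] that h hh by auto
  have W0: "W \<ge> 0" using l by (simp add: W)
  have l0: "0 \<le> l" using l by simp
  have hR: "h < 2 * R"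
  proof -
    have "K \<ge> 0" unfolding K using l0 W0 R by (intro add_nonneg_nonneg mult_nonneg_nonneg divide_nonneg_pos) auto
    then have "h \<le> (l + K) / real n" unfolding h_def by (intro divide_right_mono) auto
    then show ?thesis using big R by linarith
  qed
  have dX2: "h\<^sup>2 * (1 - h / R) \<le> (norm (X (Suc i) - X i))\<^sup>2" if "i < n" for i
    using shortest_path_chord_ge[OF R feet x[unfolded l(1)], of "real i * h" "real (Suc i) * h"]
      ih[of i] ih[of "Suc i"] that h hR unfolding hh X_def l(1)[symmetric] by (auto simp: mult_right_mono)
  have d\<eta>: "\<bar>\<eta> (Suc i) - \<eta> i\<bar> \<le> \<mu> / n" for i unfolding \<eta>_def by (rule green_step[OF \<mu>b(1) n])
  have du: "norm (u (Suc i) - u i) \<le> K / real n" if i: "i < n" for i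
  proof -
    have "u (Suc i) - u i = (\<eta> (Suc i) - \<eta> i) *\<^sub>R (y - X (Suc i)) - \<eta> i *\<^sub>R (X (Suc i) - X i)"
      by (simp add: u_def algebra_simps)
    then have "norm (u (Suc i) - u i) \<le> \<bar>\<eta> (Suc i) - \<eta> i\<bar> * norm (y - X (Suc i)) + \<bar>\<eta> i\<bar> * norm (X (Suc i) - X i)"
      using norm_triangle_ineq4[of "(\<eta> (Suc i) - \<eta> i) *\<^sub>R (y - X (Suc i))" "\<eta> i *\<^sub>R (X (Suc i) - X i)"] by simp
    also have "\<dots> \<le> \<mu> / n * W + 1 * (l / n)"
      using d\<eta>[of i] yX[of "Suc i"] \<eta>01[of i] dX[OF i] i \<mu>b by (intro add_mono mult_mono) auto
    finally show ?thesis by (simp add: K \<mu> add_divide_distrib)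
  qed
  define I where "I = (\<Sum>i<n. (X (Suc i) - X i) \<bullet> (u (Suc i) - u i))"
  define D where "D = (\<Sum>i<n. (\<eta> (Suc i) - \<eta> i) * (\<Psi> (Suc i) - \<Psi> i))"
  define C where "C = 8 * l\<^sup>2 * \<sigma>\<^sup>2 + 12 * l * K * \<sigma> + 4 * K\<^sup>2"
  define Q where "Q = (\<Sum>i<n. \<eta> i * (norm (y - X i))\<^sup>2 + \<eta> (Suc i) * (norm (y - X (Suc i)))\<^sup>2)"
  have FV: "l\<^sup>2 * (1 - 2 * (l + K) / (R * real n)) \<le> l\<^sup>2 + \<epsilon> * (2 * real n * I + l\<^sup>2 / (2 * R\<^sup>2 * real n) * Q) + C * \<epsilon>\<^sup>2"
  proof -
    have "(path_dist A (X 0) (X n))\<^sup>2 * (1 - 2 * (l + K) / (R * real n)) \<le>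
      l\<^sup>2 + \<epsilon> * (2 * real n * I + l\<^sup>2 / (2 * R\<^sup>2 * real n) * Q) + C * \<epsilon>\<^sup>2"
      unfolding I_def Q_def C_def
      by (rule first_variation[where W = W, OF R feet n _ _ _ _ _ _ _ _ _ _ \<epsilon> \<sigma> big])
         (simp_all add: XA yA \<eta>01 yX u_def[symmetric] dX du, simp_all add: u_def \<eta>0)
    then show ?thesis by (simp only: Xe l(1)[symmetric])
  qed
  have shift: "(\<Sum>i<n. f (Suc i)) = (\<Sum>i<n. f i)" if "f 0 = f n" for f :: "nat \<Rightarrow> real"
    using sum.lessThan_Suc_shift[of f n] that by simp
  \<comment> \<open>The constant \<open>R\<^sup>2\<close> in \<open>\<psi>\<close> produces the
    multiple of \<open>H\<close> that cancels the one coming from unit speed in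
    \<open>I\<close>.\<close>
  have Q: "Q = 4 * R\<^sup>2 * H - 4 * G"
  proof -
    have "Q = 2 * (\<Sum>i<n. \<eta> i * (norm (y - X i))\<^sup>2)"
      unfolding Q_def sum.distrib using shift[of "\<lambda>i. \<eta> i * (norm (y - X i))\<^sup>2"] \<eta>0 by simp
    also have "\<dots> = 2 * (\<Sum>i<n. 2 * R\<^sup>2 * \<eta> i - 2 * (\<eta> i * \<Psi> i))"
      by (intro arg_cong2[where f = "(*)"] sum.cong refl) (simp add: \<Psi> algebra_simps)
    also have "\<dots> = 4 * R\<^sup>2 * H - 4 * G" by (simp add: sum_subtractf H_def G_def flip: sum_distrib_left)
    finally show ?thesis .
  qed
  have I: "I \<le> - (h\<^sup>2 * (1 - h / R)) * H + D"
  proof -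
    have "I \<le> (\<Sum>i<n. - (h\<^sup>2 * (1 - h / R)) * ((\<eta> i + \<eta> (Suc i)) / 2) + (\<eta> (Suc i) - \<eta> i) * (\<Psi> (Suc i) - \<Psi> i))"
      unfolding I_def
    proof (rule sum_mono)
      fix i assume "i \<in> {..<n}"
      then have i: "i < n" by simp
      \<comment> \<open>The product rule with weights averaged over the edge; it is exact because
        \<open>\<Psi>\<close> is quadratic in \<open>X\<close>.\<close>
      have "(X (Suc i) - X i) \<bullet> (u (Suc i) - u i)
        = - ((norm (X (Suc i) - X i))\<^sup>2 * ((\<eta> i + \<eta> (Suc i)) / 2)) + (\<eta> (Suc i) - \<eta> i) * (\<Psi> (Suc i) - \<Psi> i)"
        unfolding \<Psi> u_def power2_norm_eq_inner by (simp add: inner_diff inner_add inner_commute field_simps)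
      moreover have "h\<^sup>2 * (1 - h / R) * ((\<eta> i + \<eta> (Suc i)) / 2) \<le> (norm (X (Suc i) - X i))\<^sup>2 * ((\<eta> i + \<eta> (Suc i)) / 2)"
        using dX2[OF i] \<eta>01[of i] \<eta>01[of "Suc i"] i by (intro mult_right_mono) auto
      ultimately show "(X (Suc i) - X i) \<bullet> (u (Suc i) - u i)
        \<le> - (h\<^sup>2 * (1 - h / R)) * ((\<eta> i + \<eta> (Suc i)) / 2) + (\<eta> (Suc i) - \<eta> i) * (\<Psi> (Suc i) - \<Psi> i)" by simp
    qed
    also have "\<dots> = - (h\<^sup>2 * (1 - h / R)) * (\<Sum>i<n. (\<eta> i + \<eta> (Suc i)) / 2) + D"
      unfolding sum.distrib D_def sum_distrib_left ..
    also have "(\<Sum>i<n. (\<eta> i + \<eta> (Suc i)) / 2) = H"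
      using shift[of \<eta>] \<eta>0 by (simp add: H_def sum.distrib flip: sum_divide_distrib)
    finally show ?thesis .
  qed
  have H: "0 \<le> H" "H \<le> n"
    using \<eta>01 sum_mono[of "{..<n}" \<eta> "\<lambda>_. 1"] by (auto simp: H_def intro!: sum_nonneg)
  have G: "\<bar>G / n\<bar> \<le> R\<^sup>2 + W\<^sup>2 / 2"
  proof -
    have "\<bar>G\<bar> \<le> (\<Sum>i<n. \<bar>\<eta> i * \<Psi> i\<bar>)" unfolding G_def by (rule sum_abs)
    also have "\<dots> \<le> (\<Sum>i<n. R\<^sup>2 + W\<^sup>2 / 2)"
    proof (rule sum_mono)
      fix i assume "i \<in> {..<n}"
      then have i: "i \<le> n" by simp
      have "(norm (y - X i))\<^sup>2 \<le> W\<^sup>2" using yX[OF i] by (intro power_mono) auto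
      then have "\<bar>\<Psi> i\<bar> \<le> R\<^sup>2 + W\<^sup>2 / 2" unfolding \<Psi> by (auto simp: abs_le_iff intro: add_increasing order_trans[of _ 0])
      then have "\<bar>\<eta> i\<bar> * \<bar>\<Psi> i\<bar> \<le> 1 * (R\<^sup>2 + W\<^sup>2 / 2)" using \<eta>01[OF i] by (intro mult_mono) auto
      then show "\<bar>\<eta> i * \<Psi> i\<bar> \<le> R\<^sup>2 + W\<^sup>2 / 2" by (simp add: abs_mult)
    qed
    finally show ?thesis using n by (simp add: pos_divide_le_eq mult.commute)
  qed
  have D: "D = sin (\<mu> / n) * Z + 4 * (sin (\<mu> / (2 * real n)))\<^sup>2 * G"
  proof -
    have e: "\<Psi> j = \<psi> (l * real j / real n)" "\<Psi> 0 = \<psi> 0" "\<Psi> n = \<psi> l" "\<mu> / (2 * real n) = \<mu> / real n / 2"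
      using n by (simp_all add: \<Psi>_def h_def mult.commute)
    show ?thesis unfolding D_def \<eta>_def green_sum[OF j] Z G_def e by simp
  qed
  have E: "2 * real n * I + l\<^sup>2 / (2 * R\<^sup>2 * real n) * Q \<le>
     2 * (real n * sin (\<mu> / real n) * Z
        + \<bar>4 * (real n)\<^sup>2 * (sin (\<mu> / (2 * real n)))\<^sup>2 - \<mu>\<^sup>2\<bar> * (R\<^sup>2 + W\<^sup>2 / 2) + l ^ 3 / R / real n)"
  proof -
    define \<kappa> where "\<kappa> = 4 * (real n)\<^sup>2 * (sin (\<mu> / (2 * real n)))\<^sup>2"
    have "2 * real n * I \<le> 2 * real n * (- (h\<^sup>2 * (1 - h / R)) * H + D)"
      using I by (intro mult_left_mono) auto
    also have "\<dots> = - 2 * (real n * h\<^sup>2) * H + 2 * (real n * h\<^sup>2 * h / R) * H + 2 * real n * D"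
      by (simp add: algebra_simps)
    also have "\<dots> \<le> - 2 * (real n * h\<^sup>2) * H + 2 * (real n * h\<^sup>2 * h / R) * real n + 2 * real n * D"
      using H h R by (intro add_mono order_refl mult_left_mono) auto
    also have "real n * h\<^sup>2 = l\<^sup>2 / real n" using n by (simp add: h_def power2_eq_square)
    also have "2 * (l\<^sup>2 / real n * h / R) * real n = 2 * (l ^ 3 / R / real n)"
      using n by (simp add: h_def power2_eq_square power3_eq_cube mult_ac)
    also have "2 * real n * D = 2 * (real n * sin (\<mu> / n) * Z + \<kappa> * (G / n))"
      using n by (simp add: D \<kappa>_def power2_eq_square algebra_simps)
    finally have 1: "2 * real n * I \<le> - 2 * (l\<^sup>2 / real n) * H + 2 * (l ^ 3 / R / real n) + 2 * (real n * sin (\<mu> / n) * Z + \<kappa> * (G / n))" .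
    have 2: "l\<^sup>2 / (2 * R\<^sup>2 * real n) * Q = 2 * (l\<^sup>2 / real n) * H - 2 * (\<mu>\<^sup>2 * (G / n))"
      unfolding Q using R n by (simp add: \<mu> field_simps)
    have "(\<kappa> - \<mu>\<^sup>2) * (G / n) \<le> \<bar>\<kappa> - \<mu>\<^sup>2\<bar> * \<bar>G / n\<bar>" by (metis abs_ge_self abs_mult)
    also have "\<dots> \<le> \<bar>\<kappa> - \<mu>\<^sup>2\<bar> * (R\<^sup>2 + W\<^sup>2 / 2)" using G by (intro mult_left_mono) auto
    finally have 3: "\<kappa> * (G / n) - \<mu>\<^sup>2 * (G / n) \<le> \<bar>\<kappa> - \<mu>\<^sup>2\<bar> * (R\<^sup>2 + W\<^sup>2 / 2)" by (simp only: left_diff_distrib)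
    show ?thesis unfolding \<kappa>_def[symmetric] 2 distrib_left using 1 3 unfolding distrib_left by linarith
  qed
  have "\<epsilon> * (2 * real n * I + l\<^sup>2 / (2 * R\<^sup>2 * real n) * Q) \<le> \<epsilon> * (2 * (real n * sin (\<mu> / real n) * Z
        + \<bar>4 * (real n)\<^sup>2 * (sin (\<mu> / (2 * real n)))\<^sup>2 - \<mu>\<^sup>2\<bar> * (R\<^sup>2 + W\<^sup>2 / 2) + l ^ 3 / R / real n))"
    using E \<epsilon>(1) by (rule mult_left_mono)
  moreover have "l\<^sup>2 * (1 - 2 * (l + K) / (R * real n)) = l\<^sup>2 - 2 * l\<^sup>2 * (l + K) / R / real n"
    by (simp add: right_diff_distrib)
  ultimately show ?thesis using FV unfolding C_def mult.assoc[of 2 \<epsilon>] mult.left_commute[of 2 \<epsilon>] by linarith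
qed

text \<open>The weak form of $\psi'' + \psi/R^2 \le 0$, tested with Green's function.\<close>

lemma shortest_path_sine_concave:
  fixes A :: "'a::real_inner set" and M :: nat
  assumes R: "R > 0" and feet: "has_feet R A"
    and x: "unit_path A p q l x" and l: "l = path_dist A p q" "0 < l" "l < pi * R" and yA: "y \<in> A"
    and M: "2 \<le> M" and \<mu>: "\<mu> = l / R" and \<psi>: "\<And>t. \<psi> t = R\<^sup>2 - (norm (y - x t))\<^sup>2 / 2"
  shows "\<psi> 0 * sin (\<mu> - \<mu> / M) + \<psi> l * sin (\<mu> / M) \<le> \<psi> (l / M) * sin \<mu>"
proof -
  define W where "W = norm (y - p) + l"
  define K where "K = l + l / R * W"
  define \<sigma> where "\<sigma> = W\<^sup>2 / (2 * R\<^sup>2)"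
  define C where "C = 8 * l\<^sup>2 * \<sigma>\<^sup>2 + 12 * l * K * \<sigma> + 4 * K\<^sup>2"
  define Z where "Z = \<psi> (l / M) * sin \<mu> - \<psi> 0 * sin (\<mu> - \<mu> / M) - \<psi> l * sin (\<mu> / M)"
  have W0: "W > 0" using l by (simp add: W_def add_nonneg_pos)
  have \<sigma>0: "\<sigma> > 0" using W0 R by (simp add: \<sigma>_def)
  have K0: "K > 0" using l W0 R by (simp add: K_def add_pos_pos)
  have C0: "C \<ge> 0" using l K0 \<sigma>0 by (simp add: C_def)
  have \<mu>0: "\<mu> > 0" using l R by (simp add: \<mu>)
  define F where "F \<epsilon> n = 2 * l\<^sup>2 * (l + K) / R / real n + C * \<epsilon>\<^sup>2
    + 2 * \<epsilon> * (real n * sin (\<mu> / real n) * Z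
        + \<bar>4 * (real n)\<^sup>2 * (sin (\<mu> / (2 * real n)))\<^sup>2 - \<mu>\<^sup>2\<bar> * (R\<^sup>2 + W\<^sup>2 / 2) + l ^ 3 / R / real n)" for \<epsilon> n
  \<comment> \<open>The grid is refined with \<open>\<epsilon>\<close> fixed, and one factor
    \<open>\<epsilon>\<close> is cancelled; only then does \<open>\<epsilon>\<close> tend to
    0.\<close>
  have main: "0 \<le> C * \<epsilon> + 2 * (\<mu> * Z)" if \<epsilon>: "0 < \<epsilon>" "\<epsilon> \<le> 1" "\<epsilon> * W < R" "\<epsilon> * \<sigma> \<le> 1 / 2" for \<epsilon>
  proof -
    have "F \<epsilon> \<longlonglongrightarrow> 0 + C * \<epsilon>\<^sup>2 + 2 * \<epsilon> * (\<mu> * Z + \<bar>\<mu>\<^sup>2 - \<mu>\<^sup>2\<bar> * (R\<^sup>2 + W\<^sup>2 / 2) + 0)"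
      unfolding F_def by (intro tendsto_intros tendsto_wirtinger_constant tendsto_mult_sin_divide lim_const_over_n)
    then have lim: "F \<epsilon> \<longlonglongrightarrow> \<epsilon> * (C * \<epsilon> + 2 * (\<mu> * Z))" by (simp add: power2_eq_square algebra_simps)
    \<comment> \<open>Only multiples of \<open>M\<close> serve as grid sizes, so that
      \<open>l / M\<close> is the grid point with index \<open>Suc j\<close> and can carry the
      pole.\<close>
    define r where "r j = M * Suc j" for j
    have r: "strict_mono r" using M by (auto simp: strict_mono_def r_def)
    have "(\<lambda>n. (l + K) / real n) \<longlonglongrightarrow> 0" by (rule lim_const_over_n)
    then have "\<forall>\<^sub>F n in sequentially. (l + K) / real n < R" using R by (intro order_tendstoD) auto
    then have "\<forall>\<^sub>F j in sequentially. (l + K) / real (r j) < R" by (rule eventually_subseq[OF r])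
    then have "\<forall>\<^sub>F j in sequentially. 0 \<le> (F \<epsilon> \<circ> r) j"
    proof eventually_elim
      case (elim j)
      have "1 * Suc j < M * Suc j" using M by (intro mult_less_mono1) auto
      then have j: "0 < Suc j" "Suc j < r j" by (auto simp: r_def)
      have e: "l * real (Suc j) / real (r j) = l / M" "\<mu> * real (Suc j) / real (r j) = \<mu> / M"
        by (simp_all add: r_def del: of_nat_Suc mult_Suc_right)
      have Z: "Z = \<psi> (l * real (Suc j) / real (r j)) * sin \<mu> - \<psi> 0 * sin (\<mu> - \<mu> * real (Suc j) / real (r j))
          - \<psi> l * sin (\<mu> * real (Suc j) / real (r j))" unfolding e Z_def ..
      show ?case
        using green_variation[OF R feet x l yA j W_def K_def \<sigma>_def _ \<epsilon>(2-4) elim \<mu> \<psi> Z] \<epsilon>(1)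
        by (simp add: F_def C_def)
    qed
    then have "0 \<le> \<epsilon> * (C * \<epsilon> + 2 * (\<mu> * Z))"
      by (rule tendsto_lowerbound[OF LIMSEQ_subseq_LIMSEQ[OF lim r]]) simp
    then show ?thesis using \<epsilon>(1) by (simp add: zero_le_mult_iff)
  qed
  have "((\<lambda>\<epsilon>. C * \<epsilon> + 2 * (\<mu> * Z)) \<longlongrightarrow> C * 0 + 2 * (\<mu> * Z)) (at_right 0)"
    by (intro tendsto_intros)
  moreover have "\<forall>\<^sub>F \<epsilon> in at_right (0::real). 0 \<le> C * \<epsilon> + 2 * (\<mu> * Z)"
  proof -
    define e0 where "e0 = min 1 (min (R / W / 2) (1 / (2 * \<sigma>)))"
    have e0: "e0 > 0" using R W0 \<sigma>0 by (simp add: e0_def)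
    show ?thesis using eventually_at_right_real[OF e0]
    proof eventually_elim
      case (elim \<epsilon>)
      then have \<epsilon>: "0 < \<epsilon>" "\<epsilon> \<le> 1" "\<epsilon> < R / W / 2" "\<epsilon> < 1 / (2 * \<sigma>)" by (auto simp: e0_def)
      have "\<epsilon> * W < R / W / 2 * W" using \<epsilon>(3) W0 by (rule mult_strict_right_mono)
      also have "\<dots> = R / 2" using W0 by simp
      finally have "\<epsilon> * W < R" using R by simp
      moreover have "\<epsilon> * \<sigma> \<le> 1 / 2" using \<epsilon>(4) \<sigma>0 by (simp add: pos_less_divide_eq)
      ultimately show ?case using main \<epsilon> by blast
    qed
  qed
  ultimately have "0 \<le> C * 0 + 2 * (\<mu> * Z)" by (rule tendsto_lowerbound) simp
  then show ?thesis using \<mu>0 by (simp add: Z_def zero_le_mult_iff)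
qed

section \<open>Comparison with the circle of radius R\<close>

lemma sine_chord_inequality:
  fixes R D \<mu> :: real
  assumes R: "R > 0" and D: "0 \<le> D" "D \<le> 2 * R"
  shows "D * sqrt (1 - (D / (2 * R))\<^sup>2) * sin \<mu> \<le> (R\<^sup>2 - (R\<^sup>2 - D\<^sup>2 / 2) * cos \<mu>) / R"
proof -
  \<comment> \<open>\<open>D\<close> is the chord of the central angle 2\<theta>. In these terms the
    claim is cos(\<mu> - 2\<theta>) <= 1, with equality for \<mu> = 2\<theta>, the case of a circle
    arc.\<close>
  define \<theta> where "\<theta> = arcsin (D / (2 * R))"
  have b: "0 \<le> D / (2 * R)" "D / (2 * R) \<le> 1" using R D by auto
  have s: "sin \<theta> = D / (2 * R)" using b by (simp add: \<theta>_def)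
  have c: "cos \<theta> = sqrt (1 - (D / (2 * R))\<^sup>2)" using b by (simp add: \<theta>_def cos_arcsin)
  have Ds: "D = 2 * R * sin \<theta>" using s R by simp
  have "D * sqrt (1 - (D / (2 * R))\<^sup>2) * sin \<mu> = R * (sin (2 * \<theta>) * sin \<mu>)"
    unfolding c[symmetric] by (subst Ds) (simp add: sin_double)
  also have "\<dots> \<le> R * (1 - cos \<mu> * cos (2 * \<theta>))"
    using cos_le_one[of "\<mu> - 2 * \<theta>"] R by (intro mult_left_mono) (auto simp: cos_diff mult.commute)
  also have "\<dots> = (R\<^sup>2 - (R\<^sup>2 - D\<^sup>2 / 2) * cos \<mu>) / R"
    using R unfolding Ds cos_double_sin by (simp add: field_simps power2_eq_square)
  finally show ?thesis .
qed

text \<open>The sine comparison with y = q, differentiated at p. The bound is |q - p| cos \<theta>,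
  where sin \<theta> = |q - p|/(2R): in a circle of radius R this \<theta> is the angle between
  chord and tangent. As no derivative of x is available, the claim concerns all late difference
  quotients.\<close>

lemma shortest_path_initial_direction:
  fixes A :: "'a::real_inner set"
  assumes R: "R > 0" and feet: "has_feet R A"
    and x: "unit_path A p q l x" and l: "l = path_dist A p q" "0 < l" "l < pi * R" and D: "norm (q - p) \<le> 2 * R"
    and c: "c < norm (q - p) * sqrt (1 - (norm (q - p) / (2 * R))\<^sup>2)"
  shows "\<forall>\<^sub>F M in sequentially. c \<le> (q - p) \<bullet> ((real M / l) *\<^sub>R (x (l / M) - p))"
proof -
  define \<mu> where "\<mu> = l / R"
  define d where "d = norm (q - p)"
  define \<psi> where "\<psi> t = R\<^sup>2 - (norm (q - x t))\<^sup>2 / 2" for t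
  have ends: "x 0 = p" "x l = q" using x by (simp_all add: unit_path_def)
  have qA: "q \<in> A" using x l(2) ends by (auto simp: unit_path_def image_subset_iff dest: bspec[of _ _ l])
  have "0 < \<mu>" "\<mu> < pi" using l R by (auto simp: \<mu>_def pos_divide_less_eq)
  then have s\<mu>: "0 < sin \<mu>" by (intro sin_gt_zero)
  have \<psi>0: "\<psi> 0 = R\<^sup>2 - d\<^sup>2 / 2" and \<psi>l: "\<psi> l = R\<^sup>2" by (simp_all add: \<psi>_def ends d_def)
  \<comment> \<open>This is \<open>sin \<mu>\<close> times the difference quotient at 0 of the sine
    function with the end values \<open>\<psi> 0\<close> and \<open>\<psi> l\<close>.\<close>
  define B where "B M = (\<psi> 0 * (real M * (sin (\<mu> - \<mu> / real M) - sin \<mu>)) + R\<^sup>2 * (real M * sin (\<mu> / real M))) / l" for M :: nat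
  have "(\<lambda>M. real M * (sin (\<mu> - \<mu> / real M) - sin \<mu>)) \<longlonglongrightarrow> - (\<mu> * cos \<mu>)"
  proof -
    have e: "real M * (sin (\<mu> - \<mu> / real M) - sin \<mu>)
      = - 2 * sin \<mu> * ((real M * sin (\<mu> / 2 / real M)) * sin (\<mu> / 2 / real M)) - cos \<mu> * (real M * sin (\<mu> / real M))" for M :: nat
    proof -
      have c: "cos (\<mu> / real M) = 1 - 2 * (sin (\<mu> / 2 / real M))\<^sup>2"
        using cos_double_sin[of "\<mu> / 2 / real M"] by simp
      show ?thesis unfolding sin_diff c by (simp add: power2_eq_square algebra_simps)
    qed
    have "(\<lambda>M. sin (\<mu> / 2 / real M)) \<longlonglongrightarrow> sin 0" by (intro tendsto_sin lim_const_over_n)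
    then have "(\<lambda>M. - 2 * sin \<mu> * ((real M * sin (\<mu> / 2 / real M)) * sin (\<mu> / 2 / real M)) - cos \<mu> * (real M * sin (\<mu> / real M)))
      \<longlonglongrightarrow> - 2 * sin \<mu> * (\<mu> / 2 * sin 0) - cos \<mu> * \<mu>"
      by (intro tendsto_intros tendsto_mult_sin_divide)
    then show ?thesis unfolding e by (simp add: mult.commute)
  qed
  then have "B \<longlonglongrightarrow> (\<psi> 0 * (- (\<mu> * cos \<mu>)) + R\<^sup>2 * \<mu>) / l"
    unfolding B_def using l(2) by (intro tendsto_intros tendsto_mult_sin_divide) auto
  also have "(\<psi> 0 * (- (\<mu> * cos \<mu>)) + R\<^sup>2 * \<mu>) / l = (R\<^sup>2 - (R\<^sup>2 - d\<^sup>2 / 2) * cos \<mu>) / R"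
    unfolding \<psi>0 \<mu>_def using l R by (simp add: field_simps)
  finally have lim: "B \<longlonglongrightarrow> (R\<^sup>2 - (R\<^sup>2 - d\<^sup>2 / 2) * cos \<mu>) / R" .
  have "c * sin \<mu> < d * sqrt (1 - (d / (2 * R))\<^sup>2) * sin \<mu>"
    using c s\<mu> by (simp add: d_def)
  also have "\<dots> \<le> (R\<^sup>2 - (R\<^sup>2 - d\<^sup>2 / 2) * cos \<mu>) / R"
    using D by (intro sine_chord_inequality[OF R]) (auto simp: d_def)
  finally have "\<forall>\<^sub>F M in sequentially. c * sin \<mu> < B M" by (rule order_tendstoD(1)[OF lim])
  then show ?thesis using eventually_ge_at_top[of 2]
  proof eventually_elim
    case (elim M)
    define v where "v = x (l / M) - p"
    have "\<psi> 0 * sin (\<mu> - \<mu> / M) + \<psi> l * sin (\<mu> / M) \<le> \<psi> (l / M) * sin \<mu>"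
      by (rule shortest_path_sine_concave[OF R feet x l qA elim(2) \<mu>_def \<psi>_def])
    moreover have "\<psi> (l / M) \<le> \<psi> 0 + (q - p) \<bullet> v"
    proof -
      have "(norm (q - x (l / M)))\<^sup>2 = (norm (q - p))\<^sup>2 - 2 * ((q - p) \<bullet> v) + (norm v)\<^sup>2"
        unfolding power2_norm_eq_inner v_def by (simp add: inner_diff inner_commute)
      then show ?thesis using zero_le_power2[of "norm v"] unfolding \<psi>_def ends by linarith
    qed
    then have "\<psi> (l / M) * sin \<mu> \<le> (\<psi> 0 + (q - p) \<bullet> v) * sin \<mu>" using s\<mu> by (intro mult_right_mono) auto
    ultimately have "\<psi> 0 * (sin (\<mu> - \<mu> / M) - sin \<mu>) + R\<^sup>2 * sin (\<mu> / M) \<le> (q - p) \<bullet> v * sin \<mu>"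
      by (simp add: \<psi>l algebra_simps)
    then have "(\<psi> 0 * (sin (\<mu> - \<mu> / M) - sin \<mu>) + R\<^sup>2 * sin (\<mu> / M)) * (real M / l) \<le> (q - p) \<bullet> v * sin \<mu> * (real M / l)"
      using l(2) by (intro mult_right_mono) auto
    moreover have "(\<psi> 0 * (sin (\<mu> - \<mu> / M) - sin \<mu>) + R\<^sup>2 * sin (\<mu> / M)) * (real M / l) = B M"
      by (simp add: B_def algebra_simps add_divide_distrib diff_divide_distrib)
    ultimately have "c * sin \<mu> \<le> (q - p) \<bullet> ((real M / l) *\<^sub>R v) * sin \<mu>" using elim(1) by (simp add: mult_ac)
    then show ?case using s\<mu> by (simp only: v_def mult_le_cancel_right_pos)
  qed
qed

text \<open>As p is nearest to h, the initial direction v of the path has, in the limit, no positive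
  component along h - p. Since <q - p, v> is at least |q - p| cos \<theta> in the limit, the part of
  q - p that can be aligned with h - p has length at most |q - p| sin \<theta> = |q -
  p|^2/(2R).\<close>

lemma shortest_path_support:
  fixes A :: "'a::real_inner set"
  assumes R: "R > 0" and feet: "has_feet R A"
    and x: "unit_path A p q l x" and l: "l = path_dist A p q" "0 < l" "l < pi * R" and D: "norm (q - p) < 2 * R"
    and near: "\<And>t. 0 \<le> t \<Longrightarrow> t \<le> l \<Longrightarrow> norm (h - p) \<le> norm (h - x t)"
  shows "2 * R * ((q - p) \<bullet> (h - p)) \<le> norm (h - p) * (norm (q - p))\<^sup>2"
proof (cases "q = p")
  case False
  define d where "d = norm (q - p)"
  define k where "k = h - p"
  define c1 where "c1 = d * sqrt (1 - (d / (2 * R))\<^sup>2)"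
  have d: "0 < d" "d < 2 * R" using False D by (auto simp: d_def)
  have dR: "0 < d / (2 * R)" "d / (2 * R) < 1" using d R by auto
  have d1: "(d / (2 * R))\<^sup>2 < 1" using dR by (simp add: power_less_one_iff)
  have c1: "0 < c1" using d d1 by (simp add: c1_def)
  have c1sq: "d\<^sup>2 - c1\<^sup>2 = (d\<^sup>2 / (2 * R))\<^sup>2"
    using d1 unfolding c1_def power_mult_distrib by (simp add: power_divide algebra_simps)
  have bound: "(q - p) \<bullet> k \<le> sqrt (d\<^sup>2 - c\<^sup>2) * norm k" if c: "0 < c" "c < c1" for c
  proof -
    have "(\<lambda>M. sqrt (d\<^sup>2 - c\<^sup>2) * norm k + c * (l / 2 / real M)) \<longlonglongrightarrow> sqrt (d\<^sup>2 - c\<^sup>2) * norm k + c * 0"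
      by (intro tendsto_intros lim_const_over_n)
    moreover have "\<forall>\<^sub>F M in sequentially. (q - p) \<bullet> k \<le> sqrt (d\<^sup>2 - c\<^sup>2) * norm k + c * (l / 2 / real M)"
      using shortest_path_initial_direction[OF R feet x l less_imp_le[OF D] c(2)[unfolded c1_def d_def]] eventually_gt_at_top[of 0]
    proof eventually_elim
      case (elim M)
      define t where "t = l / M"
      define u where "u = x t - p"
      define v where "v = (real M / l) *\<^sub>R u"
      have t: "0 < t" "t \<le> l" using l elim(2) by (auto simp: t_def pos_divide_le_eq)
      have tM: "real M / l = 1 / t" by (simp add: t_def)
      have "norm (x t - x 0) \<le> t - 0" by (rule unit_path_norm_le[OF x]) (use t in auto)
      then have u: "norm u \<le> t" using x by (simp add: u_def unit_path_def)
      then have nv: "norm v \<le> 1" using t by (simp add: v_def tM pos_divide_le_eq)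
      have "(norm k)\<^sup>2 \<le> (norm (k - u))\<^sup>2" using near[of t] t by (simp add: k_def u_def)
      also have "\<dots> = (norm k)\<^sup>2 - 2 * (k \<bullet> u) + (norm u)\<^sup>2"
        unfolding power2_norm_eq_inner by (simp add: inner_diff inner_commute)
      finally have "2 * (k \<bullet> u) \<le> t\<^sup>2" using power_mono[OF u, of 2] by simp
      then have kv: "k \<bullet> v \<le> t / 2" using t by (simp add: v_def tM pos_divide_le_eq power2_eq_square)
      have gv: "c \<le> (q - p) \<bullet> v" using elim(1) by (simp add: v_def u_def t_def)
      \<comment> \<open>the component $c v$ of $q - p$ contributes at most $c t / 2$, the rest is short\<close>
      have "(norm (q - p - c *\<^sub>R v))\<^sup>2 = d\<^sup>2 - 2 * c * ((q - p) \<bullet> v) + c\<^sup>2 * (norm v)\<^sup>2"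
        unfolding power2_norm_eq_inner d_def
        by (simp add: inner_diff inner_commute power2_eq_square algebra_simps)
      also have "\<dots> \<le> d\<^sup>2 - 2 * c * c + c\<^sup>2 * 1"
        using gv nv c by (intro add_mono diff_left_mono mult_left_mono) (auto simp: power_le_one)
      finally have "(norm (q - p - c *\<^sub>R v))\<^sup>2 \<le> d\<^sup>2 - c\<^sup>2" by (simp add: power2_eq_square)
      then have 1: "norm (q - p - c *\<^sub>R v) \<le> sqrt (d\<^sup>2 - c\<^sup>2)" by (rule real_le_rsqrt)
      have "(q - p) \<bullet> k = (q - p - c *\<^sub>R v) \<bullet> k + c * (k \<bullet> v)" by (simp add: inner_diff inner_commute algebra_simps)
      also have "\<dots> \<le> norm (q - p - c *\<^sub>R v) * norm k + c * (t / 2)"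
        using kv c by (intro add_mono norm_cauchy_schwarz mult_left_mono) auto
      also have "\<dots> \<le> sqrt (d\<^sup>2 - c\<^sup>2) * norm k + c * (t / 2)" using 1 by (intro add_mono order_refl mult_right_mono) auto
      finally show ?case by (simp add: t_def)
    qed
    ultimately have "(q - p) \<bullet> k \<le> sqrt (d\<^sup>2 - c\<^sup>2) * norm k + c * 0" by (rule tendsto_lowerbound) simp
    then show ?thesis by simp
  qed
  have "((\<lambda>c. sqrt (d\<^sup>2 - c\<^sup>2) * norm k) \<longlongrightarrow> sqrt (d\<^sup>2 - c1\<^sup>2) * norm k) (at_left c1)"
    by (intro tendsto_intros)
  moreover have "\<forall>\<^sub>F c in at_left c1. (q - p) \<bullet> k \<le> sqrt (d\<^sup>2 - c\<^sup>2) * norm k"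
    using eventually_at_left_real[OF c1] by eventually_elim (use bound in auto)
  ultimately have "(q - p) \<bullet> k \<le> sqrt (d\<^sup>2 - c1\<^sup>2) * norm k" by (rule tendsto_lowerbound) simp
  also have "sqrt (d\<^sup>2 - c1\<^sup>2) = d\<^sup>2 / (2 * R)" unfolding c1sq using R by (intro real_sqrt_unique) auto
  finally show ?thesis using R by (simp add: d_def k_def pos_le_divide_eq mult_ac)
qed simp

section \<open>The image of a shortest path\<close>

lemma path_dist_commute: "path_dist A a b = path_dist A b a"
proof -
  have "{L. \<exists>x. unit_path A a b L x} = {L. \<exists>x. unit_path A b a L x}"
    using unit_path_reverse by blast
  then show ?thesis by (simp add: path_dist_def)
qed

text \<open>The image is compact, so nearest points exist. For the foot x s and another point x t of
  the image, \<open>shortest_path_support\<close> applies to the piece from x s to x t, taken from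
  the reversed path if t < s; pieces of shortest paths are shortest.\<close>

lemma shortest_path_image_has_feet:
  fixes A :: "'a::real_inner set"
  assumes R: "R > 0" and feet: "has_feet R A"
    and x: "unit_path A a b (path_dist A a b) x" and lam: "path_dist A a b < pi * R"
  shows "compact (x ` {0..path_dist A a b})" "has_feet R (x ` {0..path_dist A a b})"
proof -
  define L where "L = path_dist A a b"
  define G where "G = x ` {0..L}"
  have L0: "0 \<le> L" using x by (simp add: unit_path_def L_def)
  have "continuous_on {0..L} x" using unit_path_continuous_on[OF x] by (simp add: L_def)
  then show cG: "compact (x ` {0..path_dist A a b})"
    unfolding L_def by (intro compact_continuous_image) auto
  have ordered: "2 * R * ((y t - y s) \<bullet> (h - y s)) \<le> norm (h - y s) * (norm (y t - y s))\<^sup>2"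
    if y: "unit_path A c d (path_dist A c d) y" and lt: "path_dist A c d < pi * R"
      and st: "0 \<le> s" "s < t" "t \<le> path_dist A c d" and D: "norm (y t - y s) < 2 * R"
      and near: "\<And>r. 0 \<le> r \<Longrightarrow> r \<le> path_dist A c d \<Longrightarrow> norm (h - y s) \<le> norm (h - y r)"
    for c d y s t h
  proof (rule shortest_path_support[OF R feet])
    show "unit_path A (y s) (y t) (t - s) (\<lambda>r. y (s + r))"
      by (rule unit_path_subpath[OF y]) (use st in auto)
    show "t - s = path_dist A (y s) (y t)" using path_dist_subpath[OF y] st by simp
  qed (use st lt D near in auto)
  show "has_feet R (x ` {0..path_dist A a b})"
    unfolding has_feet_def
  proof (intro allI impI)
    fix h
    have "G \<noteq> {}" using L0 by (simp add: G_def)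
    moreover have "compact G" using cG by (simp add: G_def L_def)
    moreover have "continuous_on G (dist h)" by (intro continuous_intros)
    ultimately obtain p where p: "p \<in> G" "\<And>q. q \<in> G \<Longrightarrow> dist h p \<le> dist h q"
      using continuous_attains_inf by metis
    then obtain s where s: "0 \<le> s" "s \<le> L" "p = x s" by (auto simp: G_def)
    have hp: "infdist h G = dist h p"
      using p \<open>G \<noteq> {}\<close> by (auto simp: infdist_notempty intro!: cInf_eq_minimum)
    have near: "norm (h - x s) \<le> norm (h - x r)" if "0 \<le> r" "r \<le> L" for r
      using p(2)[of "x r"] that s by (auto simp: G_def dist_norm)
    have "2 * R * ((q - p) \<bullet> (h - p)) \<le> norm (h - p) * (norm (q - p))\<^sup>2" if "q \<in> G" for q
    proof (cases "norm (q - p) < 2 * R")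
      case False
      \<comment> \<open>At distance 2R or more from \<open>p\<close>, Cauchy-Schwarz
        suffices.\<close>
      have "2 * R * ((q - p) \<bullet> (h - p)) \<le> 2 * R * (norm (q - p) * norm (h - p))"
        using R norm_cauchy_schwarz by (intro mult_left_mono) auto
      also have "\<dots> \<le> norm (q - p) * (norm (q - p) * norm (h - p))"
        using False by (intro mult_right_mono) auto
      finally show ?thesis by (simp add: power2_eq_square mult_ac)
    next
      case True
      from that obtain t where t: "0 \<le> t" "t \<le> L" "q = x t" by (auto simp: G_def)
      consider "s = t" | "s < t" | "t < s" by linarith
      then show ?thesis
      proof cases
        case 1
        then show ?thesis using s t by simp
      next
        case 2
        then show ?thesis using ordered[OF x lam s(1) 2, of h] t s near True by (simp add: L_def)
      next
        case 3
        have y: "unit_path A b a (path_dist A b a) (\<lambda>r. x (L - r))"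
          using unit_path_reverse[OF x] by (simp add: path_dist_commute[of A b a] L_def)
        have e: "path_dist A b a = L" by (simp add: path_dist_commute[of A b a] L_def)
        show ?thesis
          using ordered[OF y, unfolded e, of "L - s" "L - t" h] lam s t 3 near True by (simp add: L_def)
      qed
    qed
    then have "foot R G h p" using p(1) hp by (auto simp: foot_def dist_norm)
    then show "\<exists>p. foot R (x ` {0..path_dist A a b}) h p" by (auto simp: G_def L_def)
  qed
qed

section \<open>Lengths of continuous curves\<close>

text \<open>A separate index set turns \<open>curve_length\<close> into a SUP in
  \<open>ennreal\<close>, to which the rules for adding suprema apply.\<close>

definition partitions :: "real \<Rightarrow> real \<Rightarrow> ((nat \<Rightarrow> real) \<times> nat) set"
  where "partitions s t = {(p, n). mono_on {..n} p \<and> p ` {..n} \<subseteq> {s..t}}"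

definition polyline :: "(real \<Rightarrow> 'a::metric_space) \<Rightarrow> (nat \<Rightarrow> real) \<times> nat \<Rightarrow> real"
  where "polyline g P = (\<Sum>i<snd P. dist (g (fst P i)) (g (fst P (Suc i))))"

lemma curve_length_SUP: "curve_length s t g = (SUP P\<in>partitions s t. ennreal (polyline g P))"
  unfolding curve_length_def by (rule arg_cong[of _ _ Sup]) (auto simp: partitions_def polyline_def image_iff; blast)

lemma polyline_le_curve_length: "P \<in> partitions s t \<Longrightarrow> ennreal (polyline g P) \<le> curve_length s t g"
  unfolding curve_length_SUP by (rule SUP_upper)

lemma constant_partition: "s \<le> t \<Longrightarrow> (\<lambda>_. s, 0) \<in> partitions s t"
  by (auto simp: partitions_def mono_on_def)

lemma grid_partition:
  assumes st: "s \<le> t" and N: "N > 0"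
  shows "(\<lambda>i. s + real i * ((t - s) / real N), N) \<in> partitions s t"
proof -
  have h: "0 \<le> (t - s) / real N" using st by simp
  have "s + real i * ((t - s) / real N) \<in> {s..t}" if "i \<le> N" for i
  proof -
    have "real i * ((t - s) / real N) \<le> real N * ((t - s) / real N)" using that h by (intro mult_right_mono) auto
    also have "\<dots> = t - s" using N by simp
    finally have "real i * ((t - s) / real N) \<le> t - s" .
    moreover have "0 \<le> real i * ((t - s) / real N)" by (rule mult_nonneg_nonneg[OF of_nat_0_le_iff h])
    ultimately show ?thesis unfolding atLeastAtMost_iff by linarith
  qed
  moreover have "mono_on {..N} (\<lambda>i. s + real i * ((t - s) / real N))"
    by (intro mono_onI add_left_mono mult_right_mono h) auto
  ultimately show ?thesis by (auto simp: partitions_def)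
qed

lemma dist_le_curve_length:
  assumes "s \<le> t"
  shows "ennreal (dist (g s) (g t)) \<le> curve_length s t g"
proof -
  have "(\<lambda>i. if i = 0 then s else t, 1) \<in> partitions s t"
    using assms by (auto simp: partitions_def mono_on_def)
  from polyline_le_curve_length[OF this, of g] show ?thesis by (simp add: polyline_def)
qed

text \<open>Partitions of the two pieces are concatenated. As they need not contain u, the joint
  partition has one additional edge, from the last point of the first to the first point of the
  second, and this edge only adds length.\<close>

lemma curve_length_superadditive:
  assumes "s \<le> u" "u \<le> t"
  shows "curve_length s u g + curve_length u t g \<le> curve_length s t g"
proof -
  have ne: "partitions s u \<noteq> {}" "partitions u t \<noteq> {}" using constant_partition assms by blast+
  have "ennreal (polyline g P) + ennreal (polyline g Q) \<le> curve_length s t g"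
    if P: "P \<in> partitions s u" and Q: "Q \<in> partitions u t" for P Q
  proof -
    obtain p n where Pe: "P = (p, n)" by (cases P)
    obtain q m where Qe: "Q = (q, m)" by (cases Q)
    have p: "mono_on {..n} p" "\<And>i. i \<le> n \<Longrightarrow> s \<le> p i \<and> p i \<le> u"
      using P by (auto simp: Pe partitions_def image_subset_iff)
    have q: "mono_on {..m} q" "\<And>i. i \<le> m \<Longrightarrow> u \<le> q i \<and> q i \<le> t"
      using Q by (auto simp: Qe partitions_def image_subset_iff)
    define r where "r i = (if i \<le> n then p i else q (i - Suc n))" for i
    have "mono_on {..n + Suc m} r"
    proof (rule mono_onI)
      fix i k assume ik: "i \<in> {..n + Suc m}" "k \<in> {..n + Suc m}" "i \<le> k"
      consider "k \<le> n" | "i \<le> n" "n < k" | "n < i" using ik by linarith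
      then show "r i \<le> r k"
      proof cases
        case 1
        then show ?thesis using ik mono_onD[OF p(1), of i k] by (simp add: r_def)
      next
        case 2
        then have "k - Suc n \<le> m" using ik by auto
        then show ?thesis using 2 p(2)[of i] q(2)[of "k - Suc n"] by (simp add: r_def)
      next
        case 3
        then show ?thesis using ik mono_onD[OF q(1), of "i - Suc n" "k - Suc n"] by (simp add: r_def)
      qed
    qed
    moreover have "r i \<in> {s..t}" if "i \<le> n + Suc m" for i
    proof (cases "i \<le> n")
      case False
      then have "i - Suc n \<le> m" using that by auto
      then show ?thesis using q(2)[of "i - Suc n"] False assms by (simp add: r_def)
    qed (use p(2)[of i] assms in \<open>simp add: r_def\<close>)
    ultimately have "(r, n + Suc m) \<in> partitions s t" by (auto simp: partitions_def)
    then have "ennreal (polyline g (r, n + Suc m)) \<le> curve_length s t g" by (rule polyline_le_curve_length)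
    moreover have "polyline g P + polyline g Q \<le> polyline g (r, n + Suc m)"
    proof -
      define f where "f i = dist (g (r i)) (g (r (Suc i)))" for i
      have "polyline g (r, n + Suc m) = (\<Sum>i<n. f i) + f n + (\<Sum>i<m. f (i + Suc n))"
        using sum.atLeastLessThan_concat[of 0 "Suc n" "Suc n + m" f] sum.shift_bounds_nat_ivl[of f 0 "Suc n" m]
        by (simp add: polyline_def f_def[symmetric] lessThan_atLeast0 add.commute)
      moreover have "(\<Sum>i<n. f i) = polyline g P" unfolding polyline_def f_def Pe
        by (intro sum.cong) (auto simp: r_def)
      moreover have "(\<Sum>i<m. f (i + Suc n)) = polyline g Q" unfolding polyline_def f_def Qe
        by (intro sum.cong) (auto simp: r_def)
      moreover have "0 \<le> f n" by (simp add: f_def)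
      ultimately show ?thesis by linarith
    qed
    moreover have "ennreal (polyline g P) + ennreal (polyline g Q) = ennreal (polyline g P + polyline g Q)"
      by (rule ennreal_plus[symmetric]) (simp_all add: polyline_def sum_nonneg)
    ultimately show ?thesis by (metis ennreal_leI order_trans)
  qed
  then have "(SUP P\<in>partitions s u. ennreal (polyline g P) + ennreal (polyline g Q)) \<le> curve_length s t g"
    if "Q \<in> partitions u t" for Q using that by (intro SUP_least) auto
  then have "curve_length s u g + ennreal (polyline g Q) \<le> curve_length s t g" if "Q \<in> partitions u t" for Q
    using that ennreal_SUP_add_left[OF ne(1)] by (simp add: curve_length_SUP)
  then have "(SUP Q\<in>partitions u t. curve_length s u g + ennreal (polyline g Q)) \<le> curve_length s t g"
    by (intro SUP_least) auto
  then show ?thesis using ennreal_SUP_add_right[OF ne(2)] by (simp add: curve_length_SUP[of u t])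
qed

section \<open>Lipschitz paths versus continuous curves\<close>

lemma curve_length_le_lipschitz:
  fixes g :: "real \<Rightarrow> 'a::metric_space"
  assumes K: "0 \<le> K" and lip: "\<And>u v. s \<le> u \<Longrightarrow> u \<le> v \<Longrightarrow> v \<le> t \<Longrightarrow> dist (g u) (g v) \<le> K * (v - u)" and st: "s \<le> t"
  shows "curve_length s t g \<le> ennreal (K * (t - s))"
  unfolding curve_length_SUP
proof (rule SUP_least)
  fix P assume "P \<in> partitions s t"
  then obtain p n where P: "P = (p, n)" "mono_on {..n} p" "\<And>i. i \<le> n \<Longrightarrow> s \<le> p i \<and> p i \<le> t"
    by (cases P) (auto simp: partitions_def image_subset_iff)
  have "polyline g P \<le> (\<Sum>i<n. K * (p (Suc i) - p i))"
    unfolding polyline_def P(1) fst_conv snd_conv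
  proof (rule sum_mono)
    fix i assume "i \<in> {..<n}"
    then show "dist (g (p i)) (g (p (Suc i))) \<le> K * (p (Suc i) - p i)"
      using P(3)[of i] P(3)[of "Suc i"] mono_onD[OF P(2), of i "Suc i"] by (intro lip) auto
  qed
  also have "\<dots> = K * (p n - p 0)" by (simp add: sum_lessThan_telescope flip: sum_distrib_left)
  also have "\<dots> \<le> K * (t - s)" using P(3)[of 0] P(3)[of n] K by (intro mult_left_mono) auto
  finally show "ennreal (polyline g P) \<le> ennreal (K * (t - s))" by (rule ennreal_leI)
qed

lemma unit_path_curve_length_le:
  assumes "unit_path A a b L x"
  shows "curve_length 0 L x \<le> ennreal L"
proof -
  have "curve_length 0 L x \<le> ennreal (1 * (L - 0))"
    by (rule curve_length_le_lipschitz)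
       (use assms unit_path_norm_le[OF assms] in \<open>auto simp: dist_norm norm_minus_commute unit_path_def\<close>)
  then show ?thesis by simp
qed

lemma unit_path_curve_between:
  "unit_path A a b L x \<Longrightarrow> 0 < L \<Longrightarrow> curve_between A a b 0 L x"
  using unit_path_continuous_on[of A a b L x] by (simp add: curve_between_def curve_def unit_path_def)

text \<open>Uniform continuity provides an inscribed chain with edges below \<delta>;
  \<open>chain_path\<close> turns it into a path in A at the cost of the factor 1/(1 -
  \<delta>/(2R)), and \<delta> tends to 0. So the infimum over Lipschitz paths bounds the length of
  every continuous curve, and a Lipschitz path exists even if that length is infinite.\<close>

lemma path_dist_le_curve_length:
  fixes A :: "'a::real_inner set"
  assumes R: "R > 0" and feet: "has_feet R A"
    and cont: "continuous_on {s..t} g" and gA: "g ` {s..t} \<subseteq> A" and st: "s \<le> t"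
  shows "\<exists>L x. unit_path A (g s) (g t) L x" and "ennreal (path_dist A (g s) (g t)) \<le> curve_length s t g"
proof -
  have grid: "\<exists>c S. unit_path A (g s) (g t) (S / (1 - \<delta> / (2 * R))) c \<and> ennreal S \<le> curve_length s t g"
    if \<delta>: "0 < \<delta>" "\<delta> < 2 * R" for \<delta>
  proof -
    have "uniformly_continuous_on {s..t} g" using cont by (intro compact_uniformly_continuous) auto
    then obtain d where d: "d > 0" "\<And>u v. u \<in> {s..t} \<Longrightarrow> v \<in> {s..t} \<Longrightarrow> dist u v < d \<Longrightarrow> dist (g u) (g v) < \<delta>"
      using \<delta> unfolding uniformly_continuous_on_def by (metis dist_commute)
    obtain N :: nat where "(t - s) / d < N" using reals_Archimedean2 by blast
    then have Nd: "t - s < N * d" using d by (simp add: pos_divide_less_eq)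
    have N: "N > 0" using Nd st by (cases N) auto
    define p where "p i = s + real i * ((t - s) / N)" for i :: nat
    have h: "0 \<le> (t - s) / N" "(t - s) / N < d" using st N Nd by (auto simp: pos_divide_less_eq mult.commute)
    have part: "(p, N) \<in> partitions s t" unfolding p_def by (rule grid_partition[OF st N])
    then have pb: "p i \<in> {s..t}" if "i \<le> N" for i
      using that by (auto simp: partitions_def image_subset_iff)
    have ends: "p 0 = s" "p N = t" using N by (simp_all add: p_def)
    have step: "norm (g (p (Suc i)) - g (p i)) \<le> \<delta>" if "i < N" for i
    proof -
      have "p (Suc i) = p i + (t - s) / N" unfolding p_def of_nat_Suc distrib_right by simp
      then have "dist (p (Suc i)) (p i) = (t - s) / N" using st by (simp add: dist_real_def)
      then show ?thesis using d(2)[of "p (Suc i)" "p i"] pb[of i] pb[of "Suc i"] that h by (simp add: dist_norm)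
    qed
    define S where "S = (\<Sum>i<N. norm (g (p (Suc i)) - g (p i)))"
    have gpA: "g (p i) \<in> A" if "i \<le> N" for i using gA pb[OF that] by (auto simp: image_subset_iff)
    obtain c where "unit_path A (g (p 0)) (g (p N)) (S / (1 - \<delta> / (2 * R))) c"
      using chain_path[OF R feet less_imp_le[OF \<delta>(1)] \<delta>(2), of N "\<lambda>i. g (p i)"] gpA step
      unfolding S_def by blast
    moreover have "ennreal S \<le> curve_length s t g"
      using polyline_le_curve_length[OF part, of g] by (simp add: S_def polyline_def dist_norm norm_minus_commute)
    ultimately show ?thesis unfolding ends by blast
  qed
  show "\<exists>L x. unit_path A (g s) (g t) L x" using grid[of R] R by auto
  show "ennreal (path_dist A (g s) (g t)) \<le> curve_length s t g"
  proof (cases "curve_length s t g")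
    case (real l)
    have "(path_dist A (g s) (g t)) * (1 - \<delta> / (2 * R)) \<le> l" if \<delta>: "0 < \<delta>" "\<delta> < 2 * R" for \<delta>
    proof -
      obtain c S where c: "unit_path A (g s) (g t) (S / (1 - \<delta> / (2 * R))) c" "ennreal S \<le> ennreal l"
        using grid[OF \<delta>] real by auto
      have "S \<le> l" using c(2) real(1) by (simp add: ennreal_le_iff)
      then show ?thesis using path_dist_le[OF c(1)] \<delta> R by (simp add: pos_le_divide_eq)
    qed
    moreover have "((\<lambda>\<delta>. (path_dist A (g s) (g t)) * (1 - \<delta> / (2 * R))) \<longlongrightarrow> (path_dist A (g s) (g t)) * (1 - 0 / (2 * R))) (at_right 0)"
      by (intro tendsto_intros) (use R in auto)
    moreover have "0 < 2 * R" using R by simp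
    then have "\<forall>\<^sub>F \<delta> in at_right 0. 0 < \<delta> \<and> \<delta> < 2 * R" using eventually_at_right_real[of 0 "2 * R"] by simp
    ultimately have "path_dist A (g s) (g t) * (1 - 0 / (2 * R)) \<le> l"
      by (intro tendsto_upperbound[where F = "at_right (0::real)"]) (auto elim: eventually_mono)
    then show ?thesis using real by (simp add: ennreal_leI)
  qed simp
qed

text \<open>The arc length V is continuous, so it maps onto [0, lam], and |g u - g v| <= |V u - V v|
  makes g factor through V with a 1-Lipschitz map h. Intervals on which g pauses are collapsed by
  V.\<close>

lemma shortest_curve_arclength:
  fixes A :: "'a::real_inner set"
  assumes R: "R > 0" and feet: "has_feet R A" and g: "curve_between A a b s t g"
    and len: "curve_length s t g \<le> ennreal (path_dist A a b)" and lam: "0 < path_dist A a b"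
  shows "\<exists>h. unit_path A a b (path_dist A a b) h \<and> reparametrization_of s t g 0 (path_dist A a b) h"
proof -
  define lam where "lam = path_dist A a b"
  have st: "s < t" and cont: "continuous_on {s..t} g" and gA: "g ` {s..t} \<subseteq> A" and ends: "g s = a" "g t = b"
    using g by (auto simp: curve_between_def curve_def)
  have sub: "\<exists>L x. unit_path A (g u) (g v) L x" "ennreal (path_dist A (g u) (g v)) \<le> curve_length u v g"
    if "s \<le> u" "u \<le> v" "v \<le> t" for u v
    using path_dist_le_curve_length[OF R feet continuous_on_subset[OF cont], of u v] gA that by (auto simp: image_subset_iff)
  have total: "curve_length s t g \<le> ennreal lam" using len by (simp add: lam_def)
  have fin: "curve_length u v g \<le> ennreal lam" if "s \<le> u" "u \<le> v" "v \<le> t" for u v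
  proof -
    have "curve_length u v g \<le> curve_length s u g + (curve_length u v g + curve_length v t g)"
      by (metis add.commute add.left_commute le_iff_add)
    also have "\<dots> \<le> curve_length s u g + curve_length u t g"
      using that by (intro add_mono curve_length_superadditive) auto
    also have "\<dots> \<le> curve_length s t g" using that by (intro curve_length_superadditive) auto
    finally show ?thesis using total by simp
  qed
  define \<Lambda> where "\<Lambda> u v = enn2real (curve_length u v g)" for u v
  have \<Lambda>: "curve_length u v g = ennreal (\<Lambda> u v)" "0 \<le> \<Lambda> u v" if "s \<le> u" "u \<le> v" "v \<le> t" for u v
    using fin[OF that] by (auto simp: \<Lambda>_def ennreal_enn2real_if top_unique)
  have add: "\<Lambda> u v + \<Lambda> v w \<le> \<Lambda> u w" if "s \<le> u" "u \<le> v" "v \<le> w" "w \<le> t" for u v w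
  proof -
    have "ennreal (\<Lambda> u v) + ennreal (\<Lambda> v w) \<le> ennreal (\<Lambda> u w)"
      using curve_length_superadditive[of u v w g] \<Lambda>[of u v] \<Lambda>[of v w] \<Lambda>[of u w] that by simp
    then show ?thesis using \<Lambda>[of u v] \<Lambda>[of v w] \<Lambda>[of u w] that by (simp flip: ennreal_plus)
  qed
  have pd: "path_dist A (g u) (g v) \<le> \<Lambda> u v" if "s \<le> u" "u \<le> v" "v \<le> t" for u v
    using sub(2)[OF that] \<Lambda>[OF that] by simp
  have \<Lambda>d: "norm (g u - g v) \<le> \<Lambda> u v" if "s \<le> u" "u \<le> v" "v \<le> t" for u v
    using dist_le_curve_length[OF that(2), of g] \<Lambda>[OF that] by (simp add: dist_norm)
  have \<Lambda>t: "\<Lambda> s t = lam"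
  proof (rule antisym)
    have "0 \<le> lam" using lam by (simp add: lam_def)
    then show "\<Lambda> s t \<le> lam" using total \<Lambda>[of s t] st by simp
    show "lam \<le> \<Lambda> s t" using pd[of s t] st by (simp add: lam_def ends)
  qed
  define V where "V u = \<Lambda> s u" for u
  have Vmono: "V u \<le> V v" if "s \<le> u" "u \<le> v" "v \<le> t" for u v
    using add[of s u v] \<Lambda>(2)[of u v] that by (simp add: V_def)
  have gV: "norm (g u - g v) \<le> V v - V u" if "s \<le> u" "u \<le> v" "v \<le> t" for u v
    using add[of s u v] \<Lambda>d[of u v] that by (simp add: V_def)
  \<comment> \<open>the arc length is continuous, since replacing the piece of $g$ over $[u,v]$ by a projected chord
    does not give a shorter curve\<close>
  have Vg: "V v - V u \<le> 2 * norm (g u - g v)" if uv: "s \<le> u" "u \<le> v" "v \<le> t" and small: "norm (g u - g v) \<le> R" for u v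
  proof -
    define e where "e = norm (g u - g v)"
    have e: "0 \<le> e" "e \<le> R" using small by (auto simp: e_def)
    obtain L1 x1 where 1: "unit_path A (g s) (g u) L1 x1" using sub(1)[of s u] uv by auto
    obtain L2 x2 where 2: "unit_path A (g u) (g v) L2 x2" using sub(1)[of u v] uv by auto
    obtain L3 x3 where 3: "unit_path A (g v) (g t) L3 x3" using sub(1)[of v t] uv by auto
    have "lam \<le> path_dist A (g s) (g u) + path_dist A (g u) (g t)"
      using path_dist_triangle[OF 1 unit_path_join[OF 2 3]] by (simp add: lam_def ends)
    also have "path_dist A (g u) (g t) \<le> path_dist A (g u) (g v) + path_dist A (g v) (g t)"
      by (rule path_dist_triangle[OF 2 3])
    also have "path_dist A (g u) (g v) \<le> e / (1 - e / (2 * R))"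
      unfolding e_def using gA uv small R by (intro path_dist_le_chord[OF R feet]) auto
    also have "e / (1 - e / (2 * R)) \<le> e / (1 / 2)"
    proof (rule divide_left_mono)
      show "1 / 2 \<le> 1 - e / (2 * R)" using e R by (simp add: field_simps)
      then show "0 < (1 - e / (2 * R)) * (1 / 2)" by auto
    qed (use e in simp)
    finally have "lam \<le> \<Lambda> s u + 2 * e + \<Lambda> v t" using pd[of s u] pd[of v t] uv by simp
    moreover have "\<Lambda> s v + \<Lambda> v t \<le> lam" using add[of s v t] \<Lambda>t uv by simp
    ultimately show ?thesis by (simp add: V_def e_def)
  qed
  have Vcont: "continuous_on {s..t} V"
    unfolding continuous_on_iff
  proof (intro ballI allI impI)
    fix u and e :: real assume u: "u \<in> {s..t}" and e: "e > 0"
    have "min R (e / 3) > 0" using R e by simp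
    then obtain d where d: "d > 0" "\<And>v. v \<in> {s..t} \<Longrightarrow> dist v u < d \<Longrightarrow> dist (g v) (g u) < min R (e / 3)"
      using cont u unfolding continuous_on_iff by meson
    have "dist (V v) (V u) < e" if v: "v \<in> {s..t}" "dist v u < d" for v
    proof -
      have n: "norm (g v - g u) < R" "norm (g v - g u) < e / 3" "norm (g u - g v) = norm (g v - g u)"
        using d(2)[OF v] by (auto simp: dist_norm norm_minus_commute)
      show ?thesis
      proof (cases "u \<le> v")
        case True
        then show ?thesis using Vg[of u v] Vmono[of u v] u v n e by (simp add: dist_real_def)
      next
        case False
        then show ?thesis using Vg[of v u] Vmono[of v u] u v n e by (simp add: dist_real_def)
      qed
    qed
    then show "\<exists>d>0. \<forall>v\<in>{s..t}. dist v u < d \<longrightarrow> dist (V v) (V u) < e" using d(1) by blast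
  qed
  have "0 \<le> V s" and "V s + V s \<le> V s" using \<Lambda>(2)[of s s] add[of s s s] st by (auto simp: V_def)
  then have V0: "V s = 0" by simp
  have Vt: "V t = lam" using \<Lambda>t by (simp add: V_def)
  have Vimg: "V ` {s..t} = {0..lam}"
  proof
    show "V ` {s..t} \<subseteq> {0..lam}"
      using Vmono[of s] Vmono[of _ t] st unfolding V0 Vt by (auto simp: image_subset_iff)
    show "{0..lam} \<subseteq> V ` {s..t}"
    proof
      fix r assume r: "r \<in> {0..lam}"
      then have "\<exists>u\<ge>s. u \<le> t \<and> V u = r" using st Vcont V0 Vt by (intro IVT') auto
      then show "r \<in> V ` {s..t}" by auto
    qed
  qed
  \<comment> \<open>Any preimage will do, since \<open>gV\<close> makes \<open>g\<close> constant on
    the fibres of \<open>V\<close>.\<close>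
  define inv where "inv r = (SOME u. u \<in> {s..t} \<and> V u = r)" for r
  have inv: "inv r \<in> {s..t} \<and> V (inv r) = r" if "r \<in> {0..lam}" for r
  proof -
    have "r \<in> V ` {s..t}" using that Vimg by simp
    then have "\<exists>u. u \<in> {s..t} \<and> V u = r" by blast
    then show ?thesis unfolding inv_def by (rule someI_ex)
  qed
  define h where "h r = g (inv r)" for r
  have gh: "g u = h (V u)" if u: "u \<in> {s..t}" for u
  proof -
    define w where "w = inv (V u)"
    have w: "w \<in> {s..t}" "V w = V u" using inv[of "V u"] imageI[OF u, of V] unfolding Vimg w_def by auto
    have "norm (g u - g w) \<le> 0"
    proof (cases "u \<le> w")
      case True
      then show ?thesis using gV[of u w] u w by simp
    next
      case False
      then show ?thesis using gV[of w u] u w norm_minus_commute[of "g u" "g w"] by simp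
    qed
    then show ?thesis by (simp add: h_def w_def)
  qed
  have lip: "norm (h r' - h r) \<le> r' - r" if r: "0 \<le> r" "r \<le> r'" "r' \<le> lam" for r r'
  proof (cases "inv r \<le> inv r'")
    case True
    then show ?thesis using gV[of "inv r" "inv r'"] inv[of r] inv[of r'] r
        norm_minus_commute[of "g (inv r)" "g (inv r')"] by (simp add: h_def)
  next
    case False
    then have "norm (g (inv r') - g (inv r)) \<le> r - r'" using gV[of "inv r'" "inv r"] inv[of r] inv[of r'] r by simp
    then show ?thesis using r by (simp add: h_def)
  qed
  have "unit_path A a b lam h"
    unfolding unit_path_def
  proof (intro conjI allI impI)
    show "0 \<le> lam" using lam by (simp add: lam_def)
    show "h 0 = a" "h lam = b" using gh[of s] gh[of t] V0 Vt ends st by simp_all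
    show "h ` {0..lam} \<subseteq> A" using inv gA by (auto simp: h_def)
  qed (rule lip)
  moreover have "reparametrization_of s t g 0 lam h"
    unfolding reparametrization_of_def
    using Vcont Vimg gh Vmono by (intro exI[of _ V]) (auto simp: mono_on_def)
  ultimately show ?thesis by (auto simp: lam_def)
qed

section \<open>Circle arcs and the theorem\<close>

lemma circle_chord:
  fixes c e f :: "'a::real_inner"
  assumes R: "R > 0" and on: "norm e = 1" "norm f = 1" "e \<bullet> f = 0"
  shows "dist (c + (R * cos u) *\<^sub>R e + (R * sin u) *\<^sub>R f) (c + (R * cos v) *\<^sub>R e + (R * sin v) *\<^sub>R f)
    = 2 * R * \<bar>sin ((u - v) / 2)\<bar>"
proof -
  define X where "X = R * cos u - R * cos v"
  define Y where "Y = R * sin u - R * sin v"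
  have "(c + (R * cos u) *\<^sub>R e + (R * sin u) *\<^sub>R f) - (c + (R * cos v) *\<^sub>R e + (R * sin v) *\<^sub>R f) = X *\<^sub>R e + Y *\<^sub>R f"
    by (simp add: X_def Y_def algebra_simps)
  moreover have "(norm (X *\<^sub>R e + Y *\<^sub>R f))\<^sup>2 = (2 * R * \<bar>sin ((u - v) / 2)\<bar>)\<^sup>2"
  proof -
    have "e \<bullet> e = 1" "f \<bullet> f = 1" using on by (simp_all add: norm_eq_1)
    then have "(norm (X *\<^sub>R e + Y *\<^sub>R f))\<^sup>2 = X\<^sup>2 + Y\<^sup>2"
      unfolding power2_norm_eq_inner using on(3) by (simp add: inner_add inner_commute power2_eq_square)
    also have "\<dots> = R\<^sup>2 * (((cos u)\<^sup>2 + (sin u)\<^sup>2) + ((cos v)\<^sup>2 + (sin v)\<^sup>2) - 2 * cos (u - v))"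
      unfolding X_def Y_def cos_diff by algebra
    also have "cos (u - v) = 1 - 2 * (sin ((u - v) / 2))\<^sup>2" 
    proof -
      have "2 * ((u - v) / 2) = u - v" by simp
      then show ?thesis using cos_double_sin[of "(u - v) / 2"] by metis
    qed
    finally show ?thesis by (simp add: power_mult_distrib)
  qed
  then have "norm (X *\<^sub>R e + Y *\<^sub>R f) = 2 * R * \<bar>sin ((u - v) / 2)\<bar>"
    by (rule power2_eq_imp_eq) (use R in simp_all)
  ultimately show ?thesis by (simp add: dist_norm)
qed

text \<open>Chords are at most as long as arcs, and N equal chords have the total length 2RN |sin((t
  - s)/(2N))|, whose limit is at least R(t - s).\<close>

lemma circle_arc_length:
  fixes g :: "real \<Rightarrow> 'a::real_inner"
  assumes R: "R > 0" and st: "s < t" and on: "norm e = 1" "norm f = 1" "e \<bullet> f = 0"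
    and g: "\<And>x. x \<in> {s..t} \<Longrightarrow> g x = c + (R * cos x) *\<^sub>R e + (R * sin x) *\<^sub>R f"
  shows "curve_length s t g = ennreal (R * (t - s))"
proof (rule antisym)
  have chord: "dist (g u) (g v) = 2 * R * \<bar>sin ((u - v) / 2)\<bar>" if "u \<in> {s..t}" "v \<in> {s..t}" for u v
    using circle_chord[OF R on] g that by simp
  show "curve_length s t g \<le> ennreal (R * (t - s))"
  proof (rule curve_length_le_lipschitz)
    fix u v assume uv: "s \<le> u" "u \<le> v" "v \<le> t"
    have "dist (g u) (g v) = 2 * R * \<bar>sin ((u - v) / 2)\<bar>" using uv by (intro chord) auto
    also have "\<dots> \<le> 2 * R * \<bar>(u - v) / 2\<bar>" using R by (intro mult_left_mono abs_sin_x_le_abs_x) auto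
    also have "\<dots> = R * (v - u)" using uv by simp
    finally show "dist (g u) (g v) \<le> R * (v - u)" .
  qed (use R st in auto)
  show "ennreal (R * (t - s)) \<le> curve_length s t g"
  proof (cases "curve_length s t g")
    case (real l)
    have "2 * R * (real N * sin ((t - s) / 2 / real N)) \<le> l" if N: "N \<ge> 1" for N
    proof -
      define p where "p i = s + real i * ((t - s) / real N)" for i
      have part: "(p, N) \<in> partitions s t" unfolding p_def using st N by (intro grid_partition) auto
      then have pb: "p i \<in> {s..t}" if "i \<le> N" for i using that by (auto simp: partitions_def image_subset_iff)
      have "polyline g (p, N) = (\<Sum>i<N. 2 * R * \<bar>sin ((t - s) / 2 / real N)\<bar>)"
        unfolding polyline_def fst_conv snd_conv
      proof (rule sum.cong)
        fix i assume "i \<in> {..<N}"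
        then have i: "i \<le> N" "Suc i \<le> N" by auto
        have "p (Suc i) = p i + (t - s) / real N" unfolding p_def of_nat_Suc distrib_right by simp
        then have "(t - s) / 2 / real N = (p (Suc i) - p i) / 2" by simp
        then show "dist (g (p i)) (g (p (Suc i))) = 2 * R * \<bar>sin ((t - s) / 2 / real N)\<bar>"
          using chord[OF pb[OF i(2)] pb[OF i(1)]] by (simp only: dist_commute)
      qed simp
      then have "ennreal (real N * (2 * R * \<bar>sin ((t - s) / 2 / real N)\<bar>)) \<le> ennreal l"
        using polyline_le_curve_length[OF part, of g] real by simp
      then have "real N * (2 * R * \<bar>sin ((t - s) / 2 / real N)\<bar>) \<le> l" using real(1) by (simp add: ennreal_le_iff)
      moreover have "real N * (2 * R * sin ((t - s) / 2 / real N)) \<le> real N * (2 * R * \<bar>sin ((t - s) / 2 / real N)\<bar>)"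
        using R by (intro mult_left_mono) auto
      ultimately show ?thesis by (simp add: mult_ac)
    qed
    moreover have "(\<lambda>N. 2 * R * (real N * sin ((t - s) / 2 / real N))) \<longlonglongrightarrow> 2 * R * ((t - s) / 2)"
      by (intro tendsto_intros tendsto_mult_sin_divide)
    ultimately have "2 * R * ((t - s) / 2) \<le> l" by (intro LIMSEQ_le_const2) auto
    then show ?thesis using real by (simp add: ennreal_leI)
  qed simp
qed

text \<open>Half the opening angle y satisfies |a - b| = 2R sin y. On a long arc y exceeds pi/2, and
  arcsin then returns the smaller angle with the same sine.\<close>

lemma circle_arc_between_length_ge:
  fixes a b :: "'a::real_inner"
  assumes R: "R > 0" and g: "circle_arc_between R a b s t g"
  shows "ennreal (2 * R * arcsin (norm (a - b) / (2 * R))) \<le> curve_length s t g"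
proof -
  obtain c e f where st: "s < t" "t - s \<le> 2 * pi" and ends: "g s = a" "g t = b"
    and on: "norm e = 1" "norm f = 1" "e \<bullet> f = 0"
    and gx: "\<And>x. x \<in> {s..t} \<Longrightarrow> g x = c + (R * cos x) *\<^sub>R e + (R * sin x) *\<^sub>R f"
    using g unfolding circle_arc_between_def by blast
  define y where "y = (t - s) / 2"
  have y: "0 < y" "y \<le> pi" using st by (simp_all add: y_def)
  have "dist b a = 2 * R * \<bar>sin y\<bar>"
    using circle_chord[OF R on, of c t s] gx[of s] gx[of t] st ends by (simp add: y_def)
  then have "norm (a - b) / (2 * R) = sin y"
    using R sin_ge_zero[of y] y by (simp add: dist_norm norm_minus_commute)
  moreover have "arcsin (sin y) \<le> y"
  proof (cases "y \<le> pi / 2")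
    case True
    then show ?thesis using y by (simp add: arcsin_sin)
  next
    case False
    then show ?thesis using arcsin_ubound[of "sin y"] by simp
  qed
  ultimately have "2 * R * arcsin (norm (a - b) / (2 * R)) \<le> 2 * R * y" using R by simp
  also have "\<dots> = R * (t - s)" by (simp add: y_def)
  finally show ?thesis using circle_arc_length[OF R st(1) on gx] by (simp add: ennreal_leI)
qed

text \<open>Here the dimension enters: the circle arc lies in a plane through the chord, and if all
  vectors were multiples of f there would be no two independent ones.\<close>

lemma orthogonal_unit_vector:
  fixes f :: "'a::real_inner"
  assumes "\<exists>x y :: 'a. x \<noteq> y \<and> independent {x, y}" and f: "norm f = 1"
  obtains n where "norm n = 1" "n \<bullet> f = 0"
proof -
  obtain x y :: 'a where xy: "x \<noteq> y" "independent {x, y}" using assms(1) by blast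
  have ff: "f \<bullet> f = 1" using f by (simp add: norm_eq_1)
  have "\<exists>z. z - (z \<bullet> f) *\<^sub>R f \<noteq> 0"
  proof (rule ccontr)
    assume "\<not> ?thesis"
    then have "z = (z \<bullet> f) *\<^sub>R f" for z by simp
    then have "{x, y} \<subseteq> span {f}" by (metis singletonI span_base span_mul subsetI)
    then have "card {x, y} \<le> card {f}" using independent_span_bound[of "{f}" "{x, y}"] xy(2) by simp
    then show False using xy(1) by simp
  qed
  then obtain z where z: "z - (z \<bullet> f) *\<^sub>R f \<noteq> 0" by blast
  define w where "w = z - (z \<bullet> f) *\<^sub>R f"
  have "w \<bullet> f = 0" by (simp add: w_def inner_diff_left ff)
  then show thesis using that[of "(1 / norm w) *\<^sub>R w"] z by (simp add: w_def)
qed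

lemma shortest_circle_arc_exists:
  fixes a b :: "'a::real_inner"
  assumes R: "R > 0" and dim: "\<exists>x y :: 'a. x \<noteq> y \<and> independent {x, y}"
    and ab: "a \<noteq> b" "norm (a - b) < 2 * R"
  obtains s t g where "shortest_circle_arc R a b s t g"
    "curve_length s t g = ennreal (2 * R * arcsin (norm (a - b) / (2 * R)))"
proof -
  define d where "d = norm (a - b)"
  define \<theta> where "\<theta> = arcsin (d / (2 * R))"
  define f where "f = (1 / d) *\<^sub>R (b - a)"
  have d: "0 < d" "d < 2 * R" using ab by (simp_all add: d_def)
  have b: "0 < d / (2 * R)" "d / (2 * R) < 1" using d R by auto
  have s\<theta>: "sin \<theta> = d / (2 * R)" using b by (simp add: \<theta>_def)
  have \<theta>: "0 < \<theta>" "\<theta> \<le> pi / 2"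
    using b arcsin_less_arcsin[of 0 "d / (2 * R)"] arcsin_ubound[of "d / (2 * R)"] by (simp_all add: \<theta>_def)
  have nf: "norm f = 1" using d by (simp add: f_def d_def norm_minus_commute)
  obtain n where n: "norm n = 1" "n \<bullet> f = 0" using orthogonal_unit_vector[OF dim nf] .
  \<comment> \<open>The angle is counted from the axis of symmetry \<open>n\<close>, so that
    \<open>a\<close> and \<open>b\<close> have the angles -\<theta> and \<theta>.\<close>
  define c where "c = (1/2) *\<^sub>R (a + b) - (R * cos \<theta>) *\<^sub>R n"
  define g where "g z = c + (R * cos z) *\<^sub>R n + (R * sin z) *\<^sub>R f" for z
  have half: "(R * sin \<theta>) *\<^sub>R f = (1/2) *\<^sub>R (b - a)" using d R by (simp add: s\<theta> f_def)
  have "g \<theta> = (1/2) *\<^sub>R (a + b) + (1/2) *\<^sub>R (b - a)" by (simp add: g_def c_def half)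
  then have g1: "g \<theta> = b" by (simp add: algebra_simps flip: scaleR_add_left)
  have "g (- \<theta>) = (1/2) *\<^sub>R (a + b) - (1/2) *\<^sub>R (b - a)" by (simp add: g_def c_def half)
  then have g0: "g (- \<theta>) = a" by (simp add: algebra_simps flip: scaleR_add_left)
  have "\<exists>c e f. norm e = 1 \<and> norm f = 1 \<and> e \<bullet> f = 0 \<and>
      (\<forall>x\<in>{- \<theta>..\<theta>}. g x = c + (R * cos x) *\<^sub>R e + (R * sin x) *\<^sub>R f)"
    by (rule exI[of _ c], rule exI[of _ n], rule exI[of _ f]) (use n nf in \<open>auto simp: g_def\<close>)
  then have arc: "circle_arc_between R a b (- \<theta>) \<theta> g"
    unfolding circle_arc_between_def using \<theta> g0 g1 by auto
  have len: "curve_length (- \<theta>) \<theta> g = ennreal (2 * R * \<theta>)"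
    using circle_arc_length[OF R _ n(1) nf n(2), of "- \<theta>" \<theta> g c] \<theta> by (simp add: g_def mult_ac)
  have "shortest_circle_arc R a b (- \<theta>) \<theta> g"
    unfolding shortest_circle_arc_def
    using arc len circle_arc_between_length_ge[OF R] by (auto simp: \<theta>_def d_def)
  then show thesis using that len by (simp add: \<theta>_def d_def)
qed

theorem theorem1p1:
  fixes A :: "'a::{real_inner, banach} set" and a b :: 'a and R :: real
  assumes "\<exists>x y :: 'a. x \<noteq> y \<and> independent {x, y}"
    and "R > 0"
    and "proximally_smooth R A"
    and "a \<in> A" and "b \<in> A" and "a \<noteq> b"
    and "norm (a - b) < 2 * R"
  shows "(\<exists>s t g. shortest_curve A a b s t g) \<and>
    (\<forall>s1 t1 g1 s2 t2 g2. shortest_curve A a b s1 t1 g1 \<and> shortest_curve A a b s2 t2 g2 \<longrightarrow>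
       same_up_to_reparametrization s1 t1 g1 s2 t2 g2) \<and>
    (\<forall>s t g. shortest_curve A a b s t g \<longrightarrow>
       proximally_smooth R (g ` {s..t}) \<and>
       (\<exists>s' t' c. shortest_circle_arc R a b s' t' c \<and>
          curve_length s t g \<le> curve_length s' t' c \<and>
          curve_length s' t' c = ennreal (2 * R * arcsin (norm (a - b) / (2 * R)))))"
proof -
  note R = \<open>R > 0\<close>
  define lam where "lam = path_dist A a b"
  have cl: "closed A" using assms(3) by (simp add: proximally_smooth_def)
  have feet: "has_feet R A" using proximally_smooth_has_feet[OF assms(3)] assms(4) by blast
  obtain L0 x0 where ex: "unit_path A a b L0 x0" using crude_path[OF R feet assms(4,5,7)] by blast
  \<comment> \<open>Positive length makes the parameter segment [0, lam] non-degenerate, as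
    \<open>curve\<close> demands.\<close>
  have "0 < norm (a - b)" using assms(6) by simp
  also have "\<dots> \<le> lam" unfolding lam_def by (rule path_dist_ge_norm[OF ex])
  finally have lam0: "0 < lam" .
  have lam1: "lam \<le> 2 * R * arcsin (norm (a - b) / (2 * R))"
    unfolding lam_def by (rule path_dist_le_arcsin[OF R feet assms(4,5,7)])
  \<comment> \<open>Strictness of |a - b| < 2R puts \<open>lam\<close> strictly below pi R, where
    the comparison with Wirtinger's inequality works.\<close>
  have "arcsin (norm (a - b) / (2 * R)) < arcsin 1"
    using assms(7) R by (intro arcsin_less_arcsin) (auto intro: order_trans[of _ 0])
  then have "2 * R * arcsin (norm (a - b) / (2 * R)) < 2 * R * (pi / 2)" using R by simp
  then have lam2: "path_dist A a b < pi * R" using lam1 by (simp add: lam_def mult.commute)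
  obtain x where x: "unit_path A a b lam x"
    using shortest_unit_path_exists[OF R feet cl lam2 ex] by (auto simp: lam_def)
  have xc: "curve_between A a b 0 lam x" by (rule unit_path_curve_between[OF x lam0])
  have xl: "curve_length 0 lam x \<le> ennreal lam" by (rule unit_path_curve_length_le[OF x])
  have shortest: "shortest_curve A a b 0 lam x"
    unfolding shortest_curve_def
  proof (intro conjI allI impI)
    show "curve_length 0 lam x < \<infinity>" using xl by (simp add: order_le_less_trans)
    fix s t g assume g: "curve_between A a b s t g"
    then have "ennreal lam \<le> curve_length s t g"
      using path_dist_le_curve_length(2)[OF R feet, of s t g] by (auto simp: curve_between_def curve_def lam_def)
    then show "curve_length 0 lam x \<le> curve_length s t g" using xl by simp
  qed (rule xc)
  \<comment> \<open>All shortest curves are reparametrizations of the one path \<open>x\<close>: it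
    serves as the common curve in the uniqueness claim, and all images coincide with its
    image.\<close>
  have rep: "curve_length s t g \<le> ennreal lam \<and> reparametrization_of s t g 0 lam x" if g: "shortest_curve A a b s t g" for s t g
  proof -
    have "curve_length s t g \<le> curve_length 0 lam x" using g xc by (auto simp: shortest_curve_def)
    then have len: "curve_length s t g \<le> ennreal lam" using xl by simp
    obtain h where h: "unit_path A a b lam h" "reparametrization_of s t g 0 lam h"
      using shortest_curve_arclength[OF R feet, of a b s t g] g len lam0 by (auto simp: shortest_curve_def lam_def)
    have "h r = x r" if "r \<in> {0..lam}" for r
      using shortest_unit_path_unique[OF R feet lam2] h(1) x that by (simp add: lam_def)
    then have "reparametrization_of s t g 0 lam x"
      using h(2) unfolding reparametrization_of_def by (metis imageI)
    then show ?thesis using len by blast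
  qed
  have image: "g ` {s..t} = x ` {0..lam}" if re: "reparametrization_of s t g 0 lam x" for s t g
  proof -
    obtain \<phi> where \<phi>: "\<phi> ` {s..t} = {0..lam}" "\<forall>u\<in>{s..t}. g u = x (\<phi> u)"
      using re unfolding reparametrization_of_def by blast
    have "g ` {s..t} = x ` (\<phi> ` {s..t})" unfolding image_image using \<phi>(2) by (intro image_cong) auto
    then show ?thesis using \<phi>(1) by simp
  qed
  have smooth: "proximally_smooth R (x ` {0..lam})"
    using shortest_path_image_has_feet[OF R feet x[unfolded lam_def] lam2]
    by (intro has_feet_proximally_smooth[OF R]) (auto simp: lam_def compact_imp_closed)
  obtain s' t' c where arc: "shortest_circle_arc R a b s' t' c"
      "curve_length s' t' c = ennreal (2 * R * arcsin (norm (a - b) / (2 * R)))"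
    using shortest_circle_arc_exists[OF R assms(1,6,7)] .
  have "curve 0 lam x" using xc by (simp add: curve_between_def)
  then have "same_up_to_reparametrization s1 t1 g1 s2 t2 g2"
    if "shortest_curve A a b s1 t1 g1" "shortest_curve A a b s2 t2 g2" for s1 t1 g1 s2 t2 g2
    using rep[OF that(1)] rep[OF that(2)] unfolding same_up_to_reparametrization_def by blast
  moreover have "proximally_smooth R (g ` {s..t}) \<and> (\<exists>s' t' c. shortest_circle_arc R a b s' t' c \<and>
          curve_length s t g \<le> curve_length s' t' c \<and>
          curve_length s' t' c = ennreal (2 * R * arcsin (norm (a - b) / (2 * R))))"
    if g: "shortest_curve A a b s t g" for s t g
  proof -
    have "curve_length s t g \<le> ennreal lam" using rep[OF g] by blast
    also have "\<dots> \<le> curve_length s' t' c" unfolding arc(2) using lam1 by (rule ennreal_leI)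
    finally show ?thesis using arc image rep[OF g] smooth by metis
  qed
  ultimately show ?thesis using shortest by blast
qed

end
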